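(* Let $\Bbbk$ be a field, $H$ a Hopf algebra over $\Bbbk$ with bijective antipode, $A$ a braided Hopf algebra in ${}^H_H\mathcal{YD}$, and $K$ a left coideal subalgebra of $A$ in ${}^H\mathcal{M}$. Assume that $H$ is cosemisimple. (1) Assume that any non-zero Hopf module $V$ in ${}^A({}^H\mathcal{M})_K$ contains a non-zero Hopf submodule which is $K$-free in ${}^H\mathcal{M}$. Then any Hopf module in ${}^A({}^H\mathcal{M})_K$ is $K$-free in ${}^H\mathcal{M}$. (2) Assume that $A$ is pointed and that (a) $g^{-1}\in K$ for all $g\in G(A)\cap K$, (b) for all $g\in G(A)$, the subspace $\Bbbk g\subseteq A$ is a left $H$-subcomodule (i.e. ${}^H\delta_A(g)=1\otimes g$), (c) for all $g\in G(A)$, $\Bbbk g$ is a left $H$-submodule of $A$. Then any Hopf module in ${}^A({}^H\mathcal{M})_K$ is $K$-free in ${}^H\mathcal{M}$.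
   Context: All tensor products are over $\Bbbk$. ${}^H\mathcal{M}$ is the monoidal category of left $H$-comodules with diagonal coaction on tensor products. ${}^H_H\mathcal{YD}$ is the braided monoidal category of Yetter-Drinfeld modules: left $H$-modules and left $H$-comodules $V$ with ${}^H\delta(h\cdot v)=h_{(1)}v_{(-1)}S(h_{(3)})\otimes h_{(2)}\cdot v_{(0)}$, with braiding $c(v\otimes w)=v_{(-1)}\cdot w\otimes v_{(0)}$. A braided Hopf algebra in ${}^H_H\mathcal{YD}$ is a Hopf algebra object of this braided category: all structure maps are morphisms in ${}^H_H\mathcal{YD}$, and $\Delta$ is an algebra map to $A\otimes A$ with product $(a\otimes b)(a'\otimes b')=a(b_{(-1)}\cdot a')\otimes b_{(0)}b'$. $A$ is pointed if all its simple subcoalgebras are one-dimensional. $G(A)$ is the set of group-like elements of $A$; each $g\in G(A)$ is invertible in $A$ with $g^{-1}=S(g)$. $H$ is cosemisimple if every $H$-comodule is a direct sum of simple comodules. A left coideal subalgebra $K$ of $A$ in ${}^H\mathcal{M}$ is a subalgebra (containing $1$) that is a left $H$-subcomodule of $A$ with $\Delta(K)\subseteq A\otimes K$. For a left $H$-comodule $V$, let $c:V\otimes A\to A\otimes V$, $c(v\otimes a)=v_{(-1)}\cdot a\otimes v_{(0)}$. If $V$ is a right $K$-module in ${}^H\mathcal{M}$ (i.e. with left $H$-colinear action $\lambda_{V,K}:V\otimes K\to V$), then $A\otimes V$ is a right $K$-module in ${}^H\mathcal{M}$ by the (half) braided diagonal action $(\mu_A\otimes\lambda_{V,K})(\mathrm{id}_A\otimes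 c\otimes\mathrm{id}_K)(\mathrm{id}_{A\otimes V}\otimes\Delta|_K):A\otimes V\otimes K\to A\otimes V$, where $\mu_A$ is the multiplication of $A$. A Hopf module in ${}^A({}^H\mathcal{M})_K$ is a left $H$-comodule $V$ which is a left $A$-comodule and a right $K$-module with left $H$-colinear structure maps, such that ${}^A\delta_V:V\to A\otimes V$ is right $K$-linear, where $A\otimes V$ carries the (half) braided diagonal action. Morphisms in ${}^A({}^H\mathcal{M})_K$ are the left $H$-colinear, left $A$-colinear and right $K$-linear maps; a Hopf submodule is a subspace stable under all structures. A right $K$-module $M$ in ${}^H\mathcal{M}$ is called $K$-free in ${}^H\mathcal{M}$ if there is an $H$-subcomodule $N\subseteq M$ such that the restricted $K$-module structure map $N\otimes K\to M$ is bijective. *)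

theory Defs
  imports Complex_Main "HOL-Library.Function_Algebras"
begin

section \<open>Vector spaces and tensor products\<close>

text \<open>
  A vector space over \<open>'k\<close> is a subspace \<open>vcar V\<close> of a type \<open>'v\<close> which as a whole is
  a vector space for \<open>vscale V\<close>.  Every vector space is of this form (take \<open>vcar V = UNIV\<close>);
  carriers are kept so that subspaces are again objects, and so that quotients of \<open>V\<close>,
  realised on complements, are objects over the same type.
\<close>

record ('k, 'v) vspace =
  vcar :: "'v set"
  vscale :: "'k \<Rightarrow> 'v \<Rightarrow> 'v"

definition is_vspace :: "('k::field, 'v::ab_group_add, 'z) vspace_scheme \<Rightarrow> bool" where
  "is_vspace V \<longleftrightarrow> vector_space (vscale V) \<and> module.subspace (vscale V) (vcar V)"

definition sub :: "('k, 'v, 'z) vspace_scheme \<Rightarrow> 'v set \<Rightarrow> ('k, 'v) vspace" where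
  "sub V N = \<lparr>vcar = N, vscale = vscale V\<rparr>"

abbreviation whole :: "('k, 'v, 'z) vspace_scheme \<Rightarrow> ('k, 'v) vspace" where
  "whole V \<equiv> sub V UNIV"

definition is_subspace ::
  "('k::field, 'v::ab_group_add, 'z) vspace_scheme \<Rightarrow> 'v set \<Rightarrow> bool" where
  "is_subspace V N \<longleftrightarrow> N \<subseteq> vcar V \<and> module.subspace (vscale V) N"

definition base :: "('k::field, 'k) vspace" where
  "base = \<lparr>vcar = UNIV, vscale = (*)\<rparr>"

definition lin ::
  "('k, 'v::ab_group_add, 'y) vspace_scheme \<Rightarrow> ('k, 'w::ab_group_add, 'z) vspace_scheme
    \<Rightarrow> ('v \<Rightarrow> 'w) \<Rightarrow> bool" where
  "lin V W f \<longleftrightarrow>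
     (\<forall>x \<in> vcar V. f x \<in> vcar W) \<and>
     (\<forall>x \<in> vcar V. \<forall>y \<in> vcar V. f (x + y) = f x + f y) \<and>
     (\<forall>c. \<forall>x \<in> vcar V. f (vscale V c x) = vscale W c (f x))"

definition bilin ::
  "('k, 'v::ab_group_add, 'x) vspace_scheme \<Rightarrow> ('k, 'w::ab_group_add, 'y) vspace_scheme
    \<Rightarrow> ('k, 'u::ab_group_add, 'z) vspace_scheme \<Rightarrow> ('v \<Rightarrow> 'w \<Rightarrow> 'u) \<Rightarrow> bool" where
  "bilin V W U B \<longleftrightarrow>
     (\<forall>v \<in> vcar V. lin W U (B v)) \<and> (\<forall>w \<in> vcar W. lin V U (\<lambda>v. B v w))"

text \<open>
  The pure tensor of \<open>v\<close> and \<open>w\<close> is the evaluation functional \<open>B \<mapsto> B v w\<close> on the bilinear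
  forms on the two ambient spaces, and the tensor product is the span of the pure tensors.  Over
  a field this is the usual tensor product (universal property: \<open>tlift_tens\<close>,
  \<open>lin_tlift\<close>, \<open>lin_tensor_eqI\<close> below).  Since the ambient spaces are used, for
  subspaces \<open>N\<close>, \<open>M\<close> of \<open>V\<close>, \<open>W\<close> the tensor product of \<open>N\<close> and \<open>M\<close> is literally a subset of
  that of \<open>V\<close> and \<open>W\<close>.
\<close>

type_synonym ('k, 'v, 'w) tensor = "('v \<Rightarrow> 'w \<Rightarrow> 'k) \<Rightarrow> 'k"

definition tens ::
  "('k::field, 'v::ab_group_add, 'y) vspace_scheme \<Rightarrow> ('k, 'w::ab_group_add, 'z) vspace_scheme
    \<Rightarrow> 'v \<Rightarrow> 'w \<Rightarrow> ('k, 'v, 'w) tensor" where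
  "tens V W v w = (\<lambda>B. if bilin (whole V) (whole W) base B then B v w else 0)"

definition tscale :: "'k::field \<Rightarrow> ('k, 'v, 'w) tensor \<Rightarrow> ('k, 'v, 'w) tensor" where
  "tscale c t = (\<lambda>B. c * t B)"

definition tensor_space ::
  "('k::field, 'v::ab_group_add, 'y) vspace_scheme \<Rightarrow> ('k, 'w::ab_group_add, 'z) vspace_scheme
    \<Rightarrow> ('k, ('k, 'v, 'w) tensor) vspace" (infixr "\<otimes>" 75) where
  "V \<otimes> W =
     \<lparr>vcar = module.span tscale {tens V W v w | v w. v \<in> vcar V \<and> w \<in> vcar W},
      vscale = tscale\<rparr>"

text \<open>
  The map on \<open>V \<otimes> W\<close> induced by a map \<open>B\<close> that is bilinear on \<open>vcar V\<close> and \<open>vcar W\<close>.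
  Sweedler-type expressions are written with it: a summation over \<open>t = \<Sum> v \<otimes> w\<close> of
  \<open>B v w\<close> is \<open>tlift V W B t\<close>.
\<close>

definition tlift ::
  "('k::field, 'v::ab_group_add, 'y) vspace_scheme \<Rightarrow> ('k, 'w::ab_group_add, 'z) vspace_scheme
    \<Rightarrow> ('v \<Rightarrow> 'w \<Rightarrow> 'u::ab_group_add) \<Rightarrow> ('k, 'v, 'w) tensor \<Rightarrow> 'u" where
  "tlift V W B t =
     (THE x. \<exists>ps. set ps \<subseteq> vcar V \<times> vcar W \<and>
        t = (\<Sum>(v, w) \<leftarrow> ps. tens V W v w) \<and> x = (\<Sum>(v, w) \<leftarrow> ps. B v w))"

definition tmap ::
  "('k::field, 'v::ab_group_add, 'x1) vspace_scheme \<Rightarrow> ('k, 'w::ab_group_add, 'x2) vspace_scheme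
    \<Rightarrow> ('k, 'v'::ab_group_add, 'x3) vspace_scheme \<Rightarrow> ('k, 'w'::ab_group_add, 'x4) vspace_scheme
    \<Rightarrow> ('v \<Rightarrow> 'v') \<Rightarrow> ('w \<Rightarrow> 'w') \<Rightarrow> ('k, 'v, 'w) tensor \<Rightarrow> ('k, 'v', 'w') tensor" where
  "tmap V W V' W' f g = tlift V W (\<lambda>v w. tens V' W' (f v) (g w))"

definition tassoc ::
  "('k::field, 'u::ab_group_add, 'x) vspace_scheme \<Rightarrow> ('k, 'v::ab_group_add, 'y) vspace_scheme
    \<Rightarrow> ('k, 'w::ab_group_add, 'z) vspace_scheme
    \<Rightarrow> ('k, ('k, 'u, 'v) tensor, 'w) tensor \<Rightarrow> ('k, 'u, ('k, 'v, 'w) tensor) tensor" where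
  "tassoc U V W =
     tlift (U \<otimes> V) W (\<lambda>t w. tlift U V (\<lambda>u v. tens U (V \<otimes> W) u (tens V W v w)) t)"

subsection \<open>Universal property of the tensor product\<close>

lemma vector_space_tscale:
  "vector_space (tscale :: 'k::field \<Rightarrow> ('k, 'v, 'w) tensor \<Rightarrow> ('k, 'v, 'w) tensor)"
  by unfold_locales (auto simp: tscale_def fun_eq_iff algebra_simps)

lemma is_vspace_tensor:
  fixes V :: "('k::field, 'v::ab_group_add, 'y) vspace_scheme"
    and W :: "('k, 'w::ab_group_add, 'z) vspace_scheme"
  shows "is_vspace (V \<otimes> W)"
proof -
  interpret T: vector_space "tscale :: 'k \<Rightarrow> ('k, 'v, 'w) tensor \<Rightarrow> ('k, 'v, 'w) tensor"
    by (rule vector_space_tscale)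
  show ?thesis
    using vector_space_tscale T.subspace_span by (auto simp: is_vspace_def tensor_space_def)
qed

lemma lin_sum_list:
  assumes V: "is_vspace V" and f: "lin V W f" and xs: "\<And>x. x \<in> set xs \<Longrightarrow> g x \<in> vcar V"
  shows "f (\<Sum>x \<leftarrow> xs. g x) = (\<Sum>x \<leftarrow> xs. f (g x)) \<and> (\<Sum>x \<leftarrow> xs. g x) \<in> vcar V"
proof -
  interpret V: vector_space "vscale V" using V by (simp add: is_vspace_def)
  have s: "V.subspace (vcar V)" using V by (simp add: is_vspace_def)
  have z: "f 0 = 0"
    using f V.subspace_0[OF s] by (metis add_cancel_right_left lin_def)
  show ?thesis using xs
  proof (induction xs)
    case Nil then show ?case using z V.subspace_0[OF s] by simp
  next
    case (Cons a xs)
    then show ?case using f V.subspace_add[OF s] by (simp add: lin_def)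
  qed
qed

lemma tens_add1: "tens V W (x + y) w = tens V W x w + tens V W y w"
  by (auto simp: tens_def fun_eq_iff bilin_def lin_def sub_def)

lemma tens_add2: "tens V W v (x + y) = tens V W v x + tens V W v y"
  by (auto simp: tens_def fun_eq_iff bilin_def lin_def sub_def)

lemma tens_scale1: "tens V W (vscale V c x) w = tscale c (tens V W x w)"
  by (auto simp: tens_def fun_eq_iff bilin_def lin_def sub_def base_def tscale_def)

lemma tens_scale2: "tens V W v (vscale W c x) = tscale c (tens V W v x)"
  by (auto simp: tens_def fun_eq_iff bilin_def lin_def sub_def base_def tscale_def)

lemma tens_in: "v \<in> vcar V \<Longrightarrow> w \<in> vcar W \<Longrightarrow> tens V W v w \<in> vcar (V \<otimes> W)"
  using vector_space_tscale
  by (auto simp: tensor_space_def module_iff_vector_space intro!: module.span_base)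

lemma tensor_rep:
  fixes V :: "('k::field, 'v::ab_group_add, 'y) vspace_scheme"
    and W :: "('k, 'w::ab_group_add, 'z) vspace_scheme"
  assumes V: "is_vspace V" and t: "t \<in> vcar (V \<otimes> W)"
  shows "\<exists>ps. set ps \<subseteq> vcar V \<times> vcar W \<and> t = (\<Sum>(v, w) \<leftarrow> ps. tens V W v w)"
proof -
  interpret V: vector_space "vscale V" using V by (simp add: is_vspace_def)
  interpret T: vector_space "tscale :: 'k \<Rightarrow> ('k, 'v, 'w) tensor \<Rightarrow> ('k, 'v, 'w) tensor"
    by (rule vector_space_tscale)
  have s: "V.subspace (vcar V)" using V by (simp add: is_vspace_def)
  have "t \<in> T.span {tens V W v w | v w. v \<in> vcar V \<and> w \<in> vcar W}"
    using t by (simp add: tensor_space_def)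
  then show ?thesis
  proof (induction rule: T.span_induct_alt)
    case base
    show ?case by (rule exI[of _ "[]"]) simp
  next
    case (step c x y)
    then obtain v w ps where x: "x = tens V W v w" "v \<in> vcar V" "w \<in> vcar W"
      and ps: "set ps \<subseteq> vcar V \<times> vcar W" "y = (\<Sum>(v, w) \<leftarrow> ps. tens V W v w)" by blast
    then show ?case
      using V.subspace_scale[OF s, of v c]
      by (intro exI[of _ "(vscale V c v, w) # ps"]) (auto simp: tens_scale1)
  qed
qed

lemma tlift_unique:
  fixes V :: "('k::field, 'v::ab_group_add, 'x) vspace_scheme"
    and W :: "('k, 'w::ab_group_add, 'y) vspace_scheme"
    and U :: "('k, 'u::ab_group_add, 'z) vspace_scheme"
  assumes V: "is_vspace V" and W: "is_vspace W" and U: "is_vspace U" and B: "bilin V W U B"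
    and ps: "set ps \<subseteq> vcar V \<times> vcar W" and qs: "set qs \<subseteq> vcar V \<times> vcar W"
    and eq: "(\<Sum>(v, w) \<leftarrow> ps. tens V W v w) = (\<Sum>(v, w) \<leftarrow> qs. tens V W v w)"
  shows "(\<Sum>(v, w) \<leftarrow> ps. B v w) = (\<Sum>(v, w) \<leftarrow> qs. B v w)"
proof (rule ccontr)
  interpret V: vector_space "vscale V" using V by (simp add: is_vspace_def)
  interpret W: vector_space "vscale W" using W by (simp add: is_vspace_def)
  interpret U: vector_space "vscale U" using U by (simp add: is_vspace_def)
  interpret K: vector_space "(*) :: 'k \<Rightarrow> 'k \<Rightarrow> 'k" by unfold_locales (auto simp: algebra_simps)
  interpret VV: vector_space_pair "vscale V" "vscale V" ..
  interpret WW: vector_space_pair "vscale W" "vscale W" ..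
  interpret UK: vector_space_pair "vscale U" "(*) :: 'k \<Rightarrow> 'k \<Rightarrow> 'k" ..
  have sV: "V.subspace (vcar V)" and sW: "W.subspace (vcar W)"
    using V W by (auto simp: is_vspace_def)
  let ?P = "\<Sum>(v, w) \<leftarrow> ps. B v w" and ?Q = "\<Sum>(v, w) \<leftarrow> qs. B v w"
  assume "?P \<noteq> ?Q"
  then have "U.independent {?P - ?Q}" by simp
  from UK.linear_independent_extend[OF this, of "\<lambda>_. 1"]
  obtain \<phi> where \<phi>: "Vector_Spaces.linear (vscale U) (*) \<phi>" and "\<phi> (?P - ?Q) = 1" by auto
  interpret \<phi>: Vector_Spaces.linear "vscale U" "(*)" \<phi> by (rule \<phi>)
  have ne: "\<phi> ?P \<noteq> \<phi> ?Q" using \<open>\<phi> (?P - ?Q) = 1\<close> by (metis \<phi>.diff diff_self zero_neq_one)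
  obtain p where p: "range p \<subseteq> vcar V" "Vector_Spaces.linear (vscale V) (vscale V) p"
    "\<forall>v \<in> vcar V. p v = v"
    using VV.linear_exists_left_inverse_on[OF V.linear_id sV] by auto
  obtain q where q: "range q \<subseteq> vcar W" "Vector_Spaces.linear (vscale W) (vscale W) q"
    "\<forall>w \<in> vcar W. q w = w"
    using WW.linear_exists_left_inverse_on[OF W.linear_id sW] by auto
  interpret p: Vector_Spaces.linear "vscale V" "vscale V" p by (rule p)
  interpret q: Vector_Spaces.linear "vscale W" "vscale W" q by (rule q)
  define F where "F = (\<lambda>v w. \<phi> (B (p v) (q w)))"
  have pV: "p v \<in> vcar V" and qW: "q w \<in> vcar W" for v w using p(1) q(1) by auto
  have B1: "B v (x + y) = B v x + B v y" "B v (vscale W c x) = vscale U c (B v x)"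
    if "v \<in> vcar V" "x \<in> vcar W" "y \<in> vcar W" for v x y c
    using B that unfolding bilin_def lin_def by blast+
  have B2: "B (x + y) w = B x w + B y w" "B (vscale V c x) w = vscale U c (B x w)"
    if "w \<in> vcar W" "x \<in> vcar V" "y \<in> vcar V" for w x y c
    using B that unfolding bilin_def lin_def by blast+
  have F: "bilin (whole V) (whole W) base F"
    unfolding bilin_def lin_def
    by (simp add: F_def sub_def base_def p.add q.add p.scale q.scale
        B1[OF pV qW qW] B2[OF qW pV pV] \<phi>.add \<phi>.scale)
  have val: "(\<Sum>(v, w) \<leftarrow> rs. tens V W v w) F = \<phi> (\<Sum>(v, w) \<leftarrow> rs. B v w)"
    if "set rs \<subseteq> vcar V \<times> vcar W" for rs
    using that
  proof (induction rs)
    case Nil then show ?case by (simp add: \<phi>.zero)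
  next
    case (Cons a rs)
    then show ?case using F p(3) q(3) by (cases a) (auto simp: tens_def \<phi>.add F_def)
  qed
  show False using val[OF ps] val[OF qs] eq ne by simp
qed

lemma tlift_rep:
  assumes "is_vspace V" "is_vspace W" "is_vspace U" "bilin V W U B"
    and "set ps \<subseteq> vcar V \<times> vcar W"
  shows "tlift V W B (\<Sum>(v, w) \<leftarrow> ps. tens V W v w) = (\<Sum>(v, w) \<leftarrow> ps. B v w)"
  unfolding tlift_def
proof (rule the_equality)
  fix x
  assume "\<exists>qs. set qs \<subseteq> vcar V \<times> vcar W \<and>
    (\<Sum>(v, w) \<leftarrow> ps. tens V W v w) = (\<Sum>(v, w) \<leftarrow> qs. tens V W v w) \<and>
    x = (\<Sum>(v, w) \<leftarrow> qs. B v w)"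
  then obtain qs where "set qs \<subseteq> vcar V \<times> vcar W"
    "(\<Sum>(v, w) \<leftarrow> ps. tens V W v w) = (\<Sum>(v, w) \<leftarrow> qs. tens V W v w)"
    "x = (\<Sum>(v, w) \<leftarrow> qs. B v w)" by (elim exE conjE)
  then show "x = (\<Sum>(v, w) \<leftarrow> ps. B v w)" using tlift_unique[OF assms(1-5)] by simp
qed (use assms(5) in \<open>intro exI[of _ ps], simp\<close>)

lemma tlift_tens:
  assumes "is_vspace V" "is_vspace W" "is_vspace U" "bilin V W U B" "v \<in> vcar V" "w \<in> vcar W"
  shows "tlift V W B (tens V W v w) = B v w"
  using tlift_rep[OF assms(1-4), of "[(v, w)]"] assms(5,6) by simp

lemma lin_tlift:
  fixes V :: "('k::field, 'v::ab_group_add, 'x) vspace_scheme"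
    and W :: "('k, 'w::ab_group_add, 'y) vspace_scheme"
    and U :: "('k, 'u::ab_group_add, 'z) vspace_scheme"
  assumes V: "is_vspace V" and W: "is_vspace W" and U: "is_vspace U" and B: "bilin V W U B"
  shows "lin (V \<otimes> W) U (tlift V W B)"
proof -
  interpret V: vector_space "vscale V" using V by (simp add: is_vspace_def)
  interpret U: vector_space "vscale U" using U by (simp add: is_vspace_def)
  interpret T: vector_space "tscale :: 'k \<Rightarrow> ('k, 'v, 'w) tensor \<Rightarrow> ('k, 'v, 'w) tensor"
    by (rule vector_space_tscale)
  have sV: "V.subspace (vcar V)" and sU: "U.subspace (vcar U)"
    using V U by (auto simp: is_vspace_def)
  have BU: "(\<Sum>(v, w) \<leftarrow> ps. B v w) \<in> vcar U" if "set ps \<subseteq> vcar V \<times> vcar W" for ps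
    using that B
    by (induction ps) (auto simp: bilin_def lin_def intro!: U.subspace_0[OF sU] U.subspace_add[OF sU])
  note rep = tlift_rep[OF V W U B]
  show ?thesis
    unfolding lin_def
  proof (intro conjI ballI allI)
    fix x assume "x \<in> vcar (V \<otimes> W)"
    then obtain ps where ps: "set ps \<subseteq> vcar V \<times> vcar W" "x = (\<Sum>(v, w) \<leftarrow> ps. tens V W v w)"
      using tensor_rep[OF V] by blast
    then show "tlift V W B x \<in> vcar U" using rep BU by simp
    fix c
    define rs where "rs = map (\<lambda>(v, w). (vscale V c v, w)) ps"
    have rs: "set rs \<subseteq> vcar V \<times> vcar W"
      using ps(1) V.subspace_scale[OF sV] by (auto simp: rs_def)
    have "(\<Sum>(v, w) \<leftarrow> rs. tens V W v w) = tscale c x"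
      unfolding ps(2) rs_def by (induction ps) (auto simp: tens_scale1 tscale_def fun_eq_iff algebra_simps)
    moreover have "(\<Sum>(v, w) \<leftarrow> rs. B v w) = vscale U c (\<Sum>(v, w) \<leftarrow> ps. B v w)"
      using ps(1) B unfolding rs_def
      by (induction ps) (auto simp: U.scale_right_distrib bilin_def lin_def)
    ultimately show "tlift V W B (vscale (V \<otimes> W) c x) = vscale U c (tlift V W B x)"
      using rep[OF rs] rep[OF ps(1)] ps(2) by (simp add: tensor_space_def)
  next
    fix x y assume "x \<in> vcar (V \<otimes> W)" "y \<in> vcar (V \<otimes> W)"
    from tensor_rep[OF V this(1)] tensor_rep[OF V this(2)] obtain ps qs
      where ps: "set ps \<subseteq> vcar V \<times> vcar W" "x = (\<Sum>(v, w) \<leftarrow> ps. tens V W v w)"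
        and qs: "set qs \<subseteq> vcar V \<times> vcar W" "y = (\<Sum>(v, w) \<leftarrow> qs. tens V W v w)"
      by blast
    have "tlift V W B (x + y) = (\<Sum>(v, w) \<leftarrow> ps @ qs. B v w)"
      using rep[of "ps @ qs"] ps qs by simp
    then show "tlift V W B (x + y) = tlift V W B x + tlift V W B y"
      using rep ps qs by simp
  qed
qed

lemma lin_tensor_eqI:
  assumes V: "is_vspace V" and f: "lin (V \<otimes> W) U f" and g: "lin (V \<otimes> W) U g"
    and eq: "\<And>v w. v \<in> vcar V \<Longrightarrow> w \<in> vcar W \<Longrightarrow> f (tens V W v w) = g (tens V W v w)"
    and t: "t \<in> vcar (V \<otimes> W)"
  shows "f t = g t"
proof -
  obtain ps where ps: "set ps \<subseteq> vcar V \<times> vcar W" "t = (\<Sum>(v, w) \<leftarrow> ps. tens V W v w)"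
    using tensor_rep[OF V t] by blast
  have mem: "case_prod (tens V W) x \<in> vcar (V \<otimes> W)" if "x \<in> set ps" for x
    using that ps(1) tens_in[of "fst x" V "snd x" W] by (cases x) auto
  have "f t = (\<Sum>x \<leftarrow> ps. f (case_prod (tens V W) x))"
    using lin_sum_list[OF is_vspace_tensor f, of ps, OF mem] ps(2) by simp
  also have "\<dots> = (\<Sum>x \<leftarrow> ps. g (case_prod (tens V W) x))"
    using ps(1) eq by (intro arg_cong[of _ _ sum_list] map_cong) auto
  also have "\<dots> = g t"
    using lin_sum_list[OF is_vspace_tensor g, of ps, OF mem] ps(2) by simp
  finally show ?thesis .
qed

section \<open>Coalgebras, comodules, Hopf algebras\<close>

record ('k, 'c) coalg = "('k, 'c) vspace" +
  comult :: "'c \<Rightarrow> ('k, 'c, 'c) tensor"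
  counit :: "'c \<Rightarrow> 'k"

record ('k, 'h) hopf = "('k, 'h) coalg" +
  antipode :: "'h \<Rightarrow> 'h"

definition coalgebra :: "('k::field, 'c::ab_group_add, 'z) coalg_scheme \<Rightarrow> bool" where
  "coalgebra C \<longleftrightarrow>
     is_vspace C \<and> lin C (C \<otimes> C) (comult C) \<and> lin C base (counit C) \<and>
     (\<forall>x \<in> vcar C.
        tassoc C C C (tmap C C (C \<otimes> C) C (comult C) id (comult C x)) =
          tmap C C C (C \<otimes> C) id (comult C) (comult C x) \<and>
        tlift C C (\<lambda>y z. vscale C (counit C y) z) (comult C x) = x \<and>
        tlift C C (\<lambda>y z. vscale C (counit C z) y) (comult C x) = x)"

definition comodule ::
  "('k::field, 'c::ab_group_add, 'y) coalg_scheme \<Rightarrow> ('k, 'v::ab_group_add, 'z) vspace_scheme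
    \<Rightarrow> ('v \<Rightarrow> ('k, 'c, 'v) tensor) \<Rightarrow> bool" where
  "comodule C V \<delta> \<longleftrightarrow>
     is_vspace V \<and> lin V (C \<otimes> V) \<delta> \<and>
     (\<forall>v \<in> vcar V.
        tassoc C C V (tmap C V (C \<otimes> C) V (comult C) id (\<delta> v)) =
          tmap C V C (C \<otimes> V) id \<delta> (\<delta> v) \<and>
        tlift C V (\<lambda>x w. vscale V (counit C x) w) (\<delta> v) = v)"

definition subcomodule ::
  "('k::field, 'c::ab_group_add, 'y) coalg_scheme \<Rightarrow> ('k, 'v::ab_group_add, 'z) vspace_scheme
    \<Rightarrow> ('v \<Rightarrow> ('k, 'c, 'v) tensor) \<Rightarrow> 'v set \<Rightarrow> bool" where
  "subcomodule C V \<delta> N \<longleftrightarrow> is_subspace V N \<and> (\<forall>v \<in> N. \<delta> v \<in> vcar (C \<otimes> sub V N))"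

definition colinear ::
  "('k::field, 'c::ab_group_add, 'x) coalg_scheme
    \<Rightarrow> ('k, 'v::ab_group_add, 'y) vspace_scheme \<Rightarrow> ('v \<Rightarrow> ('k, 'c, 'v) tensor)
    \<Rightarrow> ('k, 'w::ab_group_add, 'z) vspace_scheme \<Rightarrow> ('w \<Rightarrow> ('k, 'c, 'w) tensor)
    \<Rightarrow> ('v \<Rightarrow> 'w) \<Rightarrow> bool" where
  "colinear C V \<delta>V W \<delta>W f \<longleftrightarrow>
     lin V W f \<and> (\<forall>v \<in> vcar V. \<delta>W (f v) = tmap C V C W id f (\<delta>V v))"

definition simple_subcomodule ::
  "('k::field, 'c::ab_group_add, 'y) coalg_scheme \<Rightarrow> ('k, 'v::ab_group_add, 'z) vspace_scheme
    \<Rightarrow> ('v \<Rightarrow> ('k, 'c, 'v) tensor) \<Rightarrow> 'v set \<Rightarrow> bool" where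
  "simple_subcomodule C V \<delta> N \<longleftrightarrow>
     subcomodule C V \<delta> N \<and> N \<noteq> {0} \<and>
     (\<forall>M. subcomodule C V \<delta> M \<and> M \<subseteq> N \<longrightarrow> M = {0} \<or> M = N)"

definition direct_sum_of ::
  "('k::field, 'v::ab_group_add, 'z) vspace_scheme \<Rightarrow> 'v set set \<Rightarrow> bool" where
  "direct_sum_of V \<N> \<longleftrightarrow>
     module.span (vscale V) (\<Union>\<N>) = vcar V \<and>
     (\<forall>N \<in> \<N>. N \<inter> module.span (vscale V) (\<Union>(\<N> - {N})) = {0})"

text \<open>
  A type cannot be quantified inside a formula, so the comodules in this definition are those
  carried by subspaces of the type \<open>'v\<close> passed as first argument.  Where cosemisimplicity is
  assumed, this is implied by the property for comodules of arbitrary size.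
\<close>

definition cosemisimple ::
  "'v::ab_group_add itself \<Rightarrow> ('k::field, 'h::ab_group_add, 'z) coalg_scheme \<Rightarrow> bool" where
  "cosemisimple T H \<longleftrightarrow>
     (\<forall>(V :: ('k, 'v) vspace) \<delta>. comodule H V \<delta> \<longrightarrow>
        (\<exists>\<N>. (\<forall>N \<in> \<N>. simple_subcomodule H V \<delta> N) \<and> direct_sum_of V \<N>))"

definition subcoalgebra ::
  "('k::field, 'c::ab_group_add, 'z) coalg_scheme \<Rightarrow> 'c set \<Rightarrow> bool" where
  "subcoalgebra C D \<longleftrightarrow>
     is_subspace C D \<and> (\<forall>x \<in> D. comult C x \<in> vcar (sub C D \<otimes> sub C D))"

definition simple_subcoalgebra ::
  "('k::field, 'c::ab_group_add, 'z) coalg_scheme \<Rightarrow> 'c set \<Rightarrow> bool" where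
  "simple_subcoalgebra C D \<longleftrightarrow>
     subcoalgebra C D \<and> D \<noteq> {0} \<and>
     (\<forall>E. subcoalgebra C E \<and> E \<subseteq> D \<longrightarrow> E = {0} \<or> E = D)"

definition pointed :: "('k::field, 'c::ab_group_add, 'z) coalg_scheme \<Rightarrow> bool" where
  "pointed C \<longleftrightarrow> (\<forall>D. simple_subcoalgebra C D \<longrightarrow> vector_space.dim (vscale C) D = 1)"

definition grouplikes :: "('k::field, 'c::ab_group_add, 'z) coalg_scheme \<Rightarrow> 'c set" where
  "grouplikes C = {g \<in> vcar C. comult C g = tens C C g g \<and> counit C g = 1}"

definition is_algebra :: "('k::field, 'a::ring_1, 'z) vspace_scheme \<Rightarrow> bool" where
  "is_algebra A \<longleftrightarrow> is_vspace A \<and> vcar A = UNIV \<and> bilin A A A (*)"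

definition antipode_axiom :: "('k::field, 'a::ring_1, 'z) hopf_scheme \<Rightarrow> bool" where
  "antipode_axiom A \<longleftrightarrow>
     lin A A (antipode A) \<and>
     (\<forall>x. tlift A A (\<lambda>y z. antipode A y * z) (comult A x) = vscale A (counit A x) 1 \<and>
          tlift A A (\<lambda>y z. y * antipode A z) (comult A x) = vscale A (counit A x) 1)"

definition tmult ::
  "('k::field, 'a::ring_1, 'z) vspace_scheme
    \<Rightarrow> ('k, 'a, 'a) tensor \<Rightarrow> ('k, 'a, 'a) tensor \<Rightarrow> ('k, 'a, 'a) tensor" where
  "tmult A s t = tlift A A (\<lambda>a b. tlift A A (\<lambda>a' b'. tens A A (a * a') (b * b')) t) s"

definition hopf_algebra :: "('k::field, 'h::ring_1, 'z) hopf_scheme \<Rightarrow> bool" where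
  "hopf_algebra H \<longleftrightarrow>
     is_algebra H \<and> coalgebra H \<and>
     comult H 1 = tens H H 1 1 \<and>
     (\<forall>x y. comult H (x * y) = tmult H (comult H x) (comult H y)) \<and>
     counit H 1 = 1 \<and> (\<forall>x y. counit H (x * y) = counit H x * counit H y) \<and>
     antipode_axiom H"

section \<open>Yetter-Drinfeld modules and braided Hopf algebras\<close>

definition diag_coact ::
  "('k::field, 'h::ring_1, 'x) vspace_scheme
    \<Rightarrow> ('k, 'v::ab_group_add, 'y) vspace_scheme \<Rightarrow> ('v \<Rightarrow> ('k, 'h, 'v) tensor)
    \<Rightarrow> ('k, 'w::ab_group_add, 'z) vspace_scheme \<Rightarrow> ('w \<Rightarrow> ('k, 'h, 'w) tensor)
    \<Rightarrow> ('k, 'v, 'w) tensor \<Rightarrow> ('k, 'h, ('k, 'v, 'w) tensor) tensor" where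
  "diag_coact H V \<delta>V W \<delta>W =
     tlift V W (\<lambda>v w.
       tlift H V (\<lambda>x v0.
         tlift H W (\<lambda>y w0. tens H (V \<otimes> W) (x * y) (tens V W v0 w0)) (\<delta>W w)) (\<delta>V v))"

definition diag_act ::
  "('k::field, 'h::ring_1, 'x) coalg_scheme
    \<Rightarrow> ('k, 'v::ab_group_add, 'y) vspace_scheme \<Rightarrow> ('h \<Rightarrow> 'v \<Rightarrow> 'v)
    \<Rightarrow> ('k, 'w::ab_group_add, 'z) vspace_scheme \<Rightarrow> ('h \<Rightarrow> 'w \<Rightarrow> 'w)
    \<Rightarrow> 'h \<Rightarrow> ('k, 'v, 'w) tensor \<Rightarrow> ('k, 'v, 'w) tensor" where
  "diag_act H V actV W actW h t =
     tlift H H (\<lambda>h1 h2. tmap V W V W (actV h1) (actW h2) t) (comult H h)"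

record ('k, 'h, 'v) yd = "('k, 'v) vspace" +
  yact :: "'h \<Rightarrow> 'v \<Rightarrow> 'v"
  ycoact :: "'v \<Rightarrow> ('k, 'h, 'v) tensor"

definition yd_module ::
  "('k::field, 'h::ring_1, 'y) hopf_scheme \<Rightarrow> ('k, 'h, 'v::ab_group_add, 'z) yd_scheme \<Rightarrow> bool"
  where
  "yd_module H V \<longleftrightarrow>
     is_vspace V \<and> bilin H V V (yact V) \<and>
     (\<forall>v \<in> vcar V. yact V 1 v = v) \<and>
     (\<forall>x y. \<forall>v \<in> vcar V. yact V (x * y) v = yact V x (yact V y v)) \<and>
     comodule H V (ycoact V) \<and>
     (\<forall>h. \<forall>v \<in> vcar V.
        ycoact V (yact V h v) =
          tlift (H \<otimes> H) H (\<lambda>t h3.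
            tlift H H (\<lambda>h1 h2.
              tlift H V (\<lambda>x v0. tens H V (h1 * x * antipode H h3) (yact V h2 v0)) (ycoact V v)) t)
            (tmap H H (H \<otimes> H) H (comult H) id (comult H h)))"

definition yd_hom ::
  "('k::field, 'h::ring_1, 'x) hopf_scheme \<Rightarrow> ('k, 'h, 'v::ab_group_add, 'y) yd_scheme
    \<Rightarrow> ('k, 'h, 'w::ab_group_add, 'z) yd_scheme \<Rightarrow> ('v \<Rightarrow> 'w) \<Rightarrow> bool" where
  "yd_hom H V W f \<longleftrightarrow>
     (\<forall>h. \<forall>v \<in> vcar V. f (yact V h v) = yact W h (f v)) \<and>
     colinear H V (ycoact V) W (ycoact W) f"

definition yd_tensor ::
  "('k::field, 'h::ring_1, 'x) hopf_scheme \<Rightarrow> ('k, 'h, 'v::ab_group_add, 'y) yd_scheme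
    \<Rightarrow> ('k, 'h, 'w::ab_group_add, 'z) yd_scheme \<Rightarrow> ('k, 'h, ('k, 'v, 'w) tensor) yd" where
  "yd_tensor H V W =
     \<lparr>vcar = vcar (V \<otimes> W), vscale = vscale (V \<otimes> W),
      yact = diag_act H V (yact V) W (yact W),
      ycoact = diag_coact H V (ycoact V) W (ycoact W)\<rparr>"

definition yd_unit :: "('k::field, 'h::ring_1, 'z) hopf_scheme \<Rightarrow> ('k, 'h, 'k) yd" where
  "yd_unit H =
     \<lparr>vcar = UNIV, vscale = (*), yact = (\<lambda>h c. counit H h * c), ycoact = tens H base 1\<rparr>"

record ('k, 'h, 'a) bhopf = "('k, 'a) hopf" +
  act :: "'h \<Rightarrow> 'a \<Rightarrow> 'a"
  coact :: "'a \<Rightarrow> ('k, 'h, 'a) tensor"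

definition yd_of :: "('k, 'h, 'a, 'z) bhopf_scheme \<Rightarrow> ('k, 'h, 'a) yd" where
  "yd_of A = \<lparr>vcar = vcar A, vscale = vscale A, yact = act A, ycoact = coact A\<rparr>"

definition braided_tmult ::
  "('k::field, 'h::ring_1, 'y) vspace_scheme \<Rightarrow> ('k, 'h, 'a::ring_1, 'z) bhopf_scheme
    \<Rightarrow> ('k, 'a, 'a) tensor \<Rightarrow> ('k, 'a, 'a) tensor \<Rightarrow> ('k, 'a, 'a) tensor" where
  "braided_tmult H A s t =
     tlift A A (\<lambda>a b. tlift A A (\<lambda>a' b'.
       tlift H A (\<lambda>x b0. tens A A (a * act A x a') (b0 * b')) (coact A b)) t) s"

definition braided_hopf_algebra ::
  "('k::field, 'h::ring_1, 'y) hopf_scheme \<Rightarrow> ('k, 'h, 'a::ring_1, 'z) bhopf_scheme \<Rightarrow> bool"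
  where
  "braided_hopf_algebra H A \<longleftrightarrow>
     is_algebra A \<and> coalgebra A \<and> yd_module H (yd_of A) \<and>
     yd_hom H (yd_tensor H (yd_of A) (yd_of A)) (yd_of A) (tlift A A (*)) \<and>
     yd_hom H (yd_unit H) (yd_of A) (\<lambda>c. vscale A c 1) \<and>
     yd_hom H (yd_of A) (yd_tensor H (yd_of A) (yd_of A)) (comult A) \<and>
     yd_hom H (yd_of A) (yd_unit H) (counit A) \<and>
     yd_hom H (yd_of A) (yd_of A) (antipode A) \<and>
     comult A 1 = tens A A 1 1 \<and>
     (\<forall>x y. comult A (x * y) = braided_tmult H A (comult A x) (comult A y)) \<and>
     counit A 1 = 1 \<and> (\<forall>x y. counit A (x * y) = counit A x * counit A y) \<and>
     antipode_axiom A"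

definition ring_inverse :: "'a::ring_1 \<Rightarrow> 'a" where
  "ring_inverse x = (THE y. x * y = 1 \<and> y * x = 1)"

section \<open>Coideal subalgebras and Hopf modules\<close>

definition left_coideal_subalgebra ::
  "('k::field, 'h::ring_1, 'y) hopf_scheme \<Rightarrow> ('k, 'h, 'a::ring_1, 'z) bhopf_scheme
    \<Rightarrow> 'a set \<Rightarrow> bool" where
  "left_coideal_subalgebra H A K \<longleftrightarrow>
     1 \<in> K \<and> (\<forall>x \<in> K. \<forall>y \<in> K. x * y \<in> K) \<and>
     subcomodule H A (coact A) K \<and>
     (\<forall>x \<in> K. comult A x \<in> vcar (A \<otimes> sub A K))"

record ('k, 'h, 'a, 'v) rmod = "('k, 'v) vspace" +
  hco :: "'v \<Rightarrow> ('k, 'h, 'v) tensor"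
  rac :: "'v \<Rightarrow> 'a \<Rightarrow> 'v"

record ('k, 'h, 'a, 'v) hopfmod = "('k, 'h, 'a, 'v) rmod" +
  aco :: "'v \<Rightarrow> ('k, 'a, 'v) tensor"

definition right_module ::
  "('k::field, 'h::ring_1, 'x) hopf_scheme \<Rightarrow> ('k, 'h, 'a::ring_1, 'y) bhopf_scheme
    \<Rightarrow> 'a set \<Rightarrow> ('k, 'h, 'a, 'v::ab_group_add, 'z) rmod_scheme \<Rightarrow> bool" where
  "right_module H A K V \<longleftrightarrow>
     comodule H V (hco V) \<and> bilin V (sub A K) V (rac V) \<and>
     (\<forall>v \<in> vcar V. rac V v 1 = v) \<and>
     (\<forall>v \<in> vcar V. \<forall>x \<in> K. \<forall>y \<in> K. rac V v (x * y) = rac V (rac V v x) y) \<and>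
     colinear H (V \<otimes> sub A K) (diag_coact H V (hco V) (sub A K) (coact A)) V (hco V)
       (tlift V (sub A K) (rac V))"

definition half_braiding ::
  "('k::field, 'h::ring_1, 'x) hopf_scheme \<Rightarrow> ('k, 'h, 'a::ring_1, 'y) bhopf_scheme
    \<Rightarrow> ('k, 'h, 'a, 'v::ab_group_add, 'z) rmod_scheme
    \<Rightarrow> ('k, 'v, 'a) tensor \<Rightarrow> ('k, 'a, 'v) tensor" where
  "half_braiding H A V =
     tlift V A (\<lambda>v a. tlift H V (\<lambda>x v0. tens A V (act A x a) v0) (hco V v))"

definition half_braided_act ::
  "('k::field, 'h::ring_1, 'x) hopf_scheme \<Rightarrow> ('k, 'h, 'a::ring_1, 'y) bhopf_scheme \<Rightarrow> 'a set
    \<Rightarrow> ('k, 'h, 'a, 'v::ab_group_add, 'z) rmod_scheme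
    \<Rightarrow> ('k, 'a, 'v) tensor \<Rightarrow> 'a \<Rightarrow> ('k, 'a, 'v) tensor" where
  "half_braided_act H A K V t x =
     tlift A V (\<lambda>a v.
       tlift A (sub A K) (\<lambda>x1 x2.
         tlift A V (\<lambda>b v0. tens A V (a * b) (rac V v0 x2)) (half_braiding H A V (tens V A v x1)))
         (comult A x)) t"

definition hopf_module ::
  "('k::field, 'h::ring_1, 'x) hopf_scheme \<Rightarrow> ('k, 'h, 'a::ring_1, 'y) bhopf_scheme
    \<Rightarrow> 'a set \<Rightarrow> ('k, 'h, 'a, 'v::ab_group_add, 'z) hopfmod_scheme \<Rightarrow> bool" where
  "hopf_module H A K V \<longleftrightarrow>
     right_module H A K V \<and>
     comodule A V (aco V) \<and>
     colinear H V (hco V) (A \<otimes> V) (diag_coact H A (coact A) V (hco V)) (aco V) \<and>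
     (\<forall>v \<in> vcar V. \<forall>x \<in> K. aco V (rac V v x) = half_braided_act H A K V (aco V v) x)"

definition hopf_submodule ::
  "('k::field, 'h::ring_1, 'x) hopf_scheme \<Rightarrow> ('k, 'h, 'a::ring_1, 'y) bhopf_scheme
    \<Rightarrow> 'a set \<Rightarrow> ('k, 'h, 'a, 'v::ab_group_add, 'z) hopfmod_scheme \<Rightarrow> 'v set \<Rightarrow> bool" where
  "hopf_submodule H A K V U \<longleftrightarrow>
     subcomodule H V (hco V) U \<and> subcomodule A V (aco V) U \<and>
     (\<forall>u \<in> U. \<forall>x \<in> K. rac V u x \<in> U)"

definition K_free ::
  "('k::field, 'h::ring_1, 'x) hopf_scheme \<Rightarrow> ('k, 'h, 'a::ring_1, 'y) bhopf_scheme
    \<Rightarrow> 'a set \<Rightarrow> ('k, 'h, 'a, 'v::ab_group_add, 'z) rmod_scheme \<Rightarrow> bool" where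
  "K_free H A K M \<longleftrightarrow>
     (\<exists>N. subcomodule H M (hco M) N \<and>
        bij_betw (tlift (sub M N) (sub A K) (rac M)) (vcar (sub M N \<otimes> sub A K)) (vcar M))"

end

theory Submission
  imports Defs
begin

text \<open>
  For a linear form \<open>f\<close> on a coalgebra \<open>C\<close>, a \<open>C\<close>-comodule \<open>V\<close> carries the operator
  \<open>v \<mapsto> f(v_(-1)) v_(0)\<close>; over a field these operators determine subcomodules, colinear maps
  and the comodule axioms, so most arguments are about spaces stable under operators.

  (1) By Zorn there is a maximal \<open>H\<close>-subcomodule \<open>N\<close> of \<open>V\<close> such that \<open>N \<otimes> K \<rightarrow> V\<close> is injective
  with image a Hopf submodule \<open>U\<close>.  Cosemisimplicity gives an \<open>H\<close>-subcomodule complement \<open>W\<close> of \<open>U\<close>,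
  on which the Hopf module \<open>V/U\<close> is realised with the coaction of \<open>H\<close> simply restricted.  A free Hopf
  submodule of \<open>W\<close> on \<open>N'\<close> would make \<open>N + N'\<close> a larger choice, so \<open>U = V\<close>.

  (2) As \<open>A\<close> is pointed, every nonzero \<open>A\<close>-comodule contains a nonzero \<open>v\<close> with coaction \<open>g \<otimes> v\<close>,
  \<open>g\<close> grouplike.  For a nonzero Hopf module \<open>V\<close> fix such a \<open>g\<close> and let \<open>N\<close> be the space of all such
  \<open>v\<close>; then \<open>N K\<close> is a Hopf submodule.  The kernel of \<open>N \<otimes> K \<rightarrow> V\<close> is an \<open>A\<close>-comodule; if it were
  nonzero it would contain \<open>t \<noteq> 0\<close> with coaction \<open>g' \<otimes> t\<close>.  Applying the counit to the last factor
  and inverting the braiding shows \<open>t = n \<otimes> y\<close> with \<open>y = g^-1 g'\<close>, because the line through \<open>y\<close> is \<open>H\<close>-stable.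
  So \<open>y \<in> K\<close> and \<open>n y = 0\<close>, and \<open>y\<close> being invertible in \<open>K\<close> gives \<open>n = 0\<close>.
\<close>

section \<open>Linear maps and tensors\<close>

text \<open>Hypothesis (1) only concerns Hopf modules carried by subspaces of the type
  \<open>'v\<close>, so \<open>V/U\<close> must not change the type; this is why it lives on a
  complement \<open>W\<close>. As both \<open>U\<close> and \<open>W\<close> are
  \<open>H\<close>-stable, the projection \<open>p\<close> along \<open>U\<close> is
  \<open>H\<close>-colinear; the action of \<open>K\<close> and the coaction of \<open>A\<close> may
  leave \<open>W\<close> and are composed with \<open>p\<close>. An \<open>H\<close>-stable
  generating space \<open>N'\<close> of a free submodule of \<open>V/U\<close> is then
  \<open>H\<close>-stable in \<open>V\<close> without any lifting. In (2), condition (b) enters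
  twice. Trivial coaction of \<open>g\<close> makes \<open>N\<close> an \<open>H\<close>-subcomodule
  and gives \<open>\<Delta>(g y) = g y_(1) \<otimes> g y_(2)\<close>, which is what makes the
  coaction on \<open>N \<otimes> K\<close> coassociative. It also makes products and inverses of
  group-likes group-like, so that (a) and (c) apply to \<open>y\<close>. The vector with coaction
  \<open>g \<otimes> v\<close> comes from coefficients: those of a simple comodule span a
  finite-dimensional subcoalgebra, and in a pointed coalgebra this contains a group-like. Simplicity
  then turns a group-like coefficient into such a vector.\<close>

lemma sub_simps [simp]:
  "vcar (sub V N) = N" "vscale (sub V N) = vscale V" "sub (sub V N) M = sub V M"
  by (simp_all add: sub_def)

lemma base_simps [simp]: "vcar base = UNIV" "vscale base = (*)"
  by (simp_all add: base_def)

lemma vscale_tensor [simp]: "vscale (V \<otimes> W) = tscale"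
  by (simp add: tensor_space_def)

lemma tens_sub [simp]: "tens (sub V N) W = tens V W" "tens V (sub W M) = tens V W"
  by (simp_all add: tens_def fun_eq_iff)

lemma is_vspace_base [simp]: "is_vspace (base :: ('k::field, 'k) vspace)"
proof -
  interpret vector_space "(*) :: 'k \<Rightarrow> 'k \<Rightarrow> 'k" by unfold_locales (auto simp: algebra_simps)
  show ?thesis unfolding is_vspace_def base_simps using subspace_UNIV vector_space_axioms by blast
qed

context
  fixes V :: "('k::field, 'v::ab_group_add, 'x) vspace_scheme"
  assumes V: "is_vspace V"
begin

interpretation vector_space "vscale V" using V by (simp add: is_vspace_def)

lemma subspace_carrier: "subspace (vcar V)" using V by (simp add: is_vspace_def)

lemma vs_zero: "0 \<in> vcar V" and vs_add: "x \<in> vcar V \<Longrightarrow> y \<in> vcar V \<Longrightarrow> x + y \<in> vcar V"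
  and vs_scale: "x \<in> vcar V \<Longrightarrow> vscale V c x \<in> vcar V"
  and vs_diff: "x \<in> vcar V \<Longrightarrow> y \<in> vcar V \<Longrightarrow> x - y \<in> vcar V"
  using subspace_0[OF subspace_carrier] subspace_add[OF subspace_carrier] subspace_scale[OF subspace_carrier] subspace_diff[OF subspace_carrier] by auto

lemma vs_sum: "(\<And>i. i \<in> I \<Longrightarrow> f i \<in> vcar V) \<Longrightarrow> sum f I \<in> vcar V"
  using subspace_sum[OF subspace_carrier] by blast

lemma vs_simps:
  "vscale V c (x + y) = vscale V c x + vscale V c y" "vscale V (c + d) x = vscale V c x + vscale V d x"
  "vscale V c (vscale V d x) = vscale V (c * d) x" "vscale V 1 x = x" "vscale V 0 x = 0"
  "vscale V c 0 = 0" "vscale V c (- x) = - vscale V c x" "vscale V c (x - y) = vscale V c x - vscale V c y"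
  by (simp_all add: scale_right_distrib scale_left_distrib scale_right_diff_distrib)

lemma is_vspace_sub: "is_subspace V N \<Longrightarrow> is_vspace (sub V N)"
  using V by (simp add: is_vspace_def is_subspace_def)

lemma is_subspace_carrier: "is_subspace V (vcar V)"
  using subspace_carrier by (simp add: is_subspace_def)

lemma is_subspaceI:
  assumes "N \<subseteq> vcar V" "0 \<in> N" "\<And>x y. x \<in> N \<Longrightarrow> y \<in> N \<Longrightarrow> x + y \<in> N"
    "\<And>c x. x \<in> N \<Longrightarrow> vscale V c x \<in> N"
  shows "is_subspace V N"
  using assms by (simp add: is_subspace_def subspace_def)

lemma is_subspaceD:
  assumes "is_subspace V N"
  shows "N \<subseteq> vcar V" "0 \<in> N" "\<And>x y. x \<in> N \<Longrightarrow> y \<in> N \<Longrightarrow> x + y \<in> N"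
    "\<And>c x. x \<in> N \<Longrightarrow> vscale V c x \<in> N" "\<And>x y. x \<in> N \<Longrightarrow> y \<in> N \<Longrightarrow> x - y \<in> N"
  using assms subspace_diff[of N] by (auto simp add: is_subspace_def subspace_def)

lemma functional_exists:
  assumes v: "v \<in> vcar V" "v \<noteq> 0"
  shows "\<exists>\<xi>. lin V base \<xi> \<and> \<xi> v = 1"
proof -
  interpret K: vector_space "(*) :: 'k \<Rightarrow> 'k \<Rightarrow> 'k" by unfold_locales (auto simp: algebra_simps)
  interpret VK: vector_space_pair "vscale V" "(*) :: 'k \<Rightarrow> 'k \<Rightarrow> 'k" ..
  have "independent {v}" using v by simp
  from VK.linear_independent_extend[OF this, of "\<lambda>_. 1"]
  obtain \<phi> where \<phi>: "Vector_Spaces.linear (vscale V) (*) \<phi>" and 1: "\<phi> v = 1" by auto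
  interpret \<phi>: Vector_Spaces.linear "vscale V" "(*)" \<phi> by (rule \<phi>)
  have "lin V base \<phi>" by (simp add: lin_def \<phi>.add \<phi>.scale)
  then show ?thesis using 1 by blast
qed

text \<open>Coordinates are taken in one basis of the whole carrier, which makes every
  \<open>\<beta> b\<close> linear there; \<open>F\<close> keeps the finitely many basis vectors that
  occur in \<open>X\<close>.\<close>

lemma finite_coords:
  assumes X: "finite X" "X \<subseteq> vcar V"
  shows "\<exists>F \<beta>. finite F \<and> F \<subseteq> vcar V \<and> (\<forall>b \<in> F. lin V base (\<beta> b)) \<and>
    (\<forall>c \<in> X. c = (\<Sum>b\<in>F. vscale V (\<beta> b c) b))"
proof -
  obtain B where B: "B \<subseteq> vcar V" "independent B" "vcar V \<subseteq> span B"
    using basis_exists by metis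
  have sB: "span B = vcar V" using span_subspace[OF B(1,3) subspace_carrier] .
  define \<beta> where "\<beta> = (\<lambda>b c. representation B c b)"
  define F where "F = (\<Union>c\<in>X. {b. representation B c b \<noteq> 0})"
  have fin: "finite F" unfolding F_def using X finite_representation by auto
  have "F \<subseteq> vcar V" unfolding F_def using B representation_ne_zero by blast
  moreover have "lin V base (\<beta> b)" for b
    unfolding lin_def \<beta>_def
    using B(2) sB by (simp add: representation_add representation_scale)
  moreover have "c = (\<Sum>b\<in>F. vscale V (\<beta> b c) b)" if c: "c \<in> X" for c
  proof -
    have "c = (\<Sum>b | representation B c b \<noteq> 0. vscale V (representation B c b) b)"
      using sum_nonzero_representation_eq[OF B(2), of c] c X sB by auto
    also have "\<dots> = (\<Sum>b\<in>F. vscale V (\<beta> b c) b)"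
      unfolding \<beta>_def by (rule sum.mono_neutral_left) (use fin c in \<open>auto simp: F_def\<close>)
    finally show ?thesis .
  qed
  ultimately show ?thesis using fin by blast
qed

end

section \<open>Calculus of linear maps, bilinear maps and Sweedler sums\<close>

lemma linI:
  assumes "\<And>x. x \<in> vcar V \<Longrightarrow> f x \<in> vcar W"
    "\<And>x y. x \<in> vcar V \<Longrightarrow> y \<in> vcar V \<Longrightarrow> f (x + y) = f x + f y"
    "\<And>c x. x \<in> vcar V \<Longrightarrow> f (vscale V c x) = vscale W c (f x)"
  shows "lin V W f"
  using assms by (simp add: lin_def)

lemma lin_in: "lin V W f \<Longrightarrow> x \<in> vcar V \<Longrightarrow> f x \<in> vcar W"
  and lin_add: "lin V W f \<Longrightarrow> x \<in> vcar V \<Longrightarrow> y \<in> vcar V \<Longrightarrow> f (x + y) = f x + f y"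
  and lin_scale: "lin V W f \<Longrightarrow> x \<in> vcar V \<Longrightarrow> f (vscale V c x) = vscale W c (f x)"
  by (simp_all add: lin_def)

lemma lin_zero: "is_vspace V \<Longrightarrow> lin V W f \<Longrightarrow> f 0 = 0"
  using lin_add[of V W f 0 0] vs_zero[of V] by simp

lemma lin_diff:
  assumes V: "is_vspace V" and f: "lin V W f" and x: "x \<in> vcar V" "y \<in> vcar V"
  shows "f (x - y) = f x - f y"
  using lin_add[OF f, of "x - y" y] vs_diff[OF V x] x by (simp add: algebra_simps)

lemma lin_sum:
  assumes V: "is_vspace V" and f: "lin V W f" and g: "\<And>i. i \<in> I \<Longrightarrow> g i \<in> vcar V"
  shows "f (sum g I) = (\<Sum>i\<in>I. f (g i))"
proof (cases "finite I")
  case True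
  then show ?thesis using g
    by (induction I) (simp_all add: lin_zero[OF V f] lin_add[OF f] vs_sum[OF V])
qed (simp add: lin_zero[OF V f])

lemma bilinI:
  assumes "\<And>v. v \<in> vcar V \<Longrightarrow> lin W U (\<lambda>w. B v w)" "\<And>w. w \<in> vcar W \<Longrightarrow> lin V U (\<lambda>v. B v w)"
  shows "bilin V W U B"
  using assms by (simp add: bilin_def)

lemma bilinD1: "bilin V W U B \<Longrightarrow> v \<in> vcar V \<Longrightarrow> lin W U (B v)"
  and bilinD2: "bilin V W U B \<Longrightarrow> w \<in> vcar W \<Longrightarrow> lin V U (\<lambda>v. B v w)"
  by (simp_all add: bilin_def)

lemma bilin_in: "bilin V W U B \<Longrightarrow> v \<in> vcar V \<Longrightarrow> w \<in> vcar W \<Longrightarrow> B v w \<in> vcar U"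
  using bilinD1 lin_in by metis

lemma lin_comp: "lin V W g \<Longrightarrow> lin X V f \<Longrightarrow> lin X W (\<lambda>x. g (f x))"
  by (simp add: lin_def)

lemma lin_id: "lin V V (\<lambda>v. v)"
  by (simp add: lin_def)

lemma bilin_app1: "bilin X Y U B \<Longrightarrow> lin V X f \<Longrightarrow> y \<in> vcar Y \<Longrightarrow> lin V U (\<lambda>v. B (f v) y)"
  using lin_comp[OF bilinD2] .

lemma bilin_app2: "bilin X Y U B \<Longrightarrow> x \<in> vcar X \<Longrightarrow> lin V Y f \<Longrightarrow> lin V U (\<lambda>v. B x (f v))"
  using lin_comp[OF bilinD1] .

lemma bilin_tens: "bilin V W (V \<otimes> W) (tens V W)"
  by (auto simp: bilin_def lin_def tens_in tens_add1 tens_add2 tens_scale1 tens_scale2)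

lemmas lin_tens1 = bilin_app1[OF bilin_tens] and lin_tens2 = bilin_app2[OF bilin_tens]

lemma bilin_scale: "is_vspace V \<Longrightarrow> bilin base V V (vscale V)"
  by (auto simp: bilin_def lin_def vs_scale vs_simps mult.commute)

lemma lin_scale1: "lin V base f \<Longrightarrow> is_vspace U \<Longrightarrow> w \<in> vcar U \<Longrightarrow> lin V U (\<lambda>v. vscale U (f v) w)"
  by (rule bilin_app1[OF bilin_scale])

lemma lin_scale2: "lin V U f \<Longrightarrow> is_vspace U \<Longrightarrow> lin V U (\<lambda>v. vscale U c (f v))"
  by (rule bilin_app2[OF bilin_scale]) auto

lemma lin_base1: "lin V base f \<Longrightarrow> lin V base (\<lambda>v. f v * c)"
  and lin_base2: "lin V base f \<Longrightarrow> lin V base (\<lambda>v. c * f v)"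
  by (simp_all add: lin_def algebra_simps)

lemma lin_sub: "lin V U f \<Longrightarrow> N \<subseteq> vcar V \<Longrightarrow> lin (sub V N) U f"
  by (simp add: lin_def subset_iff)

text \<open>Only representations with entries in the carriers enter \<open>tlift\<close>. As a
  congruence rule it lets the simplifier assume carrier membership of the summation variables inside
  a Sweedler sum.\<close>

lemma tlift_cong [cong]:
  assumes "V = V'" "W = W'" "\<And>v w. v \<in> vcar V' \<Longrightarrow> w \<in> vcar W' \<Longrightarrow> B v w = B' v w" "t = t'"
  shows "tlift V W B t = tlift V' W' B' t'"
proof -
  have *: "(\<Sum>(v, w) \<leftarrow> ps. B v w) = (\<Sum>(v, w) \<leftarrow> ps. B' v w)"
    if "set ps \<subseteq> vcar V' \<times> vcar W'" for ps
    using that assms(3) by (intro arg_cong[of _ _ sum_list] map_cong) auto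
  show ?thesis unfolding tlift_def assms(1,2,4)
    by (rule arg_cong[of _ _ The]) (use * in \<open>auto simp: fun_eq_iff\<close>)
qed

lemma lin_tlift_arg:
  "lin X (V \<otimes> W) f \<Longrightarrow> bilin V W U B \<Longrightarrow> is_vspace V \<Longrightarrow> is_vspace W \<Longrightarrow> is_vspace U \<Longrightarrow>
    lin X U (\<lambda>x. tlift V W B (f x))"
  by (rule lin_comp[OF lin_tlift])

lemma tlift_in:
  "bilin V W U B \<Longrightarrow> t \<in> vcar (V \<otimes> W) \<Longrightarrow> is_vspace V \<Longrightarrow> is_vspace W \<Longrightarrow> is_vspace U \<Longrightarrow>
    tlift V W B t \<in> vcar U"
  using lin_in[OF lin_tlift] by blast

lemma lin_plus: "lin V U f \<Longrightarrow> lin V U g \<Longrightarrow> is_vspace U \<Longrightarrow> lin V U (\<lambda>x. f x + g x)"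
  by (auto simp: lin_def vs_add vs_simps algebra_simps)

lemma bilin_plus: "bilin V W U B \<Longrightarrow> bilin V W U B' \<Longrightarrow> is_vspace U \<Longrightarrow> bilin V W U (\<lambda>v w. B v w + B' v w)"
  by (auto simp: bilin_def intro: lin_plus)

lemma tlift_plus:
  assumes "is_vspace V" "is_vspace W" "is_vspace U" "bilin V W U B" "bilin V W U B'" "t \<in> vcar (V \<otimes> W)"
  shows "tlift V W (\<lambda>v w. B v w + B' v w) t = tlift V W B t + tlift V W B' t"
  by (rule lin_tensor_eqI[OF assms(1) lin_tlift lin_plus[OF lin_tlift lin_tlift] _ assms(6)])
    (use assms in \<open>auto simp: tlift_tens bilin_plus\<close>)

text \<open>Both sides are linear in \<open>t\<close>, so pure tensors decide. This is the step by
  which later computations move a map into a Sweedler sum or out of it.\<close>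

lemma lin_tlift_comp:
  assumes "is_vspace V" "is_vspace W" "is_vspace U" "is_vspace U'"
    and B: "bilin V W U B" and F: "lin U U' F" and t: "t \<in> vcar (V \<otimes> W)"
  shows "F (tlift V W B t) = tlift V W (\<lambda>v w. F (B v w)) t"
proof -
  have b: "bilin V W U' (\<lambda>v w. F (B v w))" using B F by (auto simp: bilin_def intro: lin_comp)
  show ?thesis
    by (rule lin_tensor_eqI[OF assms(1) lin_comp[OF F lin_tlift] lin_tlift _ t])
      (use assms b in \<open>auto simp: tlift_tens\<close>)
qed

text \<open>Counterpart of \<open>lin_tlift_arg\<close>: there the tensor varies, here the body
  does. Together they handle nested Sweedler sums.\<close>

lemma lin_tlift_param:
  assumes "is_vspace V" "is_vspace W" "is_vspace U"
    and B: "\<And>x. x \<in> vcar X \<Longrightarrow> bilin V W U (\<lambda>v w. B x v w)"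
    and L: "\<And>v w. v \<in> vcar V \<Longrightarrow> w \<in> vcar W \<Longrightarrow> lin X U (\<lambda>x. B x v w)"
    and t: "t \<in> vcar (V \<otimes> W)" and X: "is_vspace X"
  shows "lin X U (\<lambda>x. tlift V W (\<lambda>v w. B x v w) t)"
proof (rule linI)
  fix x assume x: "x \<in> vcar X"
  show "tlift V W (B x) t \<in> vcar U" using assms x by (auto intro: tlift_in)
next
  fix x y assume x: "x \<in> vcar X" "y \<in> vcar X"
  have "tlift V W (B (x + y)) t = tlift V W (\<lambda>v w. B x v w + B y v w) t"
    using x by (auto simp: lin_add[OF L])
  also have "\<dots> = tlift V W (B x) t + tlift V W (B y) t"
    using assms x by (auto intro: tlift_plus)
  finally show "tlift V W (B (x + y)) t = tlift V W (B x) t + tlift V W (B y) t" .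
next
  fix c x assume x: "x \<in> vcar X"
  have "tlift V W (B (vscale X c x)) t = tlift V W (\<lambda>v w. vscale U c (B x v w)) t"
    using x by (auto simp: lin_scale[OF L])
  also have "\<dots> = vscale U c (tlift V W (B x) t)"
    using assms x by (intro lin_tlift_comp[symmetric]) (auto intro!: lin_scale2 lin_id)
  finally show "tlift V W (B (vscale X c x)) t = vscale U c (tlift V W (B x) t)" .
qed

text \<open>Fubini for Sweedler sums: both sides are linear in \<open>t\<close>, and on a pure
  tensor the outer sum disappears.\<close>

lemma tlift_swap:
  assumes vs: "is_vspace V" "is_vspace W" "is_vspace X" "is_vspace Y" "is_vspace U"
    and B: "\<And>v w. v \<in> vcar V \<Longrightarrow> w \<in> vcar W \<Longrightarrow> bilin X Y U (\<lambda>x y. B v w x y)"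
    and B': "\<And>x y. x \<in> vcar X \<Longrightarrow> y \<in> vcar Y \<Longrightarrow> bilin V W U (\<lambda>v w. B v w x y)"
    and t: "t \<in> vcar (V \<otimes> W)" and s: "s \<in> vcar (X \<otimes> Y)"
  shows "tlift V W (\<lambda>v w. tlift X Y (\<lambda>x y. B v w x y) s) t =
    tlift X Y (\<lambda>x y. tlift V W (\<lambda>v w. B v w x y) t) s"
proof (rule lin_tensor_eqI[OF vs(1) _ _ _ t])
  have b: "bilin V W U (\<lambda>v w. tlift X Y (B v w) s)"
    by (intro bilinI lin_tlift_param)
      (use assms in \<open>auto intro: bilinD1[OF B'] bilinD2[OF B'] bilinD1[OF B] bilinD2[OF B]\<close>)
  then show "lin (V \<otimes> W) U (\<lambda>t. tlift V W (\<lambda>v w. tlift X Y (B v w) s) t)"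
    using vs by (intro lin_tlift)
  have *: "bilin X Y U (\<lambda>x y. tlift V W (\<lambda>v w. B v w x y) t)" if "t \<in> vcar (V \<otimes> W)" for t
    by (intro bilinI lin_tlift_param)
      (use assms that in \<open>auto intro: bilinD1[OF B'] bilinD2[OF B'] bilinD1[OF B] bilinD2[OF B]\<close>)
  show "lin (V \<otimes> W) U (\<lambda>t. tlift X Y (\<lambda>x y. tlift V W (\<lambda>v w. B v w x y) t) s)"
    by (rule lin_tlift_param) (use * assms is_vspace_tensor in \<open>auto intro: lin_tlift\<close>)
  fix v w assume v: "v \<in> vcar V" "w \<in> vcar W"
  show "tlift V W (\<lambda>v w. tlift X Y (B v w) s) (tens V W v w) =
    tlift X Y (\<lambda>x y. tlift V W (\<lambda>v w. B v w x y) (tens V W v w)) s"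
    using v vs b B' by (simp add: tlift_tens)
qed

section \<open>Tensors over subspaces\<close>

lemma tensor_mono: "N \<subseteq> vcar V \<Longrightarrow> M \<subseteq> vcar W \<Longrightarrow> vcar (sub V N \<otimes> sub W M) \<subseteq> vcar (V \<otimes> W)"
  unfolding tensor_space_def using vector_space_tscale
  by (simp add: subset_iff module_iff_vector_space) (intro allI impI, erule module.span_mono[THEN subsetD, rotated 2], auto simp: module_iff_vector_space)

lemma tensor_sub_self [simp]: "vcar (sub V (vcar V) \<otimes> W) = vcar (V \<otimes> W)"
  "vcar (V \<otimes> sub W (vcar W)) = vcar (V \<otimes> W)" 
  by (simp_all add: tensor_space_def)

text \<open>\<open>tlift\<close> refers to the carriers, so a change of carrier needs an argument: a
  list representing \<open>t\<close> over the small carriers also represents it over the large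
  ones.\<close>

lemma tlift_sub_eq:
  assumes "is_vspace V" "is_vspace W" "is_vspace U" "is_subspace V N" "is_subspace W M"
    "bilin V W U B" "t \<in> vcar (sub V N \<otimes> sub W M)"
  shows "tlift (sub V N) (sub W M) B t = tlift V W B t"
proof -
  have s: "N \<subseteq> vcar V" "M \<subseteq> vcar W" using assms is_subspaceD by blast+
  obtain ps where ps: "set ps \<subseteq> N \<times> M" "t = (\<Sum>(v, w) \<leftarrow> ps. tens V W v w)"
    using tensor_rep[OF is_vspace_sub[OF assms(1,4)] assms(7)] by auto
  have "bilin (sub V N) (sub W M) U B"
    using s assms(6) by (auto simp: bilin_def intro: lin_sub)
  from tlift_rep[OF is_vspace_sub[OF assms(1,4)] is_vspace_sub[OF assms(2,5)] assms(3) this, of ps]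
  moreover have "set ps \<subseteq> vcar V \<times> vcar W" using ps(1) s by blast
  ultimately show ?thesis using ps tlift_rep[OF assms(1,2,3,6), of ps] by simp
qed

lemma tlift_self: "tlift (sub V (vcar V)) W B = tlift V W B" "tlift V (sub W (vcar W)) B = tlift V W B"
  by (simp_all add: tlift_def fun_eq_iff)

lemma tlift_sub_eq1:
  "is_vspace V \<Longrightarrow> is_vspace W \<Longrightarrow> is_vspace U \<Longrightarrow> is_subspace V N \<Longrightarrow> bilin V W U B \<Longrightarrow>
    t \<in> vcar (sub V N \<otimes> W) \<Longrightarrow> tlift (sub V N) W B t = tlift V W B t"
  using tlift_sub_eq[of V W U N "vcar W" B t] by (simp add: tlift_self is_subspace_carrier)

lemma tlift_sub_eq2:
  "is_vspace V \<Longrightarrow> is_vspace W \<Longrightarrow> is_vspace U \<Longrightarrow> is_subspace W M \<Longrightarrow> bilin V W U B \<Longrightarrow>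
    t \<in> vcar (V \<otimes> sub W M) \<Longrightarrow> tlift V (sub W M) B t = tlift V W B t"
  using tlift_sub_eq[of V W U "vcar V" M B t] by (simp add: tlift_self is_subspace_carrier)

lemma tensor_mono1: "N \<subseteq> vcar V \<Longrightarrow> t \<in> vcar (sub V N \<otimes> W) \<Longrightarrow> t \<in> vcar (V \<otimes> W)"
  using tensor_mono[of N V "vcar W" W] by auto

lemma tensor_mono2: "M \<subseteq> vcar W \<Longrightarrow> t \<in> vcar (V \<otimes> sub W M) \<Longrightarrow> t \<in> vcar (V \<otimes> W)"
  using tensor_mono[of "vcar V" V M W] by auto

lemma lin_tens_sub1: "lin X (sub V N) f \<Longrightarrow> y \<in> M \<Longrightarrow> lin X (sub V N \<otimes> sub W M) (\<lambda>x. tens V W (f x) y)"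
  and lin_tens_sub2: "x \<in> N \<Longrightarrow> lin X (sub W M) g \<Longrightarrow> lin X (sub V N \<otimes> sub W M) (\<lambda>y. tens V W x (g y))"
  using lin_tens1[of X "sub V N" f y "sub W M"] lin_tens2[of x "sub V N" X "sub W M" g] by simp_all

lemma bilin_mult: "is_algebra A \<Longrightarrow> bilin A A A (*)"
  by (simp add: is_algebra_def)

lemmas lin_mult1 = bilin_app1[OF bilin_mult] and lin_mult2 = bilin_app2[OF bilin_mult]

text \<open>Introduction rules following the syntax of a Sweedler expression; \<open>intro\<close>
  with such a collection reduces bilinearity to carrier membership.\<close>

lemmas lin_rules = bilinI lin_id lin_tens1 lin_tens2 lin_scale1 lin_scale2 lin_base1 lin_base2
  lin_tlift_arg lin_tlift_param is_vspace_tensor is_vspace_base tens_in tlift_in vs_scale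

text \<open>First entries are written in coordinates and the second entries are collected per basis
  vector. An arbitrary \<open>B\<close> is allowed, so that flipping its arguments also gives the
  expansion along the right factor.\<close>

lemma bilinear_coords:
  assumes C: "is_vspace C" and V: "is_vspace V" and B: "bilin C V U B" and ps: "set ps \<subseteq> vcar C \<times> vcar V"
  shows "\<exists>F \<beta>. finite F \<and> F \<subseteq> vcar C \<and> (\<forall>b \<in> F. lin C base (\<beta> b)) \<and>
    (\<Sum>(c, v) \<leftarrow> ps. B c v) = (\<Sum>b\<in>F. B b (\<Sum>(c, v) \<leftarrow> ps. vscale V (\<beta> b c) v))"
proof -
  have "finite (fst ` set ps)" "fst ` set ps \<subseteq> vcar C" using ps by auto
  from finite_coords[OF C this] obtain F \<beta> where F: "finite F" "F \<subseteq> vcar C" "\<forall>b\<in>F. lin C base (\<beta> b)"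
    "\<forall>c \<in> fst ` set ps. c = (\<Sum>b\<in>F. vscale C (\<beta> b c) b)" by blast
  \<comment> \<open>\<open>F\<close> and \<open>\<beta>\<close> belong to the whole list
    \<open>ps\<close>; the induction therefore runs over lists \<open>qs\<close> with entries among
    those of \<open>ps\<close>.\<close>
  have "(\<Sum>(c, v) \<leftarrow> qs. vscale V (\<beta> b c) v) \<in> vcar V \<and>
      (\<Sum>(c, v) \<leftarrow> qs. B c v) = (\<Sum>b\<in>F. B b (\<Sum>(c, v) \<leftarrow> qs. vscale V (\<beta> b c) v))"
    if "set qs \<subseteq> set ps" for qs b
    using that
  proof (induction qs arbitrary: b)
    case Nil
    then show ?case using lin_zero[OF V bilinD1[OF B]] F(2) vs_zero[OF V] by (auto simp: subset_iff)
  next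
    case (Cons a qs)
    obtain c v where a: "a = (c, v)" by force
    have m: "c \<in> vcar C" "v \<in> vcar V" and c: "c = (\<Sum>b\<in>F. vscale C (\<beta> b c) b)"
      using Cons.prems a ps F(4) by (auto simp: image_iff)
    have IH: "(\<Sum>(c, v) \<leftarrow> qs. vscale V (\<beta> b c) v) \<in> vcar V"
      "(\<Sum>(c, v) \<leftarrow> qs. B c v) = (\<Sum>b\<in>F. B b (\<Sum>(c, v) \<leftarrow> qs. vscale V (\<beta> b c) v))" for b
      using Cons.IH Cons.prems by auto
    note l1 = bilinD1[OF B] and l2 = bilinD2[OF B m(2)]
    have "B c v = (\<Sum>b\<in>F. B (vscale C (\<beta> b c) b) v)"
      using lin_sum[OF C l2, of F "\<lambda>b. vscale C (\<beta> b c) b"] c F(2) vs_scale[OF C] by (metis subsetD)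
    also have "\<dots> = (\<Sum>b\<in>F. B b (vscale V (\<beta> b c) v))"
      using F(2) by (intro sum.cong refl) (simp add: lin_scale[OF l1 m(2)] lin_scale[OF l2] subset_iff)
    finally have "B c v + (\<Sum>(c, v) \<leftarrow> qs. B c v) =
        (\<Sum>b\<in>F. B b (vscale V (\<beta> b c) v) + B b (\<Sum>(c, v) \<leftarrow> qs. vscale V (\<beta> b c) v))"
      unfolding IH(2) by (simp only: sum.distrib)
    also have "\<dots> = (\<Sum>b\<in>F. B b (vscale V (\<beta> b c) v + (\<Sum>(c, v) \<leftarrow> qs. vscale V (\<beta> b c) v)))"
      using F(2) by (intro sum.cong refl lin_add[OF l1, symmetric] vs_scale[OF V m(2)] IH(1)) auto
    finally show ?case
      unfolding a list.map sum_list.Cons prod.case using vs_add[OF V vs_scale[OF V m(2)] IH(1)] by blast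
  qed
  then show ?thesis using F(1-3) by blast
qed

section \<open>Comodules as spaces with operators\<close>

text \<open>The contraction \<open>f \<otimes> id\<close> with the left factor, after identifying
  the tensor product of the field with \<open>V\<close> with \<open>V\<close>; \<open>rslice\<close>
  contracts the right factor.\<close>

definition lslice ::
  "('k::field, 'c::ab_group_add, 'y) vspace_scheme \<Rightarrow> ('k, 'v::ab_group_add, 'z) vspace_scheme
    \<Rightarrow> ('c \<Rightarrow> 'k) \<Rightarrow> ('k, 'c, 'v) tensor \<Rightarrow> 'v" where
  "lslice C V f = tlift C V (\<lambda>c v. vscale V (f c) v)"

definition rslice ::
  "('k::field, 'c::ab_group_add, 'y) vspace_scheme \<Rightarrow> ('k, 'v::ab_group_add, 'z) vspace_scheme
    \<Rightarrow> ('v \<Rightarrow> 'k) \<Rightarrow> ('k, 'c, 'v) tensor \<Rightarrow> 'c" where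
  "rslice C V \<xi> = tlift C V (\<lambda>c v. vscale C (\<xi> v) c)"

context
  fixes C :: "('k::field, 'c::ab_group_add, 'y) vspace_scheme"
    and V :: "('k, 'v::ab_group_add, 'z) vspace_scheme"
  assumes C: "is_vspace C" and V: "is_vspace V"
begin

lemma bilin_lslice: "lin C base f \<Longrightarrow> bilin C V V (\<lambda>c v. vscale V (f c) v)"
  by (intro lin_rules V) auto

lemma bilin_rslice: "lin V base \<xi> \<Longrightarrow> bilin C V C (\<lambda>c v. vscale C (\<xi> v) c)"
  by (intro lin_rules C) auto

lemma lin_lslice: "lin C base f \<Longrightarrow> lin (C \<otimes> V) V (lslice C V f)"
  unfolding lslice_def by (intro lin_tlift C V bilin_lslice)

lemma lin_rslice: "lin V base \<xi> \<Longrightarrow> lin (C \<otimes> V) C (rslice C V \<xi>)"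
  unfolding rslice_def by (intro lin_tlift C V bilin_rslice)

lemma lslice_tens: "lin C base f \<Longrightarrow> c \<in> vcar C \<Longrightarrow> v \<in> vcar V \<Longrightarrow> lslice C V f (tens C V c v) = vscale V (f c) v"
  unfolding lslice_def by (rule tlift_tens[OF C V V bilin_lslice])

lemma rslice_tens: "lin V base \<xi> \<Longrightarrow> c \<in> vcar C \<Longrightarrow> v \<in> vcar V \<Longrightarrow> rslice C V \<xi> (tens C V c v) = vscale C (\<xi> v) c"
  unfolding rslice_def by (rule tlift_tens[OF C V C bilin_rslice])

lemma lslice_sub:
  assumes N: "is_subspace V N" and t: "t \<in> vcar (C \<otimes> sub V N)" and f: "lin C base f"
  shows "lslice C V f t \<in> N"
proof -
  have b: "bilin C (sub V N) (sub V N) (\<lambda>c v. vscale V (f c) v)"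
    using bilin_lslice[OF f] is_subspaceD[OF V N] by (auto simp: bilin_def lin_def subset_iff)
  have "lslice C V f t = tlift C (sub V N) (\<lambda>c v. vscale V (f c) v) t"
    unfolding lslice_def by (rule tlift_sub_eq2[OF C V V N bilin_lslice[OF f] t, symmetric])
  also have "\<dots> \<in> vcar (sub V N)" by (intro tlift_in b t C is_vspace_sub V N)
  finally show ?thesis by simp
qed

text \<open>The coefficient of a basis vector \<open>b\<close> is the contraction with its
  coordinate functional. Hence contractions detect equality of tensors and membership over
  subspaces.\<close>

lemma tensor_expand_left:
  assumes t: "t \<in> vcar (C \<otimes> V)"
  shows "\<exists>F \<beta>. finite F \<and> F \<subseteq> vcar C \<and> (\<forall>b \<in> F. lin C base (\<beta> b)) \<and>
    t = (\<Sum>b\<in>F. tens C V b (lslice C V (\<beta> b) t))"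
proof -
  obtain ps where ps: "set ps \<subseteq> vcar C \<times> vcar V" "t = (\<Sum>(c, v) \<leftarrow> ps. tens C V c v)"
    using tensor_rep[OF C t] by blast
  obtain F \<beta> where F: "finite F" "F \<subseteq> vcar C" "\<forall>b\<in>F. lin C base (\<beta> b)"
    and eq: "(\<Sum>(c, v) \<leftarrow> ps. tens C V c v) = (\<Sum>b\<in>F. tens C V b (\<Sum>(c, v) \<leftarrow> ps. vscale V (\<beta> b c) v))"
    using bilinear_coords[OF C V bilin_tens ps(1)] by blast
  have "lslice C V (\<beta> b) t = (\<Sum>(c, v) \<leftarrow> ps. vscale V (\<beta> b c) v)" if "b \<in> F" for b
    unfolding lslice_def ps(2) by (rule tlift_rep) (use F(3) that ps(1) C V bilin_lslice in auto)
  then have "t = (\<Sum>b\<in>F. tens C V b (lslice C V (\<beta> b) t))"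
    by (subst ps(2), subst eq) (rule sum.cong, auto)
  then show ?thesis using F by blast
qed

lemma tensor_expand_right:
  assumes t: "t \<in> vcar (C \<otimes> V)"
  shows "\<exists>F \<beta>. finite F \<and> F \<subseteq> vcar V \<and> (\<forall>b \<in> F. lin V base (\<beta> b)) \<and>
    t = (\<Sum>b\<in>F. tens C V (rslice C V (\<beta> b) t) b)"
proof -
  obtain ps where ps: "set ps \<subseteq> vcar C \<times> vcar V" "t = (\<Sum>(c, v) \<leftarrow> ps. tens C V c v)"
    using tensor_rep[OF C t] by blast
  let ?qs = "map prod.swap ps"
  have "set ?qs \<subseteq> vcar V \<times> vcar C" using ps(1) by auto
  moreover have "bilin V C (C \<otimes> V) (\<lambda>v c. tens C V c v)" using bilin_tens by (auto simp: bilin_def)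
  ultimately obtain F \<beta> where F: "finite F" "F \<subseteq> vcar V" "\<forall>b\<in>F. lin V base (\<beta> b)"
    and eq: "(\<Sum>(v, c) \<leftarrow> ?qs. tens C V c v) = (\<Sum>b\<in>F. tens C V (\<Sum>(v, c) \<leftarrow> ?qs. vscale C (\<beta> b v) c) b)"
    using bilinear_coords[OF V C, of "C \<otimes> V" "\<lambda>v c. tens C V c v" ?qs] by blast
  have r: "rslice C V (\<beta> b) t = (\<Sum>(c, v) \<leftarrow> ps. vscale C (\<beta> b v) c)" if "b \<in> F" for b
    unfolding rslice_def ps(2) by (rule tlift_rep) (use F(3) that ps(1) C V bilin_rslice in auto)
  have sw: "(\<Sum>(v, c) \<leftarrow> ?qs. g v c) = (\<Sum>(c, v) \<leftarrow> ps. g v c)" for g :: "'v \<Rightarrow> 'c \<Rightarrow> 'w::ab_group_add"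
    by (induction ps) auto
  have "t = (\<Sum>b\<in>F. tens C V (\<Sum>(c, v) \<leftarrow> ps. vscale C (\<beta> b v) c) b)"
    using eq ps(2) by (simp only: sw)
  then have "t = (\<Sum>b\<in>F. tens C V (rslice C V (\<beta> b) t) b)"
    by (rule trans) (rule sum.cong, auto simp: r)
  then show ?thesis using F by blast
qed

lemma tensor_in_left:
  assumes t: "t \<in> vcar (C \<otimes> V)" and N: "is_subspace V N"
    and s: "\<And>f. lin C base f \<Longrightarrow> lslice C V f t \<in> N"
  shows "t \<in> vcar (C \<otimes> sub V N)"
proof -
  from tensor_expand_left[OF t] obtain F \<beta> where F: "F \<subseteq> vcar C" "\<forall>b \<in> F. lin C base (\<beta> b)"
    and t: "t = (\<Sum>b\<in>F. tens C V b (lslice C V (\<beta> b) t))" by blast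
  have "(\<Sum>b\<in>F. tens C V b (lslice C V (\<beta> b) t)) \<in> vcar (C \<otimes> sub V N)"
    using F s by (intro vs_sum[OF is_vspace_tensor] tens_in[of _ C _ "sub V N", simplified]) auto
  then show ?thesis using t by simp
qed

lemma tensor_in_right:
  assumes t: "t \<in> vcar (C \<otimes> V)" and N: "is_subspace C N"
    and s: "\<And>f. lin V base f \<Longrightarrow> rslice C V f t \<in> N"
  shows "t \<in> vcar (sub C N \<otimes> V)"
proof -
  from tensor_expand_right[OF t] obtain F \<beta> where F: "F \<subseteq> vcar V" "\<forall>b \<in> F. lin V base (\<beta> b)"
    and t: "t = (\<Sum>b\<in>F. tens C V (rslice C V (\<beta> b) t) b)" by blast
  have "(\<Sum>b\<in>F. tens C V (rslice C V (\<beta> b) t) b) \<in> vcar (sub C N \<otimes> V)"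
    using F s by (intro vs_sum[OF is_vspace_tensor] tens_in[of _ "sub C N" _ V, simplified]) auto
  then show ?thesis using t by simp
qed

lemma tensor_eqI:
  assumes t: "t \<in> vcar (C \<otimes> V)" and t': "t' \<in> vcar (C \<otimes> V)"
    and s: "\<And>f. lin C base f \<Longrightarrow> lslice C V f t = lslice C V f t'"
  shows "t = t'"
proof -
  have d: "t - t' \<in> vcar (C \<otimes> V)" using vs_diff[OF is_vspace_tensor t t'] .
  from tensor_expand_left[OF this] obtain F \<beta> where F: "F \<subseteq> vcar C" "\<forall>b \<in> F. lin C base (\<beta> b)"
    and e: "t - t' = (\<Sum>b\<in>F. tens C V b (lslice C V (\<beta> b) (t - t')))" by blast
  have "lslice C V (\<beta> b) (t - t') = 0" if "b \<in> F" for b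
    using lin_diff[OF is_vspace_tensor lin_lslice t t'] s F that by simp
  moreover have "tens C V b 0 = 0" for b using tens_add2[of C V b 0 0] by simp
  ultimately have "t - t' = 0" by (subst e) simp
  then show ?thesis by simp
qed

end

lemma projection_exists:
  assumes V: "is_vspace V" and N: "is_subspace V N"
  shows "\<exists>p. lin V (sub V N) p \<and> (\<forall>x \<in> N. p x = x)"
proof -
  interpret V: vector_space "vscale V" using V by (simp add: is_vspace_def)
  interpret VV: vector_space_pair "vscale V" "vscale V" ..
  have "V.subspace N" using N by (simp add: is_subspace_def)
  from VV.linear_exists_left_inverse_on[OF V.linear_id this]
  obtain p where p: "range p \<subseteq> N" "Vector_Spaces.linear (vscale V) (vscale V) p" "\<forall>v \<in> N. p v = v"
    by auto
  interpret p: Vector_Spaces.linear "vscale V" "vscale V" p by (rule p)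
  have "lin V (sub V N) p" using p(1) by (auto simp: lin_def p.add p.scale)
  then show ?thesis using p(3) by blast
qed

lemma tensor_in_both:
  assumes C: "is_vspace C" and V: "is_vspace V" and t: "t \<in> vcar (C \<otimes> V)"
    and M: "is_subspace C M" and N: "is_subspace V N"
    and l: "\<And>f. lin C base f \<Longrightarrow> lslice C V f t \<in> N" and r: "\<And>f. lin V base f \<Longrightarrow> rslice C V f t \<in> M"
  shows "t \<in> vcar (sub C M \<otimes> sub V N)"
proof (rule tensor_in_left[OF is_vspace_sub[OF C M] V _ N])
  show 1: "t \<in> vcar (sub C M \<otimes> V)" by (rule tensor_in_right[OF C V t M r])
  fix f assume f: "lin (sub C M) base f"
  \<comment> \<open>The assumption on left contractions concerns functionals on all of
    \<open>C\<close>; composing with a projection onto \<open>M\<close> extends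
    \<open>f\<close>.\<close>
  obtain p where p: "lin C (sub C M) p" "\<forall>x\<in>M. p x = x" using projection_exists[OF C M] by blast
  have fp: "lin C base (\<lambda>c. f (p c))" by (rule lin_comp[OF f p(1)])
  have "lslice (sub C M) V f t = lslice (sub C M) V (\<lambda>c. f (p c)) t"
    unfolding lslice_def using p(2) by (intro tlift_cong) auto
  also have "\<dots> = lslice C V (\<lambda>c. f (p c)) t"
    unfolding lslice_def by (rule tlift_sub_eq1[OF C V V M bilin_lslice[OF C V fp] 1])
  finally show "lslice (sub C M) V f t \<in> N" using l[OF fp] by simp
qed

lemma coalgebra_vspace: "coalgebra C \<Longrightarrow> is_vspace C"
  and coalgebra_lin: "coalgebra C \<Longrightarrow> lin C (C \<otimes> C) (comult C)"
  and coalgebra_counit: "coalgebra C \<Longrightarrow> lin C base (counit C)"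
  by (simp_all add: coalgebra_def)

lemma comodule_vspace: "comodule C V \<delta> \<Longrightarrow> is_vspace V"
  and comodule_lin: "comodule C V \<delta> \<Longrightarrow> lin V (C \<otimes> V) \<delta>"
  by (simp_all add: comodule_def)

lemma comodule_comult: "coalgebra C \<Longrightarrow> comodule C C (comult C)"
  by (simp add: coalgebra_def comodule_def)

definition cop ::
  "('k::field, 'c::ab_group_add, 'y) vspace_scheme \<Rightarrow> ('k, 'v::ab_group_add, 'z) vspace_scheme
    \<Rightarrow> ('v \<Rightarrow> ('k, 'c, 'v) tensor) \<Rightarrow> ('c \<Rightarrow> 'k) \<Rightarrow> 'v \<Rightarrow> 'v" where
  "cop C V \<delta> f v = lslice C V f (\<delta> v)"

definition conv ::
  "('k::field, 'c::ab_group_add, 'y) coalg_scheme \<Rightarrow> ('c \<Rightarrow> 'k) \<Rightarrow> ('c \<Rightarrow> 'k) \<Rightarrow> 'c \<Rightarrow> 'k" where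
  "conv C f g c = tlift C C (\<lambda>x y. f x * g y) (comult C c)"

context
  fixes C :: "('k::field, 'c::ab_group_add, 'y) coalg_scheme"
    and V :: "('k, 'v::ab_group_add, 'z) vspace_scheme"
    and \<delta>
  assumes C: "is_vspace C" and V: "is_vspace V"
    and \<Delta>: "lin C (C \<otimes> C) (comult C)" and \<delta>: "lin V (C \<otimes> V) \<delta>"
begin

lemma bilin_map_right: "bilin C V (C \<otimes> (C \<otimes> V)) (\<lambda>c w. tens C (C \<otimes> V) c (\<delta> w))"
  by (intro bilinI lin_tens1 lin_tens2 lin_id \<delta> lin_in[OF \<delta>])

lemma bilin_map_left: "bilin C V ((C \<otimes> C) \<otimes> V) (\<lambda>c w. tens (C \<otimes> C) V (comult C c) w)"
  by (intro bilinI lin_tens1 lin_tens2 lin_id \<Delta> lin_in[OF \<Delta>])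

lemma bilin_assoc1: "w \<in> vcar V \<Longrightarrow> bilin C C (C \<otimes> (C \<otimes> V)) (\<lambda>u v. tens C (C \<otimes> V) u (tens C V v w))"
  by (intro bilinI lin_tens1 lin_tens2 lin_id tens_in)

lemma bilin_assoc2:
  "bilin (C \<otimes> C) V (C \<otimes> (C \<otimes> V)) (\<lambda>t w. tlift C C (\<lambda>u v. tens C (C \<otimes> V) u (tens C V v w)) t)"
proof (rule bilinI)
  show "lin V (C \<otimes> (C \<otimes> V)) (\<lambda>w. tlift C C (\<lambda>u v. tens C (C \<otimes> V) u (tens C V v w)) t)"
    if "t \<in> vcar (C \<otimes> C)" for t
    by (intro lin_tlift_param C V is_vspace_tensor bilin_assoc1 lin_tens2 lin_id that)
  show "lin (C \<otimes> C) (C \<otimes> (C \<otimes> V)) (\<lambda>t. tlift C C (\<lambda>u v. tens C (C \<otimes> V) u (tens C V v w)) t)"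
    if "w \<in> vcar V" for w
    by (intro lin_tlift C is_vspace_tensor bilin_assoc1 that)
qed

lemma map_right_in: "t \<in> vcar (C \<otimes> V) \<Longrightarrow> tmap C V C (C \<otimes> V) id \<delta> t \<in> vcar (C \<otimes> (C \<otimes> V))"
  unfolding tmap_def id_apply by (intro tlift_in bilin_map_right C V is_vspace_tensor)

lemma map_left_in: "t \<in> vcar (C \<otimes> V) \<Longrightarrow>
    tassoc C C V (tmap C V (C \<otimes> C) V (comult C) id t) \<in> vcar (C \<otimes> (C \<otimes> V))"
  unfolding tmap_def tassoc_def id_apply
  by (intro tlift_in bilin_map_left bilin_assoc2 C V is_vspace_tensor)

end

section \<open>Coassociativity in Sweedler form\<close>

context
  fixes C :: "('k::field, 'c::ab_group_add, 'y) coalg_scheme"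
    and V :: "('k, 'v::ab_group_add, 'z) vspace_scheme"
    and U :: "('k, 'u::ab_group_add, 'w) vspace_scheme"
    and \<delta> B
  assumes C: "is_vspace C" and V: "is_vspace V" and U: "is_vspace U"
    and \<Delta>: "lin C (C \<otimes> C) (comult C)" and \<delta>: "lin V (C \<otimes> V) \<delta>"
    and B1: "\<And>c. c \<in> vcar C \<Longrightarrow> bilin C V U (B c)"
    and B2: "\<And>c v. c \<in> vcar C \<Longrightarrow> v \<in> vcar V \<Longrightarrow> lin C U (\<lambda>x. B x c v)"
begin

text \<open>The map on \<open>C \<otimes> (C \<otimes> V)\<close> induced by the trilinear
  \<open>B\<close>; it is applied to both sides of the coassociativity axiom.\<close>

definition trilift :: "('k, 'c, ('k, 'c, 'v) tensor) tensor \<Rightarrow> 'u" where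
  "trilift = tlift C (C \<otimes> V) (\<lambda>c s. tlift C V (B c) s)"

lemma bilin_trilift: "bilin C (C \<otimes> V) U (\<lambda>c s. tlift C V (B c) s)"
  by (rule bilinI) (auto intro!: lin_tlift lin_tlift_param is_vspace_tensor C V U B1 B2)

lemma lin_trilift: "lin (C \<otimes> (C \<otimes> V)) U trilift"
  unfolding trilift_def by (intro lin_tlift bilin_trilift C V U is_vspace_tensor)

lemma trilift_pure:
  "c \<in> vcar C \<Longrightarrow> s \<in> vcar (C \<otimes> V) \<Longrightarrow> trilift (tens C (C \<otimes> V) c s) = tlift C V (B c) s"
  unfolding trilift_def by (rule tlift_tens[OF C is_vspace_tensor U bilin_trilift])

lemma trilift_map_right:
  assumes t: "t \<in> vcar (C \<otimes> V)"
  shows "trilift (tmap C V C (C \<otimes> V) id \<delta> t) = tlift C V (\<lambda>c w. tlift C V (B c) (\<delta> w)) t"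
proof -
  have "trilift (tmap C V C (C \<otimes> V) id \<delta> t) = tlift C V (\<lambda>c w. trilift (tens C (C \<otimes> V) c (\<delta> w))) t"
    unfolding tmap_def id_apply
    by (rule lin_tlift_comp[OF C V is_vspace_tensor U bilin_map_right[OF C V \<Delta> \<delta>] lin_trilift t])
  also have "\<dots> = tlift C V (\<lambda>c w. tlift C V (B c) (\<delta> w)) t"
    by (intro tlift_cong refl) (simp add: trilift_pure lin_in[OF \<delta>])
  finally show ?thesis .
qed

lemma trilift_map_left:
  assumes t: "t \<in> vcar (C \<otimes> V)"
  shows "trilift (tassoc C C V (tmap C V (C \<otimes> C) V (comult C) id t)) =
    tlift C V (\<lambda>c w. tlift C C (\<lambda>c1 c2. B c1 c2 w) (comult C c)) t"
proof -
  let ?G = "\<lambda>t w. tlift C C (\<lambda>u v. tens C (C \<otimes> V) u (tens C V v w)) t"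
  have "tassoc C C V (tmap C V (C \<otimes> C) V (comult C) id t) =
      tlift C V (\<lambda>c w. tlift (C \<otimes> C) V ?G (tens (C \<otimes> C) V (comult C c) w)) t"
    unfolding tassoc_def tmap_def id_apply
    by (rule lin_tlift_comp[OF C V is_vspace_tensor is_vspace_tensor bilin_map_left[OF C V \<Delta> \<delta>] _ t])
      (rule lin_tlift[OF is_vspace_tensor V is_vspace_tensor bilin_assoc2[OF C V \<Delta> \<delta>]])
  also have "\<dots> = tlift C V (\<lambda>c w. ?G (comult C c) w) t"
    by (intro tlift_cong refl)
      (intro tlift_tens[OF is_vspace_tensor V is_vspace_tensor bilin_assoc2[OF C V \<Delta> \<delta>]] lin_in[OF \<Delta>])
  finally have 1: "tassoc C C V (tmap C V (C \<otimes> C) V (comult C) id t) = \<dots>" .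
  have b: "bilin C V (C \<otimes> (C \<otimes> V)) (\<lambda>c w. ?G (comult C c) w)"
    by (rule bilinI, rule bilinD1[OF bilin_assoc2[OF C V \<Delta> \<delta>] lin_in[OF \<Delta>]], assumption,
      rule lin_comp[OF bilinD2[OF bilin_assoc2[OF C V \<Delta> \<delta>]] \<Delta>])
  have "trilift (tlift C V (\<lambda>c w. ?G (comult C c) w) (t)) = tlift C V (\<lambda>c w. trilift (?G (comult C c) w)) t"
    by (rule lin_tlift_comp[OF C V is_vspace_tensor U b lin_trilift t])
  also have "\<dots> = tlift C V (\<lambda>c w. tlift C C (\<lambda>c1 c2. trilift (tens C (C \<otimes> V) c1 (tens C V c2 w))) (comult C c)) t"
    by (intro tlift_cong refl)
     (intro lin_tlift_comp[OF C C is_vspace_tensor U bilin_assoc1[OF C V \<Delta> \<delta>] lin_trilift] lin_in[OF \<Delta>])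
  also have "\<dots> = tlift C V (\<lambda>c w. tlift C C (\<lambda>c1 c2. B c1 c2 w) (comult C c)) t"
    by (intro tlift_cong refl) (simp add: trilift_pure tens_in tlift_tens[OF C V U B1])
  finally show ?thesis using 1 by simp
qed

text \<open>Both sides are the value of \<open>B\<close> on
  \<open>v_(-2) \<otimes> v_(-1) \<otimes> v_(0)\<close>, reached by coacting twice or by splitting
  the coalgebra factor.\<close>

lemma comodule_coassoc:
  assumes "comodule C V \<delta>" and v: "v \<in> vcar V"
  shows "tlift C V (\<lambda>c w. tlift C V (B c) (\<delta> w)) (\<delta> v) =
    tlift C V (\<lambda>c w. tlift C C (\<lambda>c1 c2. B c1 c2 w) (comult C c)) (\<delta> v)"
  using trilift_map_left[OF lin_in[OF \<delta> v]] trilift_map_right[OF lin_in[OF \<delta> v]] assms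
  by (simp add: comodule_def)

end

context
  fixes C :: "('k::field, 'c::ab_group_add, 'y) coalg_scheme"
    and V :: "('k, 'v::ab_group_add, 'z) vspace_scheme"
    and \<delta>
  assumes C: "is_vspace C" and V: "is_vspace V"
    and \<Delta>: "lin C (C \<otimes> C) (comult C)" and \<delta>: "lin V (C \<otimes> V) \<delta>"
begin

lemma lin_cop: "lin C base f \<Longrightarrow> lin V V (cop C V \<delta> f)"
  unfolding cop_def by (rule lin_comp[OF lin_lslice[OF C V] \<delta>])

lemma lin_conv: "lin C base f \<Longrightarrow> lin C base g \<Longrightarrow> lin C base (conv C f g)"
  unfolding conv_def by (intro lin_rules C \<Delta>) auto

lemma cop_counit: "cop C V \<delta> (counit C) v = tlift C V (\<lambda>x w. vscale V (counit C x) w) (\<delta> v)"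
  by (simp add: cop_def lslice_def)

lemma cop_cop_eq:
  assumes f: "lin C base f" and g: "lin C base g" and v: "v \<in> vcar V"
  shows "cop C V \<delta> f (cop C V \<delta> g v) =
    tlift C V (\<lambda>c w. tlift C V (\<lambda>c' w'. vscale V (g c * f c') w') (\<delta> w)) (\<delta> v)"
proof -
  have "cop C V \<delta> f (cop C V \<delta> g v) = tlift C V (\<lambda>c w. cop C V \<delta> f (vscale V (g c) w)) (\<delta> v)"
    using lin_tlift_comp[OF C V V V bilin_lslice[OF C V g] lin_cop[OF f] lin_in[OF \<delta> v]]
    by (simp add: cop_def lslice_def)
  also have "\<dots> = tlift C V (\<lambda>c w. tlift C V (\<lambda>c' w'. vscale V (g c) (vscale V (f c') w')) (\<delta> w)) (\<delta> v)"
  proof (intro tlift_cong refl)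
    fix c w assume w: "w \<in> vcar V"
    have "vscale V (g c) (cop C V \<delta> f w) = tlift C V (\<lambda>c' w'. vscale V (g c) (vscale V (f c') w')) (\<delta> w)"
      unfolding cop_def lslice_def
      by (rule lin_tlift_comp[OF C V V V bilin_lslice[OF C V f] _ lin_in[OF \<delta> w]])
        (intro lin_scale2 lin_id V)
    then show "cop C V \<delta> f (vscale V (g c) w) = \<dots>" by (simp add: lin_scale[OF lin_cop[OF f] w])
  qed
  finally show ?thesis by (simp add: vs_simps[OF V])
qed

lemma cop_conv_eq:
  assumes f: "lin C base f" and g: "lin C base g" and v: "v \<in> vcar V"
  shows "cop C V \<delta> (conv C g f) v =
    tlift C V (\<lambda>c w. tlift C C (\<lambda>c1 c2. vscale V (g c1 * f c2) w) (comult C c)) (\<delta> v)"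
  unfolding cop_def lslice_def
proof (intro tlift_cong refl)
  fix c w assume c: "c \<in> vcar C" and w: "w \<in> vcar V"
  have "bilin C C base (\<lambda>x y. g x * f y)" by (intro bilinI lin_base1 lin_base2 f g)
  from lin_tlift_comp[OF C C is_vspace_base V this, of "\<lambda>x. vscale V x w"]
  show "vscale V (conv C g f c) w = tlift C C (\<lambda>c1 c2. vscale V (g c1 * f c2) w) (comult C c)"
    unfolding conv_def using w lin_in[OF \<Delta> c] lin_scale1[OF lin_id V w] by simp
qed

text \<open>A left comodule is a right module over the convolution algebra of linear forms, hence
  the reversed order in \<open>conv C g f\<close>. For the converse, two successive contractions
  separate the elements of \<open>C \<otimes> (C \<otimes> V)\<close>. Later comodule proofs verify
  operator identities and avoid triple tensors.\<close>

lemma comodule_iff: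
  "comodule C V \<delta> \<longleftrightarrow>
    (\<forall>v \<in> vcar V. cop C V \<delta> (counit C) v = v \<and> (\<forall>f g. lin C base f \<longrightarrow> lin C base g \<longrightarrow>
      cop C V \<delta> f (cop C V \<delta> g v) = cop C V \<delta> (conv C g f) v))" (is "_ \<longleftrightarrow> ?R")
proof
  assume com: "comodule C V \<delta>"
  have "cop C V \<delta> f (cop C V \<delta> g v) = cop C V \<delta> (conv C g f) v"
    if f: "lin C base f" and g: "lin C base g" and v: "v \<in> vcar V" for f g v
    unfolding cop_cop_eq[OF that] cop_conv_eq[OF that]
    by (rule comodule_coassoc[OF C V V \<Delta> \<delta> _ _ com v])
      (intro bilinI lin_scale1 lin_scale2 lin_base1 lin_base2 lin_id f g V; assumption)+
  then show ?R using com by (simp add: comodule_def cop_counit)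
next
  assume R: ?R
  have "tassoc C C V (tmap C V (C \<otimes> C) V (comult C) id (\<delta> v)) = tmap C V C (C \<otimes> V) id \<delta> (\<delta> v)"
    (is "?l = ?r") if v: "v \<in> vcar V" for v
  proof (rule tensor_eqI[OF C is_vspace_tensor])
    note in' = lin_in[OF \<delta> v]
    show lr: "?l \<in> vcar (C \<otimes> (C \<otimes> V))" "?r \<in> vcar (C \<otimes> (C \<otimes> V))"
      by (rule map_left_in[OF C V \<Delta> \<delta> in'] map_right_in[OF C V \<Delta> \<delta> in'])+
    fix g assume g: "lin C base g"
    show "lslice C (C \<otimes> V) g ?l = lslice C (C \<otimes> V) g ?r"
    proof (rule tensor_eqI[OF C V])
      show "lslice C (C \<otimes> V) g ?l \<in> vcar (C \<otimes> V)" "lslice C (C \<otimes> V) g ?r \<in> vcar (C \<otimes> V)"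
        by (rule lin_in[OF lin_lslice[OF C is_vspace_tensor g]] lr)+
      fix f assume f: "lin C base f"
      \<comment> \<open>Chosen so that \<open>trilift\<close> performs the contractions with
        \<open>g\<close> and \<open>f\<close> at once.\<close>
      define B where "B = (\<lambda>c c' v. vscale V (g c * f c') v)"
      have B1: "bilin C V V (B c)" if "c \<in> vcar C" for c unfolding B_def
        by (intro bilinI lin_scale1 lin_scale2 lin_base1 lin_base2 lin_id f g V that; assumption)
      have B2: "lin C V (\<lambda>x. B x c v)" if "c \<in> vcar C" "v \<in> vcar V" for c v unfolding B_def
        by (intro bilinI lin_scale1 lin_scale2 lin_base1 lin_base2 lin_id f g V that; assumption)
      have *: "lslice C V f (lslice C (C \<otimes> V) g s) = trilift C V B s" if s: "s \<in> vcar (C \<otimes> (C \<otimes> V))" for s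
      proof (rule lin_tensor_eqI[OF C _ lin_trilift[OF C V V \<Delta> \<delta> B1 B2] _ s])
        show "lin (C \<otimes> C \<otimes> V) V (\<lambda>t. lslice C V f (lslice C (C \<otimes> V) g t))"
          by (intro lin_comp[OF lin_lslice[OF C V f]] lin_lslice C is_vspace_tensor g)
        fix c t assume c: "c \<in> vcar C" and t: "t \<in> vcar (C \<otimes> V)"
        have "lslice C V f (lslice C (C \<otimes> V) g (tens C (C \<otimes> V) c t)) = vscale V (g c) (lslice C V f t)"
          using lin_scale[OF lin_lslice[OF C V f] t] 
          by (simp add: lslice_tens[OF C is_vspace_tensor g c t])
        also have "\<dots> = tlift C V (B c) t"
          unfolding lslice_def B_def
          using lin_tlift_comp[OF C V V V bilin_lslice[OF C V f] lin_scale2[OF lin_id V] t, of "g c"]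
          by (simp add: vs_simps[OF V])
        finally show "lslice C V f (lslice C (C \<otimes> V) g (tens C (C \<otimes> V) c t)) =
            trilift C V B (tens C (C \<otimes> V) c t)"
          by (simp add: trilift_pure[OF C V V \<Delta> \<delta> B1 B2 c t])
      qed
      have "trilift C V B ?l = cop C V \<delta> (conv C g f) v"
        using trilift_map_left[OF C V V \<Delta> \<delta> B1 B2 in'] by (simp add: cop_conv_eq[OF f g v] B_def)
      moreover have "trilift C V B ?r = cop C V \<delta> f (cop C V \<delta> g v)"
        using trilift_map_right[OF C V V \<Delta> \<delta> B1 B2 in'] by (simp add: cop_cop_eq[OF f g v] B_def)
      ultimately show "lslice C V f (lslice C (C \<otimes> V) g ?l) = lslice C V f (lslice C (C \<otimes> V) g ?r)"
        using R v f g by (simp add: *[OF lr(1)] *[OF lr(2)])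
    qed
  qed
  then show "comodule C V \<delta>" using R V \<delta> by (simp add: comodule_def cop_counit)
qed

lemma subcomodule_iff:
  "subcomodule C V \<delta> N \<longleftrightarrow> is_subspace V N \<and> (\<forall>f. lin C base f \<longrightarrow> (\<forall>v \<in> N. cop C V \<delta> f v \<in> N))"
  using tensor_in_left[OF C V lin_in[OF \<delta>]] lslice_sub[OF C V] is_subspaceD(1)[OF V]
  unfolding subcomodule_def cop_def by blast

end

lemma colinear_iff:
  assumes C: "is_vspace C" and V: "is_vspace V" and W: "is_vspace W"
    and \<delta>V: "lin V (C \<otimes> V) \<delta>V" and \<delta>W: "lin W (C \<otimes> W) \<delta>W"
  shows "colinear C V \<delta>V W \<delta>W f \<longleftrightarrow> lin V W f \<and>
    (\<forall>\<phi>. lin C base \<phi> \<longrightarrow> (\<forall>v \<in> vcar V. cop C W \<delta>W \<phi> (f v) = f (cop C V \<delta>V \<phi> v)))"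
proof (cases "lin V W f")
  case f: True
  have b: "bilin C V (C \<otimes> W) (\<lambda>c v. tens C W c (f v))" by (intro lin_rules f lin_in[OF f])
  have eq: "lslice C W \<phi> (tmap C V C W id f (\<delta>V v)) = f (cop C V \<delta>V \<phi> v)"
    and mem: "tmap C V C W id f (\<delta>V v) \<in> vcar (C \<otimes> W)" if \<phi>: "lin C base \<phi>" and v: "v \<in> vcar V" for \<phi> v
  proof -
    show "tmap C V C W id f (\<delta>V v) \<in> vcar (C \<otimes> W)"
      unfolding tmap_def id_apply by (intro tlift_in b lin_in[OF \<delta>V] v C V is_vspace_tensor)
    have "lslice C W \<phi> (tmap C V C W id f (\<delta>V v)) = tlift C V (\<lambda>c v. lslice C W \<phi> (tens C W c (f v))) (\<delta>V v)"
      unfolding tmap_def id_apply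
      by (rule lin_tlift_comp[OF C V is_vspace_tensor W b lin_lslice[OF C W \<phi>] lin_in[OF \<delta>V v]])
    also have "\<dots> = tlift C V (\<lambda>c v. f (vscale V (\<phi> c) v)) (\<delta>V v)"
      by (intro tlift_cong refl) (simp add: lslice_tens[OF C W \<phi>] lin_in[OF f] lin_scale[OF f])
    also have "\<dots> = f (cop C V \<delta>V \<phi> v)"
      unfolding cop_def lslice_def
      by (rule lin_tlift_comp[OF C V V W bilin_lslice[OF C V \<phi>] f lin_in[OF \<delta>V v], symmetric])
    finally show "lslice C W \<phi> (tmap C V C W id f (\<delta>V v)) = f (cop C V \<delta>V \<phi> v)" .
  qed
  have 0: "lin C base (\<lambda>_. 0)" by (rule linI) simp_all
  have "\<delta>W (f v) = tmap C V C W id f (\<delta>V v) \<longleftrightarrow>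
      (\<forall>\<phi>. lin C base \<phi> \<longrightarrow> cop C W \<delta>W \<phi> (f v) = f (cop C V \<delta>V \<phi> v))" (is "?l \<longleftrightarrow> ?r")
    if v: "v \<in> vcar V" for v
  proof
    show ?r if ?l using that eq[OF _ v] by (simp add: cop_def)
    show ?l if ?r
      by (rule tensor_eqI[OF C W lin_in[OF \<delta>W lin_in[OF f v]] mem[OF 0 v]])
        (use that eq[OF _ v] in \<open>simp add: cop_def\<close>)
  qed
  then show ?thesis using f unfolding colinear_def by blast
qed (simp add: colinear_def)

text \<open>Contractions do not depend on the carrier over which a tensor is read, so the operators
  of \<open>N\<close> are restrictions and inherit the identities of
  \<open>comodule_iff\<close>.\<close>

lemma comodule_sub:
  assumes C: "coalgebra C" and V: "comodule C V \<delta>" and N: "subcomodule C V \<delta> N"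
  shows "comodule C (sub V N) \<delta>" 
    and "lin C base f \<Longrightarrow> v \<in> N \<Longrightarrow> cop C (sub V N) \<delta> f v = cop C V \<delta> f v"
proof -
  note C' = coalgebra_vspace[OF C] and V' = comodule_vspace[OF V] and \<Delta> = coalgebra_lin[OF C]
    and \<delta> = comodule_lin[OF V]
  have Ns: "is_subspace V N" using N by (simp add: subcomodule_def)
  note N' = is_vspace_sub[OF V' Ns]
  have mem: "\<delta> v \<in> vcar (C \<otimes> sub V N)" if "v \<in> N" for v using N that by (simp add: subcomodule_def)
  have \<delta>': "lin (sub V N) (C \<otimes> sub V N) \<delta>"
    using \<delta> mem is_subspaceD(1)[OF V' Ns] by (simp add: lin_def subset_iff)
  show cop: "cop C (sub V N) \<delta> f v = cop C V \<delta> f v" if f: "lin C base f" and v: "v \<in> N" for f v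
    using tlift_sub_eq2[OF C' V' V' Ns bilin_lslice[OF C' V' f] mem[OF v]] by (simp add: cop_def lslice_def)
  have cl: "cop C V \<delta> f v \<in> N" if f: "lin C base f" and v: "v \<in> N" for f v
    using N that unfolding subcomodule_iff[OF C' V' \<Delta> \<delta>] by blast
  show "comodule C (sub V N) \<delta>"
    unfolding comodule_iff[OF C' N' \<Delta> \<delta>']
    using V[unfolded comodule_iff[OF C' V' \<Delta> \<delta>]] is_subspaceD(1)[OF V' Ns]
    by (auto simp: cop cl coalgebra_counit[OF C] lin_conv[OF C' V' \<Delta> \<delta>])
qed

section \<open>Comodules over pointed coalgebras\<close>

text \<open>A nonzero candidate of least dimension is minimal: a vector outside a smaller candidate
  would enlarge its basis. The predicate \<open>P\<close> is abstract because both subcomodules and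
  subcoalgebras are needed.\<close>

lemma minimal_subspace_exists:
  assumes V: "is_vspace V" and B: "finite B" "N0 \<subseteq> module.span (vscale V) B"
    and N0: "P N0" "N0 \<noteq> {0}" and P: "\<And>N. P N \<Longrightarrow> is_subspace V N"
  shows "\<exists>N. P N \<and> N \<subseteq> N0 \<and> N \<noteq> {0} \<and> (\<forall>M. P M \<and> M \<subseteq> N \<longrightarrow> M = {0} \<or> M = N)"
proof -
  interpret vector_space "vscale V" using V by (simp add: is_vspace_def)
  let ?Q = "\<lambda>N. P N \<and> N \<subseteq> N0 \<and> N \<noteq> {0}"
  obtain N where N: "?Q N" and min: "\<And>M. ?Q M \<Longrightarrow> dim N \<le> dim M"
    using ex_has_least_nat[of ?Q N0 dim] N0 by auto
  have "M = N" if M: "P M" "M \<subseteq> N" "M \<noteq> {0}" for M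
  proof (rule ccontr)
    assume "M \<noteq> N"
    then obtain x where x: "x \<in> N" "x \<notin> M" using M by auto
    have sM: "subspace M" using P[OF M(1)] by (simp add: is_subspace_def)
    obtain b where b: "b \<subseteq> M" "independent b" "M \<subseteq> span b" "card b = dim M"
      using basis_exists by blast
    obtain b' where b': "b' \<subseteq> N" "independent b'" "N \<subseteq> span b'" "card b' = dim N"
      using basis_exists by blast
    have fin: "finite b" "finite b'"
      using independent_span_bound[OF B(1)] b b' B N M by (meson subset_trans)+
    have nx: "x \<notin> span b" using x(2) span_subspace[OF b(1,3) sM] by simp
    have "independent (insert x b)" using b(2) nx by (simp add: independent_insert)
    moreover have "insert x b \<subseteq> span b'" using x b(1) M(2) b'(3) by auto
    ultimately have "card (insert x b) \<le> card b'" using independent_span_bound[OF fin(2)] by blast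
    moreover have "x \<notin> b" using nx span_base by blast
    ultimately have "dim M < dim N" using fin b(4) b'(4) by simp
    then show False using min[of M] M N by auto
  qed
  then show ?thesis using N by blast
qed

section \<open>Matrix coefficients and the search for an eigenvector\<close>

locale comodule_over =
  fixes C :: "('k::field, 'c::ab_group_add, 'y) coalg_scheme"
    and V :: "('k, 'v::ab_group_add, 'z) vspace_scheme"
    and \<delta> :: "'v \<Rightarrow> ('k, 'c, 'v) tensor"
  assumes coalg: "coalgebra C" and com: "comodule C V \<delta>"
begin

interpretation C: vector_space "vscale C" using coalgebra_vspace[OF coalg] by (simp add: is_vspace_def)
interpretation V: vector_space "vscale V" using comodule_vspace[OF com] by (simp add: is_vspace_def)

lemmas C = coalgebra_vspace[OF coalg] and V = comodule_vspace[OF com]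
  and \<Delta> = coalgebra_lin[OF coalg] and \<delta> = comodule_lin[OF com]

abbreviation "T \<equiv> cop C V \<delta>"
abbreviation "L \<equiv> cop C C (comult C)"

text \<open>The matrix coefficient \<open>\<xi>(s_(0)) s_(-1)\<close> of the comodule.\<close>

definition coeff where "coeff \<xi> s = rslice C V \<xi> (\<delta> s)"

lemma lin_T: "lin C base f \<Longrightarrow> lin V V (T f)" by (rule lin_cop[OF C V \<Delta> \<delta>])
lemma lin_L: "lin C base f \<Longrightarrow> lin C C (L f)" by (rule lin_cop[OF C C \<Delta> \<Delta>])
lemma lin_coeff: "lin V base \<xi> \<Longrightarrow> lin V C (coeff \<xi>)"
  unfolding coeff_def[abs_def] by (rule lin_comp[OF lin_rslice[OF C V] \<delta>])

lemma lin_map_coeff: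
  assumes \<xi>: "lin V base \<xi>" and s: "s \<in> vcar V" and F: "lin C C F"
  shows "F (coeff \<xi> s) = tlift C V (\<lambda>c v. vscale C (\<xi> v) (F c)) (\<delta> s)"
proof -
  have "F (coeff \<xi> s) = tlift C V (\<lambda>c v. F (vscale C (\<xi> v) c)) (\<delta> s)"
    unfolding coeff_def rslice_def
    by (rule lin_tlift_comp[OF C V C C bilin_rslice[OF C V \<xi>] F lin_in[OF \<delta> s]])
  also have "\<dots> = tlift C V (\<lambda>c v. vscale C (\<xi> v) (F c)) (\<delta> s)"
    by (intro tlift_cong refl) (simp add: lin_scale[OF F])
  finally show ?thesis .
qed

text \<open>Coassociativity transfers the left contraction of the coproduct to the vector. With
  \<open>\<xi>\<close> fixed, the coefficients of a subcomodule therefore form a left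
  coideal.\<close>

lemma L_coeff:
  assumes f: "lin C base f" and \<xi>: "lin V base \<xi>" and s: "s \<in> vcar V"
  shows "L f (coeff \<xi> s) = coeff \<xi> (T f s)"
proof -
  let ?B = "\<lambda>c c' v. vscale C (f c * \<xi> v) c'"
  have "L f (coeff \<xi> s) = tlift C V (\<lambda>c v. vscale C (\<xi> v) (L f c)) (\<delta> s)"
    by (rule lin_map_coeff[OF \<xi> s lin_L[OF f]])
  also have "\<dots> = tlift C V (\<lambda>c v. tlift C C (\<lambda>c1 c2. ?B c1 c2 v) (comult C c)) (\<delta> s)"
  proof (intro tlift_cong refl)
    fix c v assume c: "c \<in> vcar C"
    show "vscale C (\<xi> v) (L f c) = tlift C C (\<lambda>c1 c2. ?B c1 c2 v) (comult C c)"
      using lin_tlift_comp[OF C C C C bilin_lslice[OF C C f] lin_scale2[OF lin_id C] lin_in[OF \<Delta> c], of "\<xi> v"]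
      by (simp add: cop_def lslice_def vs_simps[OF C] mult.commute)
  qed
  also have "\<dots> = tlift C V (\<lambda>c v. tlift C V (?B c) (\<delta> v)) (\<delta> s)"
    by (rule comodule_coassoc[OF C V C \<Delta> \<delta> _ _ com s, symmetric])
      (intro bilinI lin_scale1 lin_scale2 lin_base1 lin_base2 lin_id f \<xi> C V; assumption)+
  also have "\<dots> = tlift C V (\<lambda>c v. coeff \<xi> (vscale V (f c) v)) (\<delta> s)"
  proof (intro tlift_cong refl)
    fix c v assume v: "v \<in> vcar V"
    show "tlift C V (?B c) (\<delta> v) = coeff \<xi> (vscale V (f c) v)"
      unfolding lin_scale[OF lin_coeff[OF \<xi>] v]
      using lin_tlift_comp[OF C V C C bilin_rslice[OF C V \<xi>] lin_scale2[OF lin_id C] lin_in[OF \<delta> v], of "f c"]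
      by (simp add: coeff_def rslice_def vs_simps[OF C])
  qed
  also have "\<dots> = coeff \<xi> (T f s)"
    unfolding cop_def lslice_def
    by (rule lin_tlift_comp[OF C V V C bilin_lslice[OF C V f] lin_coeff[OF \<xi>] lin_in[OF \<delta> s], symmetric])
  finally show ?thesis .
qed

lemma R_coeff:
  assumes f: "lin C base f" and \<xi>: "lin V base \<xi>" and s: "s \<in> vcar V"
  shows "rslice C C f (comult C (coeff \<xi> s)) = coeff (\<lambda>v. \<xi> (T f v)) s"
proof -
  let ?B = "\<lambda>c c' v. vscale C (f c' * \<xi> v) c"
  have "rslice C C f (comult C (coeff \<xi> s)) = tlift C V (\<lambda>c v. vscale C (\<xi> v) (rslice C C f (comult C c))) (\<delta> s)"
    by (rule lin_map_coeff[OF \<xi> s lin_comp[OF lin_rslice[OF C C f] \<Delta>]])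
  also have "\<dots> = tlift C V (\<lambda>c v. tlift C C (\<lambda>c1 c2. ?B c1 c2 v) (comult C c)) (\<delta> s)"
  proof (intro tlift_cong refl)
    fix c v assume c: "c \<in> vcar C"
    show "vscale C (\<xi> v) (rslice C C f (comult C c)) = tlift C C (\<lambda>c1 c2. ?B c1 c2 v) (comult C c)"
      using lin_tlift_comp[OF C C C C bilin_rslice[OF C C f] lin_scale2[OF lin_id C] lin_in[OF \<Delta> c], of "\<xi> v"]
      by (simp add: rslice_def vs_simps[OF C] mult.commute)
  qed
  also have "\<dots> = tlift C V (\<lambda>c v. tlift C V (?B c) (\<delta> v)) (\<delta> s)"
    by (rule comodule_coassoc[OF C V C \<Delta> \<delta> _ _ com s, symmetric])
      (intro bilinI lin_scale1 lin_scale2 lin_base1 lin_base2 lin_id f \<xi> C V; assumption)+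
  also have "\<dots> = tlift C V (\<lambda>c v. vscale C (\<xi> (T f v)) c) (\<delta> s)"
  proof (intro tlift_cong refl)
    fix c v assume c: "c \<in> vcar C" and v: "v \<in> vcar V"
    show "tlift C V (?B c) (\<delta> v) = vscale C (\<xi> (T f v)) c"
      using lin_tlift_comp[OF C V V C bilin_lslice[OF C V f] lin_scale1[OF \<xi> C c] lin_in[OF \<delta> v]]
      by (simp add: cop_def lslice_def lin_scale[OF \<xi>])
  qed
  finally show ?thesis by (simp add: coeff_def rslice_def)
qed

text \<open>A finite sum of coefficient spaces, one per functional. The recursion on a list allows
  an induction that splits off one of them.\<close>

definition coeffs :: "'v set \<Rightarrow> ('v \<Rightarrow> 'k) list \<Rightarrow> 'c set" where
  "coeffs S \<xi>s = foldr (\<lambda>\<xi> M. {coeff \<xi> s + m | s m. s \<in> S \<and> m \<in> M}) \<xi>s {0}"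

lemma coeffs_simps: "coeffs S [] = {0}"
  "coeffs S (\<xi> # \<xi>s) = {coeff \<xi> s + m | s m. s \<in> S \<and> m \<in> coeffs S \<xi>s}"
  by (simp_all add: coeffs_def)

abbreviation functionals where "functionals \<equiv> {\<xi>. lin V base \<xi>}"

context
  fixes S assumes S: "is_subspace V S"
begin

lemmas S' = is_subspaceD[OF V S]

lemma subspace_coeffs: "set \<xi>s \<subseteq> functionals \<Longrightarrow> is_subspace C (coeffs S \<xi>s)"
proof (induction \<xi>s)
  case Nil
  show ?case by (rule is_subspaceI[OF C]) (auto simp: coeffs_simps vs_simps[OF C] vs_zero[OF C])
next
  case (Cons \<xi> \<xi>s)
  then have \<xi>: "lin V base \<xi>" and M: "is_subspace C (coeffs S \<xi>s)" by auto
  note M' = is_subspaceD[OF C M] and l = lin_coeff[OF \<xi>]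
  show ?case
  proof (rule is_subspaceI[OF C])
    show "coeffs S (\<xi> # \<xi>s) \<subseteq> vcar C"
      using S'(1) M'(1) lin_in[OF l] by (auto simp: coeffs_simps intro!: vs_add[OF C])
    show "0 \<in> coeffs S (\<xi> # \<xi>s)" unfolding coeffs_simps
      using S'(2) M'(2) lin_zero[OF V l] by force
  next
    fix x y assume "x \<in> coeffs S (\<xi> # \<xi>s)" "y \<in> coeffs S (\<xi> # \<xi>s)"
    then obtain s m s' m' where "x = coeff \<xi> s + m" "y = coeff \<xi> s' + m'"
      and m: "s \<in> S" "s' \<in> S" "m \<in> coeffs S \<xi>s" "m' \<in> coeffs S \<xi>s" unfolding coeffs_simps by blast
    then have "x + y = coeff \<xi> (s + s') + (m + m')"
      using S'(1) by (simp add: lin_add[OF l] subset_iff)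
    then show "x + y \<in> coeffs S (\<xi> # \<xi>s)" unfolding coeffs_simps using m S'(3) M'(3) by blast
  next
    fix c x assume "x \<in> coeffs S (\<xi> # \<xi>s)"
    then obtain s m where "x = coeff \<xi> s + m" and m: "s \<in> S" "m \<in> coeffs S \<xi>s"
      unfolding coeffs_simps by blast
    then have "vscale C c x = coeff \<xi> (vscale V c s) + vscale C c m"
      using S'(1) by (simp add: lin_scale[OF l] subset_iff vs_simps[OF C])
    then show "vscale C c x \<in> coeffs S (\<xi> # \<xi>s)" unfolding coeffs_simps using m S'(4) M'(4) by blast
  qed
qed

lemma coeffs_append:
  "set \<xi>s \<subseteq> functionals \<Longrightarrow> set \<eta>s \<subseteq> functionals \<Longrightarrow> x \<in> coeffs S \<xi>s \<Longrightarrow> y \<in> coeffs S \<eta>s \<Longrightarrow>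
    x + y \<in> coeffs S (\<xi>s @ \<eta>s)"
proof (induction \<xi>s arbitrary: x)
  case Nil then show ?case by (simp add: coeffs_simps)
next
  case (Cons \<xi> \<xi>s)
  then obtain s m where "x = coeff \<xi> s + m" and m: "s \<in> S" "m \<in> coeffs S \<xi>s"
    unfolding coeffs_simps by blast
  then have "x + y = coeff \<xi> s + (m + y)" "m + y \<in> coeffs S (\<xi>s @ \<eta>s)"
    using Cons by (simp_all add: add.assoc)
  then show ?case unfolding append_Cons coeffs_simps using m by blast
qed

lemma R_coeffs:
  assumes f: "lin C base f"
  shows "set \<xi>s \<subseteq> functionals \<Longrightarrow> x \<in> coeffs S \<xi>s \<Longrightarrow>
    rslice C C f (comult C x) \<in> coeffs S (map (\<lambda>\<xi> v. \<xi> (T f v)) \<xi>s)"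
proof (induction \<xi>s arbitrary: x)
  note l = lin_comp[OF lin_rslice[OF C C f] \<Delta>]
  {
    case Nil then show ?case using lin_zero[OF C l] by (simp add: coeffs_simps)
  next
    case (Cons \<xi> \<xi>s)
    then obtain s m where "x = coeff \<xi> s + m" and m: "s \<in> S" "m \<in> coeffs S \<xi>s"
      unfolding coeffs_simps by blast
    moreover have "coeff \<xi> s \<in> vcar C" "m \<in> vcar C" "s \<in> vcar V" "lin V base \<xi>"
      using lin_in[OF lin_coeff] Cons.prems m S'(1) is_subspaceD(1)[OF C subspace_coeffs[of \<xi>s]] by auto
    ultimately have "rslice C C f (comult C x) = coeff (\<lambda>v. \<xi> (T f v)) s + rslice C C f (comult C m)"
      by (simp add: lin_add[OF l] R_coeff[OF f])
    moreover have "rslice C C f (comult C m) \<in> coeffs S (map (\<lambda>\<xi> v. \<xi> (T f v)) \<xi>s)"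
      using Cons.IH[OF _ m(2)] Cons.prems by simp
    ultimately show ?case unfolding list.map coeffs_simps using m by blast
  }
qed

end

context
  fixes S assumes S: "subcomodule C V \<delta> S"
begin

lemma subcomodule_subspace: "is_subspace V S" and subcomodule_stable: "lin C base f \<Longrightarrow> s \<in> S \<Longrightarrow> T f s \<in> S"
  using S unfolding subcomodule_iff[OF C V \<Delta> \<delta>] by blast+

lemma L_coeffs:
  assumes f: "lin C base f"
  shows "set \<xi>s \<subseteq> functionals \<Longrightarrow> x \<in> coeffs S \<xi>s \<Longrightarrow> L f x \<in> coeffs S \<xi>s"
proof (induction \<xi>s arbitrary: x)
  note l = lin_L[OF f]
  {
    case Nil then show ?case using lin_zero[OF C l] by (simp add: coeffs_simps)
  next
    case (Cons \<xi> \<xi>s)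
    then obtain s m where "x = coeff \<xi> s + m" and m: "s \<in> S" "m \<in> coeffs S \<xi>s"
      unfolding coeffs_simps by blast
    moreover have "coeff \<xi> s \<in> vcar C" "m \<in> vcar C" "s \<in> vcar V" "lin V base \<xi>"
      using lin_in[OF lin_coeff] Cons.prems m is_subspaceD(1)[OF V subcomodule_subspace]
        is_subspaceD(1)[OF C subspace_coeffs[OF subcomodule_subspace, of \<xi>s]] by auto
    ultimately have "L f x = coeff \<xi> (T f s) + L f m"
      by (simp add: lin_add[OF l] L_coeff[OF f])
    moreover have "L f m \<in> coeffs S \<xi>s" using Cons.IH[OF _ m(2)] Cons.prems by simp
    ultimately show ?case unfolding coeffs_simps using subcomodule_stable[OF f m(1)] by blast
  }
qed

text \<open>
  Write \<open>g = coeff \<xi> s + m\<close> with \<open>m\<close> in the sum \<open>M\<close> of the remaining left coideals.  The \<open>s'\<close> in the simple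
  comodule \<open>S\<close> with \<open>coeff \<xi> s' \<in> M\<close> form a subcomodule.  If it is \<open>S\<close>, then \<open>g \<in> M\<close>; if it is \<open>0\<close>,
  then \<open>\<Delta> g = g \<otimes> g\<close> read modulo \<open>M\<close> says that \<open>s\<close> has coaction \<open>g \<otimes> s\<close>.
\<close>
lemma grouplike_in_coeffs:
  assumes min: "\<And>M. subcomodule C V \<delta> M \<Longrightarrow> M \<subseteq> S \<Longrightarrow> M = {0} \<or> M = S"
    and g: "g \<in> grouplikes C"
  shows "set \<xi>s \<subseteq> functionals \<Longrightarrow> g \<in> coeffs S \<xi>s \<Longrightarrow>
    \<exists>s\<in>S. s \<noteq> 0 \<and> (\<forall>f. lin C base f \<longrightarrow> T f s = vscale V (f g) s)"
proof (induction \<xi>s)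
  case Nil
  then have "g = 0" by (simp add: coeffs_simps)
  moreover have "counit C 0 = 0" using lin_zero[OF C coalgebra_counit[OF coalg]] .
  ultimately show ?case using g by (simp add: grouplikes_def)
next
  case (Cons \<xi> \<xi>s)
  have \<xi>: "lin V base \<xi>" and \<xi>s: "set \<xi>s \<subseteq> functionals" using Cons.prems by auto
  note l = lin_coeff[OF \<xi>] and M = subspace_coeffs[OF subcomodule_subspace \<xi>s]
  note M' = is_subspaceD[OF C M] and S' = is_subspaceD[OF V subcomodule_subspace]
  obtain s m where gsm: "g = coeff \<xi> s + m" and s: "s \<in> S" and m: "m \<in> coeffs S \<xi>s"
    using Cons.prems(2) unfolding coeffs_simps by blast
  have sV: "s \<in> vcar V" using s S' by blast
  show ?case
  proof (cases "coeff \<xi> s \<in> coeffs S \<xi>s")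
    case True
    then show ?thesis using Cons.IH \<xi>s gsm M'(3) m by blast
  next
    case False
    define W where "W = {s \<in> S. coeff \<xi> s \<in> coeffs S \<xi>s}"
    have "subcomodule C V \<delta> W"
      unfolding subcomodule_iff[OF C V \<Delta> \<delta>]
    proof (intro conjI allI impI ballI)
      show "is_subspace V W"
      proof (rule is_subspaceI[OF V])
        show "W \<subseteq> vcar V" using S'(1) by (auto simp: W_def)
        show "0 \<in> W" using S'(2) M'(2) lin_zero[OF V l] by (simp add: W_def)
        show "x + y \<in> W" if "x \<in> W" "y \<in> W" for x y
          using that S'(1,3) M'(3) by (simp add: W_def lin_add[OF l] subset_iff)
        show "vscale V c x \<in> W" if "x \<in> W" for c x
          using that S'(1,4) M'(4) by (simp add: W_def lin_scale[OF l] subset_iff)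
      qed
      fix f v assume f: "lin C base f" and v: "v \<in> W"
      then have "v \<in> S" "coeff \<xi> v \<in> coeffs S \<xi>s" by (auto simp: W_def)
      moreover from this(1) have "v \<in> vcar V" using S'(1) by blast
      ultimately show "T f v \<in> W"
        unfolding W_def mem_Collect_eq L_coeff[OF f \<xi> \<open>v \<in> vcar V\<close>, symmetric]
        using subcomodule_stable[OF f] L_coeffs[OF f \<xi>s] by blast
    qed
    moreover have "W \<noteq> S" using False s by (auto simp: W_def)
    ultimately have W: "W = {0}" using min[of W] by (auto simp: W_def)
    have "T f s = vscale V (f g) s" if f: "lin C base f" for f
    proof -
      have Tf: "T f s \<in> S" by (rule subcomodule_stable[OF f s])
      have gC: "g \<in> vcar C" using g by (simp add: grouplikes_def)
      have mC: "m \<in> vcar C" and cC: "coeff \<xi> s \<in> vcar C" using m M'(1) lin_in[OF l sV] by auto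
      have "L f g = vscale C (f g) g"
        using g lslice_tens[OF C C f gC gC] by (simp add: cop_def grouplikes_def)
      moreover have "L f g = coeff \<xi> (T f s) + L f m"
        unfolding gsm lin_add[OF lin_L[OF f] cC mC] L_coeff[OF f \<xi> sV] ..
      ultimately have "coeff \<xi> (T f s) - vscale C (f g) (coeff \<xi> s) = vscale C (f g) m - L f m"
        by (simp add: gsm vs_simps[OF C] algebra_simps)
      moreover have "coeff \<xi> (T f s - vscale V (f g) s) = coeff \<xi> (T f s) - vscale C (f g) (coeff \<xi> s)"
        using lin_diff[OF V l, of "T f s" "vscale V (f g) s"] Tf S'(1) S'(4)[OF s, of "f g"]
        by (simp add: lin_scale[OF l sV] subset_iff)
      moreover have "vscale C (f g) m - L f m \<in> coeffs S \<xi>s"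
        using M'(4,5) m L_coeffs[OF f \<xi>s] by blast
      moreover have "T f s - vscale V (f g) s \<in> S" using Tf S'(4,5) s by blast
      ultimately have "T f s - vscale V (f g) s \<in> W" by (simp add: W_def)
      then show ?thesis using W by simp
    qed
    moreover have "s \<noteq> 0" using False M'(2) lin_zero[OF V l] by auto
    ultimately show ?thesis using s by blast
  qed
qed

end

lemma T_add: "lin C base f \<Longrightarrow> lin C base g \<Longrightarrow> v \<in> vcar V \<Longrightarrow> T (\<lambda>c. f c + g c) v = T f v + T g v"
  unfolding cop_def lslice_def vs_simps[OF V]
  by (rule tlift_plus[OF C V V bilin_lslice[OF C V] bilin_lslice[OF C V] lin_in[OF \<delta>]])

lemma T_scale:
  assumes f: "lin C base f" and v: "v \<in> vcar V"
  shows "T (\<lambda>c. a * f c) v = vscale V a (T f v)"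
  using lin_tlift_comp[OF C V V V bilin_lslice[OF C V f] lin_scale2[OF lin_id V] lin_in[OF \<delta> v], of a]
  by (simp add: cop_def lslice_def vs_simps[OF V])

text \<open>The vectors \<open>T f v\<close>, for one \<open>v \<noteq> 0\<close>, form a
  subcomodule since operators compose by convolution. It contains \<open>v\<close> by the counit,
  and it lies in the span of the finitely many right factors of \<open>\<delta> v\<close>; a minimal
  subcomodule inside it is simple.\<close>

lemma simple_subcomodule_exists:
  assumes ne: "vcar V \<noteq> {0}"
  shows "\<exists>S B. simple_subcomodule C V \<delta> S \<and> finite B \<and> S \<subseteq> V.span B"
proof -
  obtain v where v: "v \<in> vcar V" "v \<noteq> 0" using ne vs_zero[OF V] by auto
  define N where "N = {T f v | f. lin C base f}"
  obtain ps where ps: "set ps \<subseteq> vcar C \<times> vcar V" "\<delta> v = (\<Sum>(c, w) \<leftarrow> ps. tens C V c w)"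
    using tensor_rep[OF C lin_in[OF \<delta> v(1)]] by blast
  have fin: "N \<subseteq> V.span (snd ` set ps)"
  proof
    fix x assume "x \<in> N"
    then obtain f where f: "lin C base f" and x: "x = T f v" by (auto simp: N_def)
    have "x = (\<Sum>(c, w) \<leftarrow> ps. vscale V (f c) w)"
      unfolding x cop_def ps(2) lslice_def by (rule tlift_rep[OF C V V bilin_lslice[OF C V f] ps(1)])
    moreover have "(\<Sum>(c, w) \<leftarrow> qs. vscale V (f c) w) \<in> V.span (snd ` set ps)" if "set qs \<subseteq> set ps" for qs
      using that
    proof (induction qs)
      case (Cons a qs)
      then have "snd a \<in> V.span (snd ` set ps)" by (intro V.span_base) auto
      then show ?case using Cons by (auto simp: case_prod_unfold intro!: V.span_add V.span_scale)
    qed (simp add: V.span_zero)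
    ultimately show "x \<in> V.span (snd ` set ps)" by blast
  qed
  have sub: "subcomodule C V \<delta> N"
    unfolding subcomodule_iff[OF C V \<Delta> \<delta>]
  proof (intro conjI allI impI ballI)
    show "is_subspace V N"
    proof (rule is_subspaceI[OF V])
      show "N \<subseteq> vcar V" using lin_in[OF lin_T v(1)] by (auto simp: N_def)
      have "lin C base (\<lambda>_. 0)" by (rule linI) simp_all
      moreover from T_scale[OF this v(1), of 0] have "T (\<lambda>_. 0) v = 0" by (simp add: vs_simps[OF V])
      ultimately show "0 \<in> N" unfolding N_def by (metis (mono_tags, lifting) mem_Collect_eq)
      show "x + y \<in> N" if xy: "x \<in> N" "y \<in> N" for x y
      proof -
        obtain f g where f: "lin C base f" "x = T f v" and g: "lin C base g" "y = T g v"
          using xy unfolding N_def by blast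
        have "x + y = T (\<lambda>c. f c + g c) v" using T_add[OF f(1) g(1) v(1)] f g by simp
        then show ?thesis unfolding N_def using lin_plus[OF f(1) g(1) is_vspace_base] by blast
      qed
      show "vscale V a x \<in> N" if x: "x \<in> N" for a x
      proof -
        obtain f where f: "lin C base f" "x = T f v" using x unfolding N_def by blast
        have "vscale V a x = T (\<lambda>c. a * f c) v" using T_scale[OF f(1) v(1)] f by simp
        then show ?thesis unfolding N_def using lin_base2[OF f(1)] by blast
      qed
    qed
    fix f x assume f: "lin C base f" and "x \<in> N"
    then obtain g where g: "lin C base g" "x = T g v" unfolding N_def by blast
    have "T f x = T (conv C g f) v"
      using com v(1) f g unfolding comodule_iff[OF C V \<Delta> \<delta>] by simp
    then show "T f x \<in> N" unfolding N_def using lin_conv[OF C V \<Delta> \<delta> g(1) f] by blast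
  qed
  have "T (counit C) v = v" using com v(1) unfolding comodule_iff[OF C V \<Delta> \<delta>] by simp
  then have "v \<in> N" unfolding N_def using coalgebra_counit[OF coalg] by force
  then have "N \<noteq> {0}" using v by auto
  from minimal_subspace_exists[of V "snd ` set ps" N "subcomodule C V \<delta>", OF V _ fin sub this]
  obtain S where "subcomodule C V \<delta> S" "S \<subseteq> N" "S \<noteq> {0}"
    "\<forall>M. subcomodule C V \<delta> M \<and> M \<subseteq> S \<longrightarrow> M = {0} \<or> M = S"
    by (auto simp: subcomodule_def)
  then show ?thesis
    using fin by (intro exI[of _ S] exI[of _ "snd ` set ps"]) (auto simp: simple_subcomodule_def)
qed

text \<open>The left factors in one representation of \<open>\<delta> b\<close> span the
  coefficients of \<open>b\<close> for all functionals simultaneously.\<close>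

lemma coeff_finite:
  assumes B: "finite B" "B \<subseteq> vcar V"
  shows "\<exists>X. finite X \<and> (\<forall>s \<in> vcar V \<inter> V.span B. \<forall>\<xi>. lin V base \<xi> \<longrightarrow> coeff \<xi> s \<in> C.span X)"
proof -
  have "\<exists>X. finite X \<and> (\<forall>\<xi>. lin V base \<xi> \<longrightarrow> coeff \<xi> b \<in> C.span X)" if b: "b \<in> B" for b
  proof -
    obtain ps where ps: "set ps \<subseteq> vcar C \<times> vcar V" "\<delta> b = (\<Sum>(c, w) \<leftarrow> ps. tens C V c w)"
      using tensor_rep[OF C lin_in[OF \<delta>]] b B by blast
    have "coeff \<xi> b \<in> C.span (fst ` set ps)" if \<xi>: "lin V base \<xi>" for \<xi>
    proof -
      have "coeff \<xi> b = (\<Sum>(c, w) \<leftarrow> ps. vscale C (\<xi> w) c)"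
        unfolding coeff_def ps(2) rslice_def by (rule tlift_rep[OF C V C bilin_rslice[OF C V \<xi>] ps(1)])
      moreover have "(\<Sum>(c, w) \<leftarrow> qs. vscale C (\<xi> w) c) \<in> C.span (fst ` set ps)" if "set qs \<subseteq> set ps" for qs
        using that
      proof (induction qs)
        case (Cons a qs)
        then have "fst a \<in> C.span (fst ` set ps)" by (intro C.span_base) auto
        then show ?case using Cons by (auto simp: case_prod_unfold intro!: C.span_add C.span_scale)
      qed (simp add: C.span_zero)
      ultimately show ?thesis by auto
    qed
    then show ?thesis by blast
  qed
  then obtain X where X: "\<And>b. b \<in> B \<Longrightarrow> finite (X b)"
    "\<And>b \<xi>. b \<in> B \<Longrightarrow> lin V base \<xi> \<Longrightarrow> coeff \<xi> b \<in> C.span (X b)" by metis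
  have "coeff \<xi> s \<in> C.span (\<Union>(X ` B))" if s: "s \<in> V.span B" and \<xi>: "lin V base \<xi>" for s \<xi>
  proof -
    note l = lin_coeff[OF \<xi>]
    have BX: "coeff \<xi> b \<in> C.span (\<Union>(X ` B))" if "b \<in> B" for b
      using X(2)[OF that \<xi>] C.span_mono[of "X b" "\<Union>(X ` B)"] that by blast
    have "s \<in> vcar V \<and> coeff \<xi> s \<in> C.span (\<Union>(X ` B))"
      using s
    proof (induction rule: V.span_induct_alt)
      case base
      then show ?case using vs_zero[OF V] lin_zero[OF V l] C.span_zero by simp
    next
      case (step c x y)
      then show ?case
        using BX B(2) vs_add[OF V] vs_scale[OF V] 
        by (auto simp: lin_add[OF l] lin_scale[OF l] subset_iff intro!: C.span_add C.span_scale)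
    qed
    then show ?thesis by blast
  qed
  then show ?thesis using X(1) B(1) by blast
qed

text \<open>Left contractions keep the list of functionals, right contractions replace each
  \<open>\<xi>\<close> by \<open>\<xi> \<circ> T f\<close>; the union over all lists is closed under
  both.\<close>

lemma subcoalgebra_coeffs:
  assumes S: "subcomodule C V \<delta> S"
  shows "subcoalgebra C (\<Union>\<xi>s \<in> lists functionals. coeffs S \<xi>s)" (is "subcoalgebra C ?D")
proof -
  note subcomodule_subspace = subcomodule_subspace[OF S]
  have sub: "is_subspace C ?D"
  proof (rule is_subspaceI[OF C])
    show "?D \<subseteq> vcar C" using is_subspaceD(1)[OF C subspace_coeffs[OF subcomodule_subspace]] by blast
    show "0 \<in> ?D" using coeffs_simps(1)[of S] by (intro UN_I[of "[]"]) auto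
    fix x y assume "x \<in> ?D" "y \<in> ?D"
    then obtain \<xi>s \<eta>s where "set \<xi>s \<subseteq> functionals" "set \<eta>s \<subseteq> functionals" "x \<in> coeffs S \<xi>s" "y \<in> coeffs S \<eta>s"
      by auto
    then show "x + y \<in> ?D" using coeffs_append[OF subcomodule_subspace] by (intro UN_I[of "\<xi>s @ \<eta>s"]) auto
  next
    fix c x assume "x \<in> ?D"
    then show "vscale C c x \<in> ?D" using is_subspaceD(4)[OF C subspace_coeffs[OF subcomodule_subspace]] by blast
  qed
  show ?thesis
    unfolding subcoalgebra_def
  proof (intro conjI ballI sub tensor_in_both[OF C C _ sub sub])
    fix x assume x: "x \<in> ?D"
    then show "comult C x \<in> vcar (C \<otimes> C)" using is_subspaceD(1)[OF C sub] lin_in[OF \<Delta>] by blast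
    fix f assume f: "lin C base f"
    show "lslice C C f (comult C x) \<in> ?D" using x L_coeffs[OF S f] by (auto simp: cop_def)
    from x obtain \<xi>s where \<xi>s: "set \<xi>s \<subseteq> functionals" "x \<in> coeffs S \<xi>s" by auto
    show "rslice C C f (comult C x) \<in> ?D"
      using R_coeffs[OF subcomodule_subspace f \<xi>s] subsetD[OF \<xi>s(1)]
      by (intro UN_I[of "map (\<lambda>\<xi> v. \<xi> (T f v)) \<xi>s"]) (auto intro!: lin_comp[OF _ lin_T[OF f]])
  qed
qed

text \<open>If \<open>d\<close> spans \<open>D\<close>, its coproduct is \<open>\<kappa>\<close>
  times \<open>d \<otimes> d\<close>. The counit law forces
  \<open>\<kappa> * counit C d = 1\<close>, so \<open>\<kappa>\<close> times \<open>d\<close> is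
  group-like.\<close>

lemma one_dim_subcoalgebra:
  assumes D: "subcoalgebra C D" and d1: "C.dim D = 1"
  shows "\<exists>g\<in>D. g \<in> grouplikes C"
proof -
  have sD: "is_subspace C D" using D by (simp add: subcoalgebra_def)
  note D' = is_subspaceD[OF C sD]
  obtain b where b: "b \<subseteq> D" "C.independent b" "D \<subseteq> C.span b" "card b = C.dim D"
    using C.basis_exists by blast
  then obtain d where "b = {d}" using d1 by (metis card_1_singletonE)
  then have d: "d \<in> D" "d \<noteq> 0" "D \<subseteq> C.span {d}" using b C.dependent_single by auto
  then have dC: "d \<in> vcar C" using D' by blast
  have "comult C d \<in> vcar (sub C D \<otimes> sub C D)" using D d by (simp add: subcoalgebra_def)
  from tensor_rep[OF is_vspace_sub[OF C sD] this] obtain ps where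
    ps: "set ps \<subseteq> D \<times> D" "comult C d = (\<Sum>(v, w)\<leftarrow>ps. tens C C v w)" by auto
  have "\<exists>\<kappa>. (\<Sum>(v, w)\<leftarrow>ps. tens C C v w) = tens C C (vscale C \<kappa> d) d" using ps(1)
  proof (induction ps)
    case Nil
    show ?case using tens_add1[of C C 0 0 d] by (intro exI[of _ 0]) (simp add: vs_simps[OF C])
  next
    case (Cons a ps)
    then obtain \<kappa> where \<kappa>: "(\<Sum>(v, w)\<leftarrow>ps. tens C C v w) = tens C C (vscale C \<kappa> d) d" by auto
    have "fst a \<in> C.span {d}" "snd a \<in> C.span {d}" using Cons.prems d(3) by auto
    then obtain \<alpha> \<beta> where a: "a = (vscale C \<alpha> d, vscale C \<beta> d)"
      unfolding C.span_singleton by (metis prod.collapse rangeE)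
    have "tens C C (vscale C \<alpha> d) (vscale C \<beta> d) = tens C C (vscale C (\<beta> * \<alpha>) d) d"
      by (simp only: tens_scale2 tens_scale1[symmetric] vs_simps[OF C])
    then have "(\<Sum>(v, w)\<leftarrow>a # ps. tens C C v w) = tens C C (vscale C (\<beta> * \<alpha> + \<kappa>) d) d"
      unfolding a list.map sum_list.Cons prod.case \<kappa> vs_simps(2)[OF C] tens_add1 by simp
    then show ?case by blast
  qed
  then obtain \<kappa> where \<kappa>: "comult C d = tens C C (vscale C \<kappa> d) d" using ps(2) by auto
  note \<epsilon> = coalgebra_counit[OF coalg]
  have kd: "vscale C \<kappa> d \<in> vcar C" using vs_scale[OF C dC] .
  have "d = tlift C C (\<lambda>y z. vscale C (counit C y) z) (comult C d)"
    using coalg dC by (simp add: coalgebra_def)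
  also have "\<dots> = vscale C (counit C (vscale C \<kappa> d)) d"
    using lslice_tens[OF C C \<epsilon> kd dC] by (simp add: \<kappa> lslice_def)
  finally have "vscale C 1 d = vscale C (\<kappa> * counit C d) d" by (simp add: lin_scale[OF \<epsilon> dC] vs_simps[OF C])
  then have 1: "\<kappa> * counit C d = 1" using d(2) C.scale_cancel_right by metis
  have "comult C (vscale C \<kappa> d) = tens C C (vscale C \<kappa> d) (vscale C \<kappa> d)"
    by (simp add: lin_scale[OF \<Delta> dC] \<kappa> tens_scale2)
  then have "vscale C \<kappa> d \<in> grouplikes C"
    using 1 kd by (simp add: grouplikes_def lin_scale[OF \<epsilon> dC])
  then show ?thesis using D'(4)[OF d(1)] by blast
qed

text \<open>The coefficients of a simple subcomodule \<open>S\<close> form a finite-dimensional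
  nonzero subcoalgebra \<open>D\<close>. A minimal subcoalgebra of \<open>D\<close> is
  one-dimensional by pointedness, so \<open>D\<close> contains a group-like \<open>g\<close>, and
  \<open>grouplike_in_coeffs\<close> finds the eigenvector for \<open>g\<close> in \<open>S\<close>
  itself.\<close>

theorem pointed_comodule_eigenvector:
  assumes pt: "pointed C" and ne: "vcar V \<noteq> {0}"
  shows "\<exists>g v. g \<in> grouplikes C \<and> v \<in> vcar V \<and> v \<noteq> 0 \<and> \<delta> v = tens C V g v"
proof -
  obtain S B0 where simple: "simple_subcomodule C V \<delta> S" and B0: "finite B0" "S \<subseteq> V.span B0"
    using simple_subcomodule_exists[OF ne] by blast
  then have S: "subcomodule C V \<delta> S" "S \<noteq> {0}"
    and min: "\<And>M. subcomodule C V \<delta> M \<Longrightarrow> M \<subseteq> S \<Longrightarrow> M = {0} \<or> M = S"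
    unfolding simple_subcomodule_def by blast+
  note subcomodule_subspace = subcomodule_subspace[OF S(1)]
  note S' = is_subspaceD[OF V subcomodule_subspace]
  \<comment> \<open>\<open>B0\<close> is not known to lie in the carrier, as
    \<open>coeff_finite\<close> demands. A basis of \<open>S\<close> does, and it is finite because
    \<open>B0\<close> spans \<open>S\<close>.\<close>
  obtain B where B: "B \<subseteq> S" "V.independent B" "S \<subseteq> V.span B" using V.basis_exists[of S] by metis
  have "finite B" using V.independent_span_bound[OF B0(1) B(2)] B(1) B0(2) by auto
  then obtain X where X: "finite X" "\<And>s \<xi>. s \<in> S \<Longrightarrow> lin V base \<xi> \<Longrightarrow> coeff \<xi> s \<in> C.span X"
    using coeff_finite[of B] B S'(1) by blast
  define D where "D = (\<Union>\<xi>s \<in> lists functionals. coeffs S \<xi>s)"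
  have "coeffs S \<xi>s \<subseteq> C.span X" if "set \<xi>s \<subseteq> functionals" for \<xi>s
    using that by (induction \<xi>s) (auto simp: coeffs_simps C.span_zero intro!: C.span_add X(2))
  then have DX: "D \<subseteq> C.span X" by (auto simp: D_def)
  have D: "subcoalgebra C D" unfolding D_def by (rule subcoalgebra_coeffs[OF S(1)])
  obtain s where s: "s \<in> S" "s \<noteq> 0" using S S'(2) by blast
  then have sV: "s \<in> vcar V" using S' by blast
  obtain \<xi> where \<xi>: "lin V base \<xi>" "\<xi> s = 1" using functional_exists[OF V sV s(2)] by blast
  have "coeff \<xi> s \<in> D" unfolding D_def
    using s \<xi> by (intro UN_I[of "[\<xi>]"]) (auto simp: coeffs_simps)
  \<comment> \<open>The counit of \<open>coeff \<xi> s\<close> is \<open>\<xi> s\<close>, which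
    shows that \<open>D\<close> is nonzero.\<close>
  moreover have "counit C (coeff \<xi> s) = 1"
  proof -
    note \<epsilon> = coalgebra_counit[OF coalg]
    have "counit C (coeff \<xi> s) = tlift C V (\<lambda>c v. counit C (vscale C (\<xi> v) c)) (\<delta> s)"
      unfolding coeff_def rslice_def
      by (rule lin_tlift_comp[OF C V C is_vspace_base bilin_rslice[OF C V \<xi>(1)] \<epsilon> lin_in[OF \<delta> sV]])
    also have "\<dots> = tlift C V (\<lambda>c v. \<xi> (vscale V (counit C c) v)) (\<delta> s)"
      by (intro tlift_cong refl) (simp add: lin_scale[OF \<epsilon>] lin_scale[OF \<xi>(1)])
    also have "\<dots> = \<xi> (tlift C V (\<lambda>c v. vscale V (counit C c) v) (\<delta> s))"
      by (rule lin_tlift_comp[OF C V V is_vspace_base bilin_lslice[OF C V \<epsilon>] \<xi>(1) lin_in[OF \<delta> sV], symmetric])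
    also have "\<dots> = 1" using com sV \<xi>(2) by (simp add: comodule_def)
    finally show ?thesis .
  qed
  ultimately have "D \<noteq> {0}" using lin_zero[OF C coalgebra_counit[OF coalg]] by fastforce
  from minimal_subspace_exists[of C X D "subcoalgebra C", OF C X(1) DX D this]
  obtain E where E: "subcoalgebra C E" "E \<subseteq> D" "E \<noteq> {0}"
    "\<forall>M. subcoalgebra C M \<and> M \<subseteq> E \<longrightarrow> M = {0} \<or> M = E"
    by (auto simp: subcoalgebra_def)
  then have "simple_subcoalgebra C E" by (simp add: simple_subcoalgebra_def)
  then have "C.dim E = 1" using pt by (simp add: pointed_def)
  from one_dim_subcoalgebra[OF E(1) this] obtain g where g: "g \<in> D" "g \<in> grouplikes C" using E by blast
  then obtain \<xi>s where "set \<xi>s \<subseteq> functionals" "g \<in> coeffs S \<xi>s" by (auto simp: D_def)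
  from grouplike_in_coeffs[OF S(1) min g(2) this] obtain s where
    s: "s \<in> S" "s \<noteq> 0" "\<And>f. lin C base f \<Longrightarrow> T f s = vscale V (f g) s" by blast
  have gC: "g \<in> vcar C" and sV: "s \<in> vcar V" using g S'(1) s(1) by (auto simp: grouplikes_def)
  have "\<delta> s = tens C V g s"
    by (rule tensor_eqI[OF C V lin_in[OF \<delta> sV] tens_in[OF gC sV]])
      (use s(3) in \<open>simp add: cop_def lslice_tens[OF C V _ gC sV]\<close>)
  then show ?thesis using g s sV by blast
qed

end

section \<open>Intersections, sums and chain unions of subcomodules\<close>

context comodule_over
begin

interpretation V: vector_space "vscale V" using comodule_vspace[OF com] by (simp add: is_vspace_def)

lemmas subcomodule_stable_iff = subcomodule_iff[OF C V \<Delta> \<delta>]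

lemma subcomodule_zero: "subcomodule C V \<delta> {0}"
  unfolding subcomodule_stable_iff
  using lin_zero[OF V lin_cop[OF C V \<Delta> \<delta>]] vs_zero[OF V]
  by (auto intro!: is_subspaceI[OF V] simp: vs_simps[OF V])

lemma subcomodule_Int:
  assumes "subcomodule C V \<delta> M" "subcomodule C V \<delta> N"
  shows "subcomodule C V \<delta> (M \<inter> N)"
proof -
  have "is_subspace V (M \<inter> N)"
    using assms V.subspace_inter unfolding subcomodule_stable_iff is_subspace_def by blast
  then show ?thesis using assms unfolding subcomodule_stable_iff by blast
qed

lemma subcomodule_sum:
  assumes "subcomodule C V \<delta> M" "subcomodule C V \<delta> N"
  shows "subcomodule C V \<delta> {x + y | x y. x \<in> M \<and> y \<in> N}"
proof -
  have s: "is_subspace V M" "is_subspace V N" using assms unfolding subcomodule_stable_iff by blast+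
  then have "is_subspace V {x + y | x y. x \<in> M \<and> y \<in> N}"
    using V.subspace_sums[of M N] vs_add[OF V] unfolding is_subspace_def by blast
  moreover have "cop C V \<delta> f (x + y) = cop C V \<delta> f x + cop C V \<delta> f y"
    if "lin C base f" "x \<in> M" "y \<in> N" for f x y
    using lin_add[OF lin_cop[OF C V \<Delta> \<delta> that(1)]] that is_subspaceD(1)[OF V] s by blast
  ultimately show ?thesis using assms unfolding subcomodule_stable_iff by blast
qed

lemma is_subspace_Union_chain:
  assumes "\<C> \<noteq> {}" "subset.chain S \<C>" "\<And>N. N \<in> \<C> \<Longrightarrow> is_subspace V N"
  shows "is_subspace V (\<Union>\<C>)"
proof (rule is_subspaceI[OF V])
  show "\<Union>\<C> \<subseteq> vcar V" using assms(3) is_subspaceD[OF V] by blast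
  show "0 \<in> \<Union>\<C>" using assms(1,3) is_subspaceD[OF V] by blast
  show "vscale V c x \<in> \<Union>\<C>" if "x \<in> \<Union>\<C>" for c x
    using is_subspaceD(4)[OF V assms(3)] that by blast
  fix x y assume "x \<in> \<Union>\<C>" "y \<in> \<Union>\<C>"
  then obtain M N where MN: "M \<in> \<C>" "N \<in> \<C>" "x \<in> M" "y \<in> N" by blast
  then have "M \<subseteq> N \<or> N \<subseteq> M" using assms(2) by (auto simp: subset.chain_def)
  then show "x + y \<in> \<Union>\<C>"
    using MN is_subspaceD(3)[OF V assms(3)[OF MN(1)]] is_subspaceD(3)[OF V assms(3)[OF MN(2)]] by blast
qed

lemma subcomodule_Union_chain:
  assumes "\<C> \<noteq> {}" "subset.chain S \<C>" "\<And>N. N \<in> \<C> \<Longrightarrow> subcomodule C V \<delta> N"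
  shows "subcomodule C V \<delta> (\<Union>\<C>)"
  using is_subspace_Union_chain[OF assms(1,2)] assms(3) unfolding subcomodule_stable_iff by blast

end

lemmas subcomodule_zero = comodule_over.subcomodule_zero[OF comodule_over.intro]
  and subcomodule_Int = comodule_over.subcomodule_Int[OF comodule_over.intro]
  and subcomodule_sum = comodule_over.subcomodule_sum[OF comodule_over.intro]
  and subcomodule_Union_chain = comodule_over.subcomodule_Union_chain[OF comodule_over.intro]
  and pointed_comodule_eigenvector = comodule_over.pointed_comodule_eigenvector[OF comodule_over.intro]

section \<open>Cosemisimplicity and diagonal coactions\<close>

lemma tensor_space_self: "sub V (vcar V) \<otimes> W = V \<otimes> W" "V \<otimes> sub W (vcar W) = V \<otimes> W"
  by (simp_all add: tensor_space_def)

lemma lin_self: "lin (sub V (vcar V)) W = lin V W" "lin V (sub W (vcar W)) = lin V W"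
  by (simp_all add: lin_def fun_eq_iff)

lemma is_vspace_self: "is_vspace (sub V (vcar V)) = is_vspace V"
  by (simp add: is_vspace_def)

text \<open>\<open>sub V (vcar V)\<close> forgets the record extension of \<open>V\<close>. This
  matters since \<open>cosemisimple\<close> quantifies over plain \<open>vspace\<close> records
  only.\<close>

lemma comodule_self: "comodule C (sub V (vcar V)) \<delta> = comodule C V \<delta>"
  by (simp add: comodule_def is_vspace_self lin_self tensor_space_self tmap_def tassoc_def tlift_self)

lemma subcomodule_self: "subcomodule C (sub V (vcar V)) \<delta> N = subcomodule C V \<delta> N"
  by (simp add: subcomodule_def is_subspace_def)

text \<open>Zorn's lemma gives a subcomodule \<open>C\<close> maximal with
  \<open>U \<inter> C = {0}\<close>. A simple subcomodule not inside \<open>U + C\<close> meets it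
  in zero and could be added to \<open>C\<close>; hence \<open>U + C\<close> contains all simple
  summands, and these span \<open>V\<close>.\<close>

lemma cosemisimple_complement:
  fixes V :: "('k::field, 'v::ab_group_add, 'z) vspace_scheme"
  assumes H: "coalgebra H" and ss: "cosemisimple TYPE('v) H"
    and V: "comodule H V \<delta>" and U: "subcomodule H V \<delta> U"
  shows "\<exists>C. subcomodule H V \<delta> C \<and> U \<inter> C = {0} \<and> (\<forall>v \<in> vcar V. \<exists>u \<in> U. \<exists>c \<in> C. v = u + c)"
proof -
  note V' = comodule_vspace[OF V]
  interpret V: vector_space "vscale V" using V' by (simp add: is_vspace_def)
  obtain \<N> where \<N>: "\<forall>N \<in> \<N>. simple_subcomodule H V \<delta> N" and span: "V.span (\<Union>\<N>) = vcar V"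
    using ss[unfolded cosemisimple_def, rule_format, of "sub V (vcar V)" \<delta>] V
    unfolding comodule_self simple_subcomodule_def subcomodule_self direct_sum_of_def by auto
  let ?S = "{C. subcomodule H V \<delta> C \<and> U \<inter> C = {0}}"
  have U0: "0 \<in> U" and sU: "is_subspace V U"
    using U is_subspaceD(2)[OF V'] by (auto simp: subcomodule_def)
  have "{0} \<in> ?S" using subcomodule_zero[OF H V] U0 by auto
  then have "?S \<noteq> {}" by blast
  moreover have "\<Union>\<C> \<in> ?S" if "\<C> \<noteq> {}" "subset.chain ?S \<C>" for \<C>
    using subcomodule_Union_chain[OF H V that] that by (auto simp: subset.chain_def)
  ultimately have "\<exists>M\<in>?S. \<forall>X\<in>?S. M \<subseteq> X \<longrightarrow> X = M"
    by (rule subset_Zorn_nonempty)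
  then obtain C where C: "C \<in> ?S" and max: "\<forall>X\<in>?S. C \<subseteq> X \<longrightarrow> X = C"
    by (elim bexE)
  define W where "W = {x + y | x y. x \<in> U \<and> y \<in> C}"
  have CS: "subcomodule H V \<delta> C" and UC: "U \<inter> C = {0}" using C by auto
  then have sC: "is_subspace V C" by (simp add: subcomodule_def)
  have WS: "subcomodule H V \<delta> W" unfolding W_def by (rule subcomodule_sum[OF H V U CS])
  then have sW: "is_subspace V W" by (simp add: subcomodule_def)
  have CW: "C \<subseteq> W" using U0 by (force simp: W_def)
  have UW: "U \<subseteq> W" using UC by (force simp: W_def)
  have "N \<subseteq> W" if N: "N \<in> \<N>" for N
  proof (rule ccontr)
    assume nW: "\<not> N \<subseteq> W"
    have Ns: "subcomodule H V \<delta> N" and sm: "\<And>M. subcomodule H V \<delta> M \<Longrightarrow> M \<subseteq> N \<Longrightarrow> M = {0} \<or> M = N"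
      using \<N> N unfolding simple_subcomodule_def by blast+
    have "N \<inter> W = {0} \<or> N \<inter> W = N" by (rule sm[OF subcomodule_Int[OF H V Ns WS]]) blast
    then have NW: "N \<inter> W = {0}" using nW by blast
    let ?C = "{x + y | x y. x \<in> C \<and> y \<in> N}"
    have N0: "0 \<in> N" using Ns is_subspaceD(2)[OF V'] by (auto simp: subcomodule_def)
    have C0: "0 \<in> C" using UC by blast
    have "U \<inter> ?C \<subseteq> {0}"
    proof
      fix u assume "u \<in> U \<inter> ?C"
      then obtain c n where u: "u \<in> U" "u = c + n" "c \<in> C" "n \<in> N" by blast
      have "n = u - c" using u by simp
      moreover have "u - c \<in> W" using is_subspaceD(5)[OF V' sW] UW CW u by blast
      ultimately have "n = 0" using NW u by blast
      then show "u \<in> {0}" using u UC by auto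
    qed
    moreover have "0 \<in> ?C" using N0 C0 by force
    ultimately have "?C \<in> ?S" using subcomodule_sum[OF H V CS Ns] U0 by blast
    moreover have "C \<subseteq> ?C" using N0 by force
    ultimately have "?C = C" using max[rule_format, of ?C] by blast
    moreover have "N \<subseteq> ?C" using C0 by force
    ultimately have "N \<subseteq> C" by simp
    then show False using nW CW by (meson subset_trans)
  qed
  then have "vcar V \<subseteq> W"
    unfolding span[symmetric] using sW by (intro V.span_minimal) (auto simp: is_subspace_def)
  then show ?thesis using CS UC unfolding W_def by blast
qed

text \<open>Substitution in a Sweedler sum; applied to the projection \<open>p\<close> it moves sums
  between a module and its quotient.\<close>

lemma colinear_tlift:
  assumes "is_vspace C" "is_vspace V" "is_vspace W" "is_vspace U"
    and \<delta>: "lin V (C \<otimes> V) \<delta>V" and f: "colinear C V \<delta>V W \<delta>W f" and G: "bilin C W U G" and v: "v \<in> vcar V"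
  shows "tlift C W G (\<delta>W (f v)) = tlift C V (\<lambda>c w. G c (f w)) (\<delta>V v)"
proof -
  have lf: "lin V W f" using f by (simp add: colinear_def)
  have b: "bilin C V (C \<otimes> W) (\<lambda>c w. tens C W c (f w))" by (intro lin_rules lf lin_in[OF lf])
  have "\<delta>W (f v) = tlift C V (\<lambda>c w. tens C W c (f w)) (\<delta>V v)"
    using f v by (simp add: colinear_def tmap_def)
  then have "tlift C W G (\<delta>W (f v)) = tlift C V (\<lambda>c w. tlift C W G (tens C W c (f w))) (\<delta>V v)"
    using lin_tlift_comp[OF assms(1,2) is_vspace_tensor assms(4) b lin_tlift[OF assms(1,3,4) G] lin_in[OF \<delta> v]]
    by simp
  also have "\<dots> = tlift C V (\<lambda>c w. G c (f w)) (\<delta>V v)"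
    by (intro tlift_cong refl) (intro tlift_tens[OF assms(1,3,4) G] lin_in[OF lf])
  finally show ?thesis .
qed

section \<open>Colinearity for diagonal coactions\<close>

context
  fixes H :: "('k::field, 'h::ring_1, 'x) coalg_scheme"
    and V :: "('k, 'v::ab_group_add, 'y) vspace_scheme"
    and W :: "('k, 'w::ab_group_add, 'z) vspace_scheme"
    and \<delta>V \<delta>W
  assumes alg: "is_algebra H" and V: "is_vspace V" and W: "is_vspace W"
    and \<delta>V: "lin V (H \<otimes> V) \<delta>V" and \<delta>W: "lin W (H \<otimes> W) \<delta>W"
begin

lemma algebra_vs: "is_vspace H" using alg by (simp add: is_algebra_def)
lemma algebra_car: "x \<in> vcar H" using alg by (simp add: is_algebra_def)

lemmas diag_rules = bilinI lin_tlift_param lin_tlift_arg lin_mult1[OF alg] lin_mult2[OF alg] lin_id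
  lin_tens1 lin_tens2 V W algebra_vs algebra_car is_vspace_tensor tens_in lin_in[OF \<delta>V] lin_in[OF \<delta>W]
  lin_comp[OF \<delta>V] lin_comp[OF \<delta>W]

lemma diag_bilin1: "x \<in> vcar H \<Longrightarrow> v0 \<in> vcar V \<Longrightarrow> bilin H W (H \<otimes> (V \<otimes> W)) (\<lambda>y w0. tens H (V \<otimes> W) (x * y) (tens V W v0 w0))"
  by (intro diag_rules)

lemma diag_bilin2: "w \<in> vcar W \<Longrightarrow> bilin H V (H \<otimes> (V \<otimes> W)) (\<lambda>x v0.
    tlift H W (\<lambda>y w0. tens H (V \<otimes> W) (x * y) (tens V W v0 w0)) (\<delta>W w))"
  by (intro diag_rules)

lemma diag_bilin3: "bilin V W (H \<otimes> (V \<otimes> W)) (\<lambda>v w. tlift H V (\<lambda>x v0.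
    tlift H W (\<lambda>y w0. tens H (V \<otimes> W) (x * y) (tens V W v0 w0)) (\<delta>W w)) (\<delta>V v))"
  by (intro diag_rules)

lemma lin_diag_coact: "lin (V \<otimes> W) (H \<otimes> (V \<otimes> W)) (diag_coact H V \<delta>V W \<delta>W)"
  unfolding diag_coact_def by (intro lin_tlift V W is_vspace_tensor diag_bilin3)

lemma diag_coact_tens:
  assumes "v \<in> vcar V" "w \<in> vcar W"
  shows "diag_coact H V \<delta>V W \<delta>W (tens V W v w) = tlift H V (\<lambda>x v0.
    tlift H W (\<lambda>y w0. tens H (V \<otimes> W) (x * y) (tens V W v0 w0)) (\<delta>W w)) (\<delta>V v)"
  unfolding diag_coact_def by (rule tlift_tens[OF V W is_vspace_tensor diag_bilin3 assms])

text \<open>The outer map \<open>f\<close> is carried along so that one computation serves the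
  identity, the projection onto the quotient and maps induced by a pairing.\<close>

lemma diag_cop_tens:
  assumes f: "lin (V \<otimes> W) U f" and U: "is_vspace U" and \<phi>: "lin H base \<phi>" and v: "v \<in> vcar V" and w: "w \<in> vcar W"
  shows "f (cop H (V \<otimes> W) (diag_coact H V \<delta>V W \<delta>W) \<phi> (tens V W v w)) =
    tlift H V (\<lambda>x v0. tlift H W (\<lambda>y w0. vscale U (\<phi> (x * y)) (f (tens V W v0 w0))) (\<delta>W w)) (\<delta>V v)"
proof -
  let ?F = "\<lambda>t. f (lslice H (V \<otimes> W) \<phi> t)"
  have F: "lin (H \<otimes> (V \<otimes> W)) U ?F" by (intro lin_comp[OF f] lin_lslice algebra_vs is_vspace_tensor \<phi>)
  have "f (cop H (V \<otimes> W) (diag_coact H V \<delta>V W \<delta>W) \<phi> (tens V W v w)) = 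
    tlift H V (\<lambda>x v0. ?F (tlift H W (\<lambda>y w0. tens H (V \<otimes> W) (x * y) (tens V W v0 w0)) (\<delta>W w))) (\<delta>V v)"
    unfolding cop_def diag_coact_tens[OF v w]
    by (rule lin_tlift_comp[OF algebra_vs V is_vspace_tensor U diag_bilin2[OF w] F lin_in[OF \<delta>V v]])
  also have "\<dots> = tlift H V (\<lambda>x v0. tlift H W (\<lambda>y w0. ?F (tens H (V \<otimes> W) (x * y) (tens V W v0 w0))) (\<delta>W w)) (\<delta>V v)"
    by (intro tlift_cong refl lin_tlift_comp[where F = ?F, OF algebra_vs W is_vspace_tensor U diag_bilin1 F lin_in[OF \<delta>W w]])
  also have "\<dots> = tlift H V (\<lambda>x v0. tlift H W (\<lambda>y w0. vscale U (\<phi> (x * y)) (f (tens V W v0 w0))) (\<delta>W w)) (\<delta>V v)"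
    by (intro tlift_cong refl)
      (simp add: lslice_tens[OF algebra_vs is_vspace_tensor \<phi> algebra_car tens_in] lin_scale[OF f tens_in, simplified])
  finally show ?thesis .
qed

text \<open>Used in both directions for the action of \<open>K\<close>: to read off its colinearity
  on \<open>V\<close> and to establish it on the quotient.\<close>

lemma colinear_diag_iff:
  assumes U: "is_vspace U" and \<delta>U: "lin U (H \<otimes> U) \<delta>U" and B: "bilin V W U B"
  shows "colinear H (V \<otimes> W) (diag_coact H V \<delta>V W \<delta>W) U \<delta>U (tlift V W B) \<longleftrightarrow>
    (\<forall>\<phi>. lin H base \<phi> \<longrightarrow> (\<forall>v \<in> vcar V. \<forall>w \<in> vcar W. cop H U \<delta>U \<phi> (B v w) =
      tlift H V (\<lambda>x v0. tlift H W (\<lambda>y w0. vscale U (\<phi> (x * y)) (B v0 w0)) (\<delta>W w)) (\<delta>V v)))" (is "_ = ?R")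
proof -
  note f = lin_tlift[OF V W U B]
  let ?D = "cop H (V \<otimes> W) (diag_coact H V \<delta>V W \<delta>W)"
  have rhs: "tlift V W B (?D \<phi> (tens V W v w)) =
      tlift H V (\<lambda>x v0. tlift H W (\<lambda>y w0. vscale U (\<phi> (x * y)) (B v0 w0)) (\<delta>W w)) (\<delta>V v)"
    if "lin H base \<phi>" "v \<in> vcar V" "w \<in> vcar W" for \<phi> v w
    unfolding diag_cop_tens[OF f U that]
    by (intro tlift_cong refl arg_cong2[where f = "vscale U"] tlift_tens[OF V W U B])
  have ld: "lin H base \<phi> \<Longrightarrow> lin (V \<otimes> W) (V \<otimes> W) (?D \<phi>)" for \<phi>
    unfolding cop_def by (rule lin_comp[OF lin_lslice[OF algebra_vs is_vspace_tensor] lin_diag_coact])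
  have lc: "lin H base \<phi> \<Longrightarrow> lin U U (cop H U \<delta>U \<phi>)" for \<phi>
    unfolding cop_def by (rule lin_comp[OF lin_lslice[OF algebra_vs U] \<delta>U])
  have "colinear H (V \<otimes> W) (diag_coact H V \<delta>V W \<delta>W) U \<delta>U (tlift V W B) \<longleftrightarrow>
    (\<forall>\<phi>. lin H base \<phi> \<longrightarrow> (\<forall>t \<in> vcar (V \<otimes> W). cop H U \<delta>U \<phi> (tlift V W B t) = tlift V W B (?D \<phi> t)))"
    unfolding colinear_iff[OF algebra_vs is_vspace_tensor U lin_diag_coact \<delta>U] using f by blast
  also have "\<dots> \<longleftrightarrow> ?R"
  proof
    assume L: "\<forall>\<phi>. lin H base \<phi> \<longrightarrow> (\<forall>t \<in> vcar (V \<otimes> W). cop H U \<delta>U \<phi> (tlift V W B t) = tlift V W B (?D \<phi> t))"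
    show ?R
    proof (intro allI impI ballI)
      fix \<phi> v w assume \<phi>: "lin H base \<phi>" and vw: "v \<in> vcar V" "w \<in> vcar W"
      show "cop H U \<delta>U \<phi> (B v w) =
        tlift H V (\<lambda>x v0. tlift H W (\<lambda>y w0. vscale U (\<phi> (x * y)) (B v0 w0)) (\<delta>W w)) (\<delta>V v)"
        using L[rule_format, OF \<phi> tens_in[OF vw]] rhs[OF \<phi> vw] tlift_tens[OF V W U B vw] by simp
    qed
  next
    assume R: ?R
    show "\<forall>\<phi>. lin H base \<phi> \<longrightarrow> (\<forall>t \<in> vcar (V \<otimes> W). cop H U \<delta>U \<phi> (tlift V W B t) = tlift V W B (?D \<phi> t))"
    proof (intro allI impI ballI)
      fix \<phi> t assume \<phi>: "lin H base \<phi>" and t: "t \<in> vcar (V \<otimes> W)"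
      show "cop H U \<delta>U \<phi> (tlift V W B t) = tlift V W B (?D \<phi> t)"
      proof (rule lin_tensor_eqI[OF V lin_comp[OF lc[OF \<phi>] f] lin_comp[OF f ld[OF \<phi>]] _ t])
        fix v w assume vw: "v \<in> vcar V" "w \<in> vcar W"
        show "cop H U \<delta>U \<phi> (tlift V W B (tens V W v w)) = tlift V W B (?D \<phi> (tens V W v w))"
          using R \<phi> vw rhs[OF \<phi> vw] tlift_tens[OF V W U B vw] by simp
      qed
    qed
  qed
  finally show ?thesis .
qed

end

section \<open>Hopf modules and their quotients\<close>

locale coideal_setting =
  fixes H :: "('k::field, 'h::ring_1) hopf"
    and A :: "('k, 'h, 'a::ring_1) bhopf"
    and K :: "'a set"
  assumes hopf_H: "hopf_algebra H" and hopf_A: "braided_hopf_algebra H A"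
    and coideal_K: "left_coideal_subalgebra H A K"
begin

lemma H_algebra: "is_algebra H" and H_coalgebra: "coalgebra H"
  using hopf_H by (simp_all add: hopf_algebra_def)

lemma A_algebra: "is_algebra A" and A_coalgebra: "coalgebra A"
  using hopf_A by (simp_all add: braided_hopf_algebra_def)

lemma H_vs: "is_vspace H" and H_car: "h \<in> vcar H" "vcar H = UNIV"
  using H_algebra by (simp_all add: is_algebra_def)

lemma A_vs: "is_vspace A" and A_car: "a \<in> vcar A" "vcar A = UNIV"
  using A_algebra by (simp_all add: is_algebra_def)

lemma A_comodule: "comodule H A (coact A)" and act_bilin: "bilin H A A (act A)"
  and act_one: "act A 1 a = a" and act_mult: "act A (h * h') a = act A h (act A h' a)"
proof -
  have yd: "yd_module H (yd_of A)" using hopf_A by (simp add: braided_hopf_algebra_def)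
  have s: "sub (yd_of A) (vcar (yd_of A)) = sub A (vcar A)" by (simp add: sub_def yd_of_def)
  have "comodule H (yd_of A) (coact A)" using yd by (simp add: yd_module_def yd_of_def)
  then show "comodule H A (coact A)" using s comodule_self by metis
  show "bilin H A A (act A)" using yd by (simp add: yd_module_def yd_of_def bilin_def lin_def)
  show "act A 1 a = a" "act A (h * h') a = act A h (act A h' a)"
    using yd A_car by (auto simp: yd_module_def yd_of_def)
qed

lemmas lin_comult_A = coalgebra_lin[OF A_coalgebra] and lin_comult_H = coalgebra_lin[OF H_coalgebra]
  and lin_counit_A = coalgebra_counit[OF A_coalgebra] and lin_counit_H = coalgebra_counit[OF H_coalgebra]
  and lin_coact = comodule_lin[OF A_comodule]

lemma K_subcomodule: "subcomodule H A (coact A) K" and K_one: "1 \<in> K"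
  and K_mult: "x \<in> K \<Longrightarrow> y \<in> K \<Longrightarrow> x * y \<in> K"
  and K_comult: "x \<in> K \<Longrightarrow> comult A x \<in> vcar (A \<otimes> sub A K)"
  using coideal_K by (auto simp: left_coideal_subalgebra_def)

lemma K_subspace: "is_subspace A K" and K_coact: "x \<in> K \<Longrightarrow> coact A x \<in> vcar (H \<otimes> sub A K)"
  using K_subcomodule by (auto simp: subcomodule_def)

lemma K_vs: "is_vspace (sub A K)"
  by (rule is_vspace_sub[OF A_vs K_subspace])

lemma lin_K_coact: "lin (sub A K) (H \<otimes> sub A K) (coact A)"
  using comodule_lin[OF comodule_sub(1)[OF H_coalgebra A_comodule K_subcomodule]] .

lemma lin_K_incl: "lin (sub A K) A (\<lambda>x. x)"
  using A_car by (simp add: lin_def)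

lemmas lin_act1 = bilin_app1[OF act_bilin] and lin_act2 = bilin_app2[OF act_bilin]

lemmas base_rules = bilinI lin_tlift_param lin_tlift_arg lin_mult1[OF H_algebra] lin_mult2[OF H_algebra]
  lin_mult1[OF A_algebra] lin_mult2[OF A_algebra] lin_id
  lin_tens1 lin_tens2 H_vs H_car(1) A_vs A_car(1) K_vs is_vspace_tensor tens_in lin_act1 lin_act2
  lin_comp[OF lin_coact] lin_in[OF lin_coact]
  lin_comp[OF lin_comult_A] lin_in[OF lin_comult_A]
  lin_comp[OF lin_comult_H] lin_in[OF lin_comult_H]
  K_comult lin_K_coact[THEN lin_comp] lin_K_incl lin_scale1 lin_scale2 lin_base1 lin_base2

end

text \<open>Only the data needed to write down the braided formulas; the quotient is an instance
  before it is known to be a Hopf module.\<close>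

locale module_data = coideal_setting H A K
  for H :: "('k::field, 'h::ring_1) hopf" and A :: "('k, 'h, 'a::ring_1) bhopf" and K +
  fixes V :: "('k, 'h, 'a, 'v::ab_group_add, 'z) rmod_scheme"
  assumes V_vs: "is_vspace V" and lin_hco: "lin V (H \<otimes> V) (hco V)"
    and bilin_rac: "bilin V (sub A K) V (rac V)"
begin

lemma lin_rac1: "lin X V f \<Longrightarrow> y \<in> K \<Longrightarrow> lin X V (\<lambda>v. rac V (f v) y)"
  by (rule bilin_app1[OF bilin_rac]) simp_all

lemma lin_rac2: "v \<in> vcar V \<Longrightarrow> lin X (sub A K) f \<Longrightarrow> lin X V (\<lambda>y. rac V v (f y))"
  by (rule bilin_app2[OF bilin_rac]) simp_all

lemma rac_in: "v \<in> vcar V \<Longrightarrow> y \<in> K \<Longrightarrow> rac V v y \<in> vcar V"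
  using bilin_in[OF bilin_rac] by simp

lemmas V_rules = V_vs lin_rac1 lin_rac2 rac_in lin_comp[OF lin_hco] lin_in[OF lin_hco]

lemma bilin_half_braiding:
  "bilin V A (A \<otimes> V) (\<lambda>v a. tlift H V (\<lambda>x v0. tens A V (act A x a) v0) (hco V v))"
  by (intro base_rules V_rules)

lemma lin_half_braiding: "lin (V \<otimes> A) (A \<otimes> V) (half_braiding H A V)"
  unfolding half_braiding_def by (rule lin_tlift[OF V_vs A_vs is_vspace_tensor bilin_half_braiding])

lemmas hb_rules = lin_comp[OF lin_half_braiding] lin_in[OF lin_half_braiding]

lemma bilin_hb1: "a \<in> vcar A \<Longrightarrow> y \<in> K \<Longrightarrow> bilin A V (A \<otimes> V) (\<lambda>b v0. tens A V (a * b) (rac V v0 y))"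
  by (intro base_rules V_rules)

lemma bilin_hb3: "x \<in> K \<Longrightarrow> bilin A V (A \<otimes> V) (\<lambda>a v. tlift A (sub A K) (\<lambda>x1 x2.
    tlift A V (\<lambda>b v0. tens A V (a * b) (rac V v0 x2)) (half_braiding H A V (tens V A v x1))) (comult A x))"
  by (intro base_rules V_rules hb_rules; simp)

lemma lin_half_braided_act: "x \<in> K \<Longrightarrow> lin (A \<otimes> V) (A \<otimes> V) (\<lambda>t. half_braided_act H A K V t x)"
  unfolding half_braided_act_def by (intro lin_tlift A_vs V_vs is_vspace_tensor bilin_hb3)

lemma bilin_hb4: "x1 \<in> vcar A \<Longrightarrow> x2 \<in> K \<Longrightarrow> bilin H V (A \<otimes> V) (\<lambda>h v0. tens A V (a * act A h x1) (rac V v0 x2))"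
  by (intro base_rules V_rules)

lemma half_braided_act_tens:
  assumes v: "v \<in> vcar V" and x: "x \<in> K"
  shows "half_braided_act H A K V (tens A V a v) x = tlift A (sub A K) (\<lambda>x1 x2.
    tlift H V (\<lambda>h v0. tens A V (a * act A h x1) (rac V v0 x2)) (hco V v)) (comult A x)"
  unfolding half_braided_act_def tlift_tens[OF A_vs V_vs is_vspace_tensor bilin_hb3[OF x] A_car(1) v]
proof (intro tlift_cong refl)
  fix x1 x2 assume "x2 \<in> vcar (sub A K)"
  then have x2: "x2 \<in> K" by simp
  let ?F = "tlift A V (\<lambda>b v0. tens A V (a * b) (rac V v0 x2))"
  have b: "bilin H V (A \<otimes> V) (\<lambda>h v0. tens A V (act A h x1) v0)" by (intro base_rules V_rules)
  have F: "lin (A \<otimes> V) (A \<otimes> V) ?F"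
    by (intro lin_tlift A_vs V_vs is_vspace_tensor bilin_hb1 x2 A_car(1))
  have "?F (half_braiding H A V (tens V A v x1)) = ?F (tlift H V (\<lambda>h v0. tens A V (act A h x1) v0) (hco V v))"
    unfolding half_braiding_def tlift_tens[OF V_vs A_vs is_vspace_tensor bilin_half_braiding v A_car(1)] ..
  also have "\<dots> = tlift H V (\<lambda>h v0. ?F (tens A V (act A h x1) v0)) (hco V v)"
    by (rule lin_tlift_comp[OF H_vs V_vs is_vspace_tensor is_vspace_tensor b F lin_in[OF lin_hco v]])
  also have "\<dots> = tlift H V (\<lambda>h v0. tens A V (a * act A h x1) (rac V v0 x2)) (hco V v)"
    by (intro tlift_cong refl tlift_tens[OF A_vs V_vs is_vspace_tensor bilin_hb1 A_car(1)] x2 A_car(1))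
  finally show "?F (half_braiding H A V (tens V A v x1)) = \<dots>" .
qed

end

locale hopf_mod = coideal_setting H A K
  for H :: "('k::field, 'h::ring_1) hopf" and A :: "('k, 'h, 'a::ring_1) bhopf" and K +
  fixes V :: "('k, 'h, 'a, 'v::ab_group_add) hopfmod"
  assumes hopf_V: "hopf_module H A K V"
begin

lemma H_com: "comodule H V (hco V)" and A_com: "comodule A V (aco V)"
  and rac_one: "v \<in> vcar V \<Longrightarrow> rac V v 1 = v"
  and rac_mult: "v \<in> vcar V \<Longrightarrow> x \<in> K \<Longrightarrow> y \<in> K \<Longrightarrow> rac V v (x * y) = rac V (rac V v x) y"
  and aco_colinear: "colinear H V (hco V) (A \<otimes> V) (diag_coact H A (coact A) V (hco V)) (aco V)"
  and aco_rac: "v \<in> vcar V \<Longrightarrow> x \<in> K \<Longrightarrow> aco V (rac V v x) = half_braided_act H A K V (aco V v) x"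
  using hopf_V by (auto simp: hopf_module_def right_module_def)

sublocale module_data H A K V
  by unfold_locales (use hopf_V in \<open>auto simp: hopf_module_def right_module_def comodule_def\<close>)

lemmas lin_aco = comodule_lin[OF A_com]

lemmas stable_A = subcomodule_iff[OF A_vs V_vs lin_comult_A lin_aco]
  and stable_H = subcomodule_iff[OF H_vs V_vs lin_comult_H lin_hco]
  and lin_cop_A = lin_cop[OF A_vs V_vs lin_comult_A lin_aco]
  and lin_cop_H = lin_cop[OF H_vs V_vs lin_comult_H lin_hco]

lemma rac_colinear:
  assumes \<phi>: "lin H base \<phi>" and v: "v \<in> vcar V" and x: "x \<in> K"
  shows "cop H V (hco V) \<phi> (rac V v x) = tlift H V (\<lambda>h v0. tlift H (sub A K)
      (\<lambda>y x0. vscale V (\<phi> (h * y)) (rac V v0 x0)) (coact A x)) (hco V v)"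
proof -
  have "colinear H (V \<otimes> sub A K) (diag_coact H V (hco V) (sub A K) (coact A)) V (hco V)
       (tlift V (sub A K) (rac V))"
    using hopf_V by (simp add: hopf_module_def right_module_def)
  then show ?thesis
    using colinear_diag_iff[OF H_algebra V_vs K_vs lin_hco lin_K_coact V_vs lin_hco bilin_rac] \<phi> v x
    by simp
qed

lemma aco_cop_hco: "lin H base \<phi> \<Longrightarrow> v \<in> vcar V \<Longrightarrow>
    cop H (A \<otimes> V) (diag_coact H A (coact A) V (hco V)) \<phi> (aco V v) = aco V (cop H V (hco V) \<phi> v)"
  using aco_colinear
  unfolding colinear_iff[OF H_vs V_vs is_vspace_tensor lin_hco
      lin_diag_coact[OF H_algebra A_vs V_vs lin_coact lin_hco]]
  by blast

end

lemma complement_projection: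
  assumes V: "is_vspace V" and U: "is_subspace V U" and W: "is_subspace V W" and 0: "U \<inter> W = {0}"
    and s: "\<And>v. v \<in> vcar V \<Longrightarrow> \<exists>u\<in>U. \<exists>w\<in>W. v = u + w"
  shows "\<exists>p. lin V (sub V W) p \<and> (\<forall>w \<in> W. p w = w) \<and> (\<forall>u \<in> U. p u = 0) \<and> (\<forall>v \<in> vcar V. v - p v \<in> U)"
proof -
  note U' = is_subspaceD[OF V U] and W' = is_subspaceD[OF V W]
  obtain p where p: "\<And>v. v \<in> vcar V \<Longrightarrow> p v \<in> W \<and> v - p v \<in> U"
    using s by (metis add_diff_cancel_right')
  have eq: "p v = w" if v: "v \<in> vcar V" and w: "w \<in> W" "v - w \<in> U" for v w
  proof -
    have "(v - w) - (v - p v) \<in> U" "p v - w \<in> W" using p[OF v] w U'(5) W'(5) by blast+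
    moreover have "(v - w) - (v - p v) = p v - w" by simp
    ultimately have "p v - w \<in> U \<inter> W" by simp
    then show ?thesis using 0 by simp
  qed
  have "lin V (sub V W) p"
  proof (rule linI)
    show "p v \<in> vcar (sub V W)" if "v \<in> vcar V" for v using p[OF that] by simp
    fix x y assume x: "x \<in> vcar V" and y: "y \<in> vcar V"
    have "(x + y) - (p x + p y) = (x - p x) + (y - p y)" by simp
    then have "(x + y) - (p x + p y) \<in> U" using p[OF x] p[OF y] U'(3) by metis
    then show "p (x + y) = p x + p y"
      using p[OF x] p[OF y] W'(3) eq[OF vs_add[OF V x y]] by blast
  next
    fix c x assume x: "x \<in> vcar V"
    show "p (vscale V c x) = vscale (sub V W) c (p x)"
      using p[OF x] U'(4)[of "x - p x" c] W'(4)[of "p x" c] eq[OF vs_scale[OF V x]]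
      by (auto simp: vs_simps[OF V])
  qed
  moreover have "p w = w" if "w \<in> W" for w using eq[of w w] that W'(1) U'(2) by auto
  moreover have "p u = 0" if "u \<in> U" for u using eq[of u 0] that U'(1) W'(2) by auto
  ultimately show ?thesis using p by blast
qed

locale hopf_quotient = hopf_mod H A K V
  for H :: "('k::field, 'h::ring_1) hopf" and A :: "('k, 'h, 'a::ring_1) bhopf" and K
    and V :: "('k, 'h, 'a, 'v::ab_group_add) hopfmod" +
  fixes U W p
  assumes hopf_U: "hopf_submodule H A K V U" and W_sub: "subcomodule H V (hco V) W"
    and lin_p: "lin V (sub V W) p" and p_id: "\<And>w. w \<in> W \<Longrightarrow> p w = w"
    and p_zero: "\<And>u. u \<in> U \<Longrightarrow> p u = 0" and p_diff: "\<And>v. v \<in> vcar V \<Longrightarrow> v - p v \<in> U"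
begin

definition proj :: "('k, 'a, 'v) tensor \<Rightarrow> ('k, 'a, 'v) tensor" where
  "proj = tlift A V (\<lambda>a v. tens A V a (p v))"

text \<open>A model of \<open>V/U\<close> on \<open>W\<close>. The coaction of \<open>H\<close>
  preserves \<open>W\<close> and is kept; the other two structures may leave \<open>W\<close> and
  are followed by \<open>p\<close>, whose kernel is \<open>U\<close>.\<close>

definition Q :: "('k, 'h, 'a, 'v) hopfmod" where
  "Q = \<lparr>vcar = W, vscale = vscale V, hco = hco V, rac = (\<lambda>v x. p (rac V v x)), aco = (\<lambda>v. proj (aco V v))\<rparr>"

lemma Q_simps [simp]: "vcar Q = W" "vscale Q = vscale V" "hco Q = hco V"
  "rac Q = (\<lambda>v x. p (rac V v x))" "aco Q = (\<lambda>v. proj (aco V v))"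
  by (simp_all add: Q_def)

lemma sub_Q: "sub V W = sub Q (vcar Q)" by (simp add: sub_def)

lemma tens_Q [simp]: "tens X Q = tens X V" "tens Q Y = tens V Y"
  using tens_sub(2)[of X V W] tens_sub(1)[of V W Y] unfolding sub_Q tens_sub by simp_all

lemma W_subspace: "is_subspace V W" and U_subspace: "is_subspace V U"
  and U_H: "subcomodule H V (hco V) U" and U_A: "subcomodule A V (aco V) U"
  and U_rac: "u \<in> U \<Longrightarrow> x \<in> K \<Longrightarrow> rac V u x \<in> U"
  using W_sub hopf_U by (auto simp: subcomodule_def hopf_submodule_def)

lemma W_V: "w \<in> W \<Longrightarrow> w \<in> vcar V" and U_V: "u \<in> U \<Longrightarrow> u \<in> vcar V"
  using is_subspaceD(1)[OF V_vs W_subspace] is_subspaceD(1)[OF V_vs U_subspace] by blast+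

lemma lin_pQ: "lin V Q p"
  using lin_p unfolding sub_Q lin_self .

lemma lin_pV: "lin V V p"
  using lin_p W_V by (simp add: lin_def)

lemma Q_vs: "is_vspace Q"
  using is_vspace_sub[OF V_vs W_subspace] unfolding sub_Q is_vspace_self .

lemma p_in: "v \<in> vcar V \<Longrightarrow> p v \<in> W" using lin_in[OF lin_pQ] by simp

text \<open>\<open>F\<close> preserves the kernel of \<open>p\<close>, so it descends to the
  quotient. This is the well-definedness of each induced structure.\<close>

lemma p_cong:
  assumes F: "lin V V F" and FU: "\<And>u. u \<in> U \<Longrightarrow> F u \<in> U" and v: "v \<in> vcar V"
  shows "p (F (p v)) = p (F v)"
proof -
  have pv: "p v \<in> vcar V" using lin_in[OF lin_pV v] .
  have "p (F v) - p (F (p v)) = p (F (v - p v))"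
    using lin_diff[OF V_vs lin_comp[OF lin_pV F] v pv] by simp
  also have "\<dots> = 0" by (intro p_zero FU p_diff v)
  finally show ?thesis by simp
qed

lemma p_rac: "v \<in> vcar V \<Longrightarrow> x \<in> K \<Longrightarrow> p (rac V (p v) x) = p (rac V v x)"
  by (rule p_cong[of "\<lambda>v. rac V v x"]) (auto intro: lin_rac1 lin_id U_rac)

lemma cop_H_Q: "lin H base f \<Longrightarrow> w \<in> W \<Longrightarrow> cop H Q (hco V) f w = cop H V (hco V) f w"
  using comodule_sub(2)[OF H_coalgebra H_com W_sub] unfolding sub_Q cop_def lslice_def tlift_self by simp

lemma Q_H_com: "comodule H Q (hco V)"
  using comodule_sub(1)[OF H_coalgebra H_com W_sub] unfolding sub_Q comodule_self .

lemma lin_hco_Q: "lin Q (H \<otimes> Q) (hco V)"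
  using comodule_lin[OF Q_H_com] .

text \<open>Stability of \<open>W\<close> makes \<open>p\<close> fix the left side; stability of
  \<open>U\<close> removes the inner \<open>p\<close> by \<open>p_cong\<close>.\<close>

lemma p_cop: 
  assumes f: "lin H base f" and v: "v \<in> vcar V" 
  shows "cop H V (hco V) f (p v) = p (cop H V (hco V) f v)"
proof -
  note iff = stable_H
  note l = lin_cop_H[OF f]
  have "cop H V (hco V) f (p v) \<in> W" using W_sub p_in[OF v] f unfolding iff by blast
  then have "cop H V (hco V) f (p v) = p (cop H V (hco V) f (p v))" by (simp add: p_id)
  also have "\<dots> = p (cop H V (hco V) f v)"
    by (rule p_cong[OF l _ v]) (use U_H f in \<open>unfold iff, blast\<close>)
  finally show ?thesis .
qed

lemma p_colinear: "colinear H V (hco V) Q (hco V) p"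
  unfolding colinear_iff[OF H_vs V_vs Q_vs lin_hco lin_hco_Q]
  using lin_pQ p_cop cop_H_Q p_in by auto

lemmas hco_p = colinear_tlift[OF H_vs V_vs Q_vs _ lin_hco p_colinear]

lemma lin_proj: "lin (A \<otimes> V) (A \<otimes> Q) proj"
proof -
  have "bilin A V (A \<otimes> Q) (\<lambda>a v. tens A Q a (p v))"
    by (intro base_rules lin_pQ lin_in[OF lin_pQ])
  then show ?thesis unfolding proj_def tens_Q by (intro lin_tlift A_vs V_vs is_vspace_tensor)
qed

lemma proj_tens: "v \<in> vcar V \<Longrightarrow> proj (tens A V a v) = tens A V a (p v)"
proof -
  have "bilin A V (A \<otimes> Q) (\<lambda>a v. tens A Q a (p v))"
    by (intro base_rules lin_pQ lin_in[OF lin_pQ])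
  then show "v \<in> vcar V \<Longrightarrow> proj (tens A V a v) = tens A V a (p v)"
    unfolding proj_def tens_Q using tlift_tens[OF A_vs V_vs is_vspace_tensor _ A_car(1)] by blast
qed

lemma lslice_proj:
  assumes f: "lin A base f" and t: "t \<in> vcar (A \<otimes> V)"
  shows "lslice A Q f (proj t) = p (lslice A V f t)"
proof (rule lin_tensor_eqI[OF A_vs lin_comp[OF lin_lslice[OF A_vs Q_vs f] lin_proj]
      lin_comp[OF lin_pQ lin_lslice[OF A_vs V_vs f]] _ t])
  fix a v assume v: "v \<in> vcar V"
  show "lslice A Q f (proj (tens A V a v)) = p (lslice A V f (tens A V a v))"
    using lslice_tens[OF A_vs Q_vs f A_car(1), of "p v" a] lslice_tens[OF A_vs V_vs f A_car(1) v, of a]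
    by (simp add: proj_tens v p_in lin_scale[OF lin_pV v])
qed

lemma lin_aco_Q: "lin Q (A \<otimes> Q) (aco Q)"
  using lin_comp[OF lin_proj lin_aco] W_V by (auto simp: lin_def)

lemma cop_A_Q: "lin A base f \<Longrightarrow> v \<in> vcar V \<Longrightarrow> cop A Q (aco Q) f v = p (cop A V (aco V) f v)"
  by (simp add: cop_def lslice_proj lin_in[OF lin_aco])

text \<open>The operators of \<open>Q\<close> are those of \<open>V\<close> followed by
  \<open>p\<close>; an inner \<open>p\<close> disappears since \<open>U\<close> is
  \<open>A\<close>-stable, and the identities for \<open>V\<close> carry over.\<close>

lemma Q_A_com: "comodule A Q (aco Q)"
proof -
  note \<Delta> = lin_comult_A
  note iff = comodule_iff[OF A_vs V_vs \<Delta> lin_aco]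
  note l = lin_cop_A
  show ?thesis
    unfolding comodule_iff[OF A_vs Q_vs \<Delta> lin_aco_Q]
  proof (intro ballI conjI allI impI)
    fix v assume "v \<in> vcar Q"
    then have v: "v \<in> W" by simp
    note vV = W_V[OF v]
    show "cop A Q (aco Q) (counit A) v = v"
      unfolding cop_A_Q[OF lin_counit_A vV]
      using A_com vV p_id[OF v] unfolding iff by simp
    fix f g assume f: "lin A base f" and g: "lin A base g"
    have "cop A Q (aco Q) f (cop A Q (aco Q) g v) = p (cop A V (aco V) f (p (cop A V (aco V) g v)))"
      unfolding cop_A_Q[OF g vV] by (rule cop_A_Q[OF f lin_in[OF lin_pV lin_in[OF l[OF g] vV]]])
    also have "\<dots> = p (cop A V (aco V) f (cop A V (aco V) g v))"
      by (rule p_cong[OF l[OF f] _ lin_in[OF l[OF g] vV]])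
        (use U_A f in \<open>unfold stable_A, blast\<close>)
    also have "\<dots> = p (cop A V (aco V) (conv A g f) v)"
      using A_com vV f g unfolding iff by simp
    also have "\<dots> = cop A Q (aco Q) (conv A g f) v"
      by (rule cop_A_Q[OF lin_conv[OF A_vs V_vs \<Delta> lin_aco g f] vV, symmetric])
    finally show "cop A Q (aco Q) f (cop A Q (aco Q) g v) = cop A Q (aco Q) (conv A g f) v" .
  qed
qed

lemma bilin_rac_Q: "bilin Q (sub A K) Q (rac Q)"
proof -
  have "bilin V (sub A K) Q (rac Q)"
    by (simp, intro bilinI lin_comp[OF lin_pQ] lin_rac1 lin_rac2 lin_id; simp)
  then show ?thesis using W_V by (auto simp: bilin_def lin_def)
qed

sublocale Q: module_data H A K Q
  by unfold_locales (simp_all add: Q_vs lin_hco_Q bilin_rac_Q[simplified])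

lemma rac_Q_colinear:
  "colinear H (Q \<otimes> sub A K) (diag_coact H Q (hco Q) (sub A K) (coact A)) Q (hco Q) (tlift Q (sub A K) (rac Q))"
  unfolding colinear_diag_iff[OF H_algebra Q_vs K_vs Q.lin_hco lin_K_coact Q_vs Q.lin_hco bilin_rac_Q]
proof (intro allI impI ballI)
  fix \<phi> v x assume \<phi>: "lin H base \<phi>" and "v \<in> vcar Q" and "x \<in> vcar (sub A K)"
  then have v: "v \<in> W" and x: "x \<in> K" by simp_all
  note vV = W_V[OF v]
  let ?G = "\<lambda>h v0. tlift H (sub A K) (\<lambda>y x0. vscale V (\<phi> (h * y)) (rac V v0 x0)) (coact A x)"
  note cx = lin_in[OF lin_K_coact, of x, simplified, OF x]
  note rules = base_rules V_rules lin_comp[OF \<phi>] cx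
  have b1: "bilin H (sub A K) V (\<lambda>y x0. vscale V (\<phi> (h * y)) (rac V v0 x0))" if "v0 \<in> vcar V" for h v0
    by (intro rules that; simp)
  have b2: "bilin H V V ?G"
    by (intro rules; simp)
  have "cop H Q (hco Q) \<phi> (rac Q v x) = p (cop H V (hco V) \<phi> (rac V v x))"
    by (simp add: cop_H_Q[OF \<phi> p_in] p_cop[OF \<phi>] rac_in vV x)
  also have "\<dots> = p (tlift H V ?G (hco V v))" by (simp add: rac_colinear[OF \<phi> vV x])
  also have "\<dots> = tlift H V (\<lambda>h v0. p (?G h v0)) (hco V v)"
    by (rule lin_tlift_comp[OF H_vs V_vs V_vs Q_vs b2 lin_pQ lin_in[OF lin_hco vV]])
  also have "\<dots> = tlift H V (\<lambda>h v0. tlift H (sub A K) (\<lambda>y x0. p (vscale V (\<phi> (h * y)) (rac V v0 x0))) (coact A x)) (hco V v)"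
    by (intro tlift_cong refl lin_tlift_comp[OF H_vs K_vs V_vs Q_vs b1 lin_pQ cx])
  \<comment> \<open>Inserting \<open>p\<close> before the action is harmless by
    \<open>p_rac\<close>, and only in this form can \<open>hco_p\<close> pass to a sum over
    \<open>Q\<close>.\<close>
  also have "\<dots> = tlift H V (\<lambda>h v0. tlift H (sub A K) (\<lambda>y x0. vscale Q (\<phi> (h * y)) (p (rac V (p v0) x0))) (coact A x)) (hco V v)"
    by (intro tlift_cong refl) (simp add: lin_scale[OF lin_pV] rac_in p_rac)
  also have "\<dots> = tlift H Q (\<lambda>h v0. tlift H (sub A K) (\<lambda>y x0. vscale Q (\<phi> (h * y)) (rac Q v0 x0)) (coact A x)) (hco V (p v))"
  proof -
    have "bilin H Q Q (\<lambda>h v0. tlift H (sub A K) (\<lambda>y x0. vscale Q (\<phi> (h * y)) (rac Q v0 x0)) (coact A x))"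
      by (intro base_rules Q.V_rules lin_comp[OF \<phi>] cx; simp)
    from hco_p[OF Q_vs this vV] show ?thesis by simp
  qed
  finally show "cop H Q (hco Q) \<phi> (rac Q v x) =
      tlift H Q (\<lambda>h v0. tlift H (sub A K) (\<lambda>y x0. vscale Q (\<phi> (h * y)) (rac Q v0 x0)) (coact A x)) (hco Q v)"
    by (simp add: p_id[OF v])
qed

lemma aco_p:
  assumes v: "v \<in> vcar V"
  shows "proj (aco V (p v)) = proj (aco V v)"
proof (rule tensor_eqI[OF A_vs Q_vs])
  note l = lin_cop_A
  have pv: "p v \<in> vcar V" using lin_in[OF lin_pV v] .
  show "proj (aco V (p v)) \<in> vcar (A \<otimes> Q)" "proj (aco V v) \<in> vcar (A \<otimes> Q)"
    by (intro lin_in[OF lin_proj] lin_in[OF lin_aco] v pv)+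
  fix f assume f: "lin A base f"
  have "p (cop A V (aco V) f (p v)) = p (cop A V (aco V) f v)"
    by (rule p_cong[OF l[OF f] _ v])
        (use U_A f in \<open>unfold stable_A, blast\<close>)
  then show "lslice A Q f (proj (aco V (p v))) = lslice A Q f (proj (aco V v))"
    by (simp add: lslice_proj[OF f] lin_in[OF lin_aco] v pv cop_def)
qed

text \<open>It suffices that \<open>proj\<close> commutes with the operators of the diagonal
  coactions, which is checked on pure tensors and follows from the colinearity of
  \<open>p\<close>.\<close>

lemma aco_Q_colinear:
  "colinear H Q (hco Q) (A \<otimes> Q) (diag_coact H A (coact A) Q (hco Q)) (aco Q)"
proof -
  note cA = lin_coact
  note dV = lin_diag_coact[OF H_algebra A_vs V_vs cA lin_hco]
    and dQ = lin_diag_coact[OF H_algebra A_vs Q_vs cA Q.lin_hco]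
  let ?V = "cop H (A \<otimes> V) (diag_coact H A (coact A) V (hco V))"
  let ?Q = "cop H (A \<otimes> Q) (diag_coact H A (coact A) Q (hco Q))"
  have eq: "?Q \<phi> (proj t) = proj (?V \<phi> t)" if \<phi>: "lin H base \<phi>" and t: "t \<in> vcar (A \<otimes> V)" for \<phi> t
  proof (rule lin_tensor_eqI[OF A_vs _ _ _ t])
    have lQ: "lin (A \<otimes> Q) (A \<otimes> Q) (?Q \<phi>)" and lV: "lin (A \<otimes> V) (A \<otimes> V) (?V \<phi>)"
      unfolding cop_def
      by (intro lin_comp[OF lin_lslice] dV dQ H_vs is_vspace_tensor \<phi>)+
    show "lin (A \<otimes> V) (A \<otimes> Q) (\<lambda>t. ?Q \<phi> (proj t))" by (rule lin_comp[OF lQ lin_proj])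
    show "lin (A \<otimes> V) (A \<otimes> Q) (\<lambda>t. proj (?V \<phi> t))" by (rule lin_comp[OF lin_proj lV])
    fix a v assume v: "v \<in> vcar V"
    have "?Q \<phi> (proj (tens A V a v)) = ?Q \<phi> (tens A Q a (p v))" by (simp add: proj_tens v)
    also have "\<dots> = tlift H A (\<lambda>x a0. tlift H Q (\<lambda>y w0. tscale (\<phi> (x * y)) (tens A Q a0 w0)) (hco V (p v))) (coact A a)"
      using diag_cop_tens[OF H_algebra A_vs Q_vs cA Q.lin_hco lin_id is_vspace_tensor \<phi> A_car(1), of "p v" a]
      by (simp add: p_in v)
    also have "\<dots> = tlift H A (\<lambda>x a0. tlift H V (\<lambda>y w0. tscale (\<phi> (x * y)) (proj (tens A V a0 w0))) (hco V v)) (coact A a)"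
    proof (rule tlift_cong[OF refl refl _ refl])
      fix x a0
      have "bilin H Q (A \<otimes> Q) (\<lambda>y w0. vscale (A \<otimes> Q) (\<phi> (x * y)) (tens A Q a0 w0))"
        by (intro base_rules lin_comp[OF \<phi>] Q_vs)
      from hco_p[OF is_vspace_tensor this v]
      have "tlift H Q (\<lambda>y w0. tscale (\<phi> (x * y)) (tens A Q a0 w0)) (hco V (p v)) =
          tlift H V (\<lambda>y w0. tscale (\<phi> (x * y)) (tens A V a0 (p w0))) (hco V v)" by simp
      also have "\<dots> = tlift H V (\<lambda>y w0. tscale (\<phi> (x * y)) (proj (tens A V a0 w0))) (hco V v)"
        by (intro tlift_cong refl) (simp add: proj_tens)
      finally show "tlift H Q (\<lambda>y w0. tscale (\<phi> (x * y)) (tens A Q a0 w0)) (hco V (p v)) = \<dots>" .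
    qed
    also have "\<dots> = proj (?V \<phi> (tens A V a v))"
      using diag_cop_tens[OF H_algebra A_vs V_vs cA lin_hco lin_proj is_vspace_tensor \<phi> A_car(1) v, of a] by simp
    finally show "?Q \<phi> (proj (tens A V a v)) = proj (?V \<phi> (tens A V a v))" .
  qed
  show ?thesis
    unfolding colinear_iff[OF H_vs Q_vs is_vspace_tensor Q.lin_hco dQ]
  proof (intro conjI lin_aco_Q allI impI ballI)
    fix \<phi> v assume \<phi>: "lin H base \<phi>" and "v \<in> vcar Q"
    then have v: "v \<in> W" by simp
    show "?Q \<phi> (aco Q v) = aco Q (cop H Q (hco Q) \<phi> v)"
      using aco_cop_hco[OF \<phi> W_V[OF v]] eq[OF \<phi> lin_in[OF lin_aco W_V[OF v]]]
      by (simp add: cop_H_Q[OF \<phi> v])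
  qed
qed

text \<open>The action involves the coaction of \<open>H\<close> and the action of \<open>K\<close>;
  \<open>p\<close> respects both, by \<open>hco_p\<close> and \<open>p_rac\<close>.\<close>

lemma half_braided_act_Q:
  assumes t: "t \<in> vcar (A \<otimes> V)" and x: "x \<in> K"
  shows "half_braided_act H A K Q (proj t) x = proj (half_braided_act H A K V t x)"
proof (rule lin_tensor_eqI[OF A_vs lin_comp[OF Q.lin_half_braided_act[OF x] lin_proj]
      lin_comp[OF lin_proj lin_half_braided_act[OF x]] _ t])
  fix a v assume v: "v \<in> vcar V"
  let ?b = "\<lambda>x1 x2 h v0. tens A V (a * act A h x1) (rac V v0 x2)"
  let ?c = "\<lambda>x1 x2 h v0. tens A Q (a * act A h x1) (rac Q v0 x2)"
  have b4: "bilin A (sub A K) (A \<otimes> V) (\<lambda>x1 x2. tlift H V (?b x1 x2) (hco V v))"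
    by (intro base_rules V_rules v; simp)
  have "proj (half_braided_act H A K V (tens A V a v) x) = tlift A (sub A K) (\<lambda>x1 x2.
      proj (tlift H V (?b x1 x2) (hco V v))) (comult A x)"
    unfolding half_braided_act_tens[OF v x]
    by (rule lin_tlift_comp[OF A_vs K_vs is_vspace_tensor is_vspace_tensor b4 lin_proj K_comult[OF x]])
  also have "\<dots> = tlift A (sub A K) (\<lambda>x1 x2. tlift H Q (?c x1 x2) (hco Q (p v))) (comult A x)"
  proof (intro tlift_cong refl)
    fix x1 x2 assume "x2 \<in> vcar (sub A K)"
    then have x2: "x2 \<in> K" by simp
    have "proj (tlift H V (?b x1 x2) (hco V v)) =
        tlift H V (\<lambda>h v0. proj (tens A V (a * act A h x1) (rac V v0 x2))) (hco V v)"
      by (rule lin_tlift_comp[OF H_vs V_vs is_vspace_tensor is_vspace_tensor bilin_hb4[OF A_car(1) x2] lin_proj lin_in[OF lin_hco v]])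
    also have "\<dots> = tlift H V (\<lambda>h v0. tens A Q (a * act A h x1) (rac Q (p v0) x2)) (hco V v)"
      by (intro tlift_cong refl) (simp add: proj_tens rac_in x2 p_rac)
    also have "\<dots> = tlift H Q (?c x1 x2) (hco V (p v))"
      by (rule hco_p[OF is_vspace_tensor Q.bilin_hb4[OF A_car(1) x2] v, symmetric])
    finally show "proj (tlift H V (?b x1 x2) (hco V v)) =
        tlift H Q (?c x1 x2) (hco Q (p v))" by simp
  qed
  also have "\<dots> = half_braided_act H A K Q (proj (tens A V a v)) x"
    using Q.half_braided_act_tens[of "p v" x a] p_in[OF v] x by (simp add: proj_tens v)
  finally show "half_braided_act H A K Q (proj (tens A V a v)) x = proj (half_braided_act H A K V (tens A V a v) x)" ..
qed

theorem hopf_module_Q: "hopf_module H A K Q"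
  unfolding hopf_module_def right_module_def
proof (intro conjI ballI)
  show "comodule H Q (hco Q)" using Q_H_com by simp
  show "bilin Q (sub A K) Q (rac Q)" by (rule bilin_rac_Q)
  show "comodule A Q (aco Q)" by (rule Q_A_com)
  show "rac Q v 1 = v" if "v \<in> vcar Q" for v using that by (simp add: rac_one W_V p_id)
  show "rac Q v (x * y) = rac Q (rac Q v x) y" if "v \<in> vcar Q" "x \<in> K" "y \<in> K" for v x y
    using that by (simp add: rac_mult p_rac rac_in W_V)
  show "aco Q (rac Q v x) = half_braided_act H A K Q (aco Q v) x" if "v \<in> vcar Q" "x \<in> K" for v x
    using that by (simp add: aco_p rac_in W_V aco_rac half_braided_act_Q lin_in[OF lin_aco])
qed (rule rac_Q_colinear aco_Q_colinear)+

end

section \<open>Maximal free submodules\<close>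

context module_data
begin

definition act_map :: "('k, 'v, 'a) tensor \<Rightarrow> 'v" where
  "act_map = tlift V (sub A K) (rac V)"

text \<open>The space \<open>N \<otimes> K\<close> as a subset of one fixed tensor type, so that
  inclusions between different \<open>N\<close> become inclusions of sets.\<close>

definition ext :: "'v set \<Rightarrow> ('k, 'v, 'a) tensor set" where
  "ext N = vcar (sub V N \<otimes> sub A K)"

lemma lin_act_map: "lin (V \<otimes> sub A K) V act_map"
  unfolding act_map_def by (rule lin_tlift[OF V_vs K_vs V_vs bilin_rac])

lemma act_map_tens: "v \<in> vcar V \<Longrightarrow> x \<in> K \<Longrightarrow> act_map (tens V A v x) = rac V v x"
  unfolding act_map_def using tlift_tens[OF V_vs K_vs V_vs bilin_rac, of v x] by simp

lemma ext_rep: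
  assumes N: "is_subspace V N" and t: "t \<in> ext N"
  shows "\<exists>ps. set ps \<subseteq> N \<times> K \<and> t = (\<Sum>(v, x) \<leftarrow> ps. tens V A v x)"
  using tensor_rep[OF is_vspace_sub[OF V_vs N], of t "sub A K"] t by (auto simp: ext_def)

lemma ext_in: "is_subspace V N \<Longrightarrow> t \<in> ext N \<Longrightarrow> t \<in> vcar (V \<otimes> sub A K)"
  unfolding ext_def using is_subspaceD(1)[OF V_vs] tensor_mono1 by blast

lemma ext_tens: "v \<in> N \<Longrightarrow> x \<in> K \<Longrightarrow> tens V A v x \<in> ext N"
  unfolding ext_def using tens_in[of v "sub V N" x "sub A K"] by simp

lemma ext_zero: "0 \<in> ext N" and ext_add: "t \<in> ext N \<Longrightarrow> t' \<in> ext N \<Longrightarrow> t + t' \<in> ext N"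
  unfolding ext_def by (rule vs_zero[OF is_vspace_tensor] vs_add[OF is_vspace_tensor]; assumption)+

lemma ext_scale: "t \<in> ext N \<Longrightarrow> tscale c t \<in> ext N"
  unfolding ext_def using vs_scale[OF is_vspace_tensor, of t "sub V N" "sub A K" c] by simp

lemma ext_mono: "N \<subseteq> M \<Longrightarrow> ext N \<subseteq> ext M"
  unfolding ext_def using tensor_mono[of N "sub V M" K "sub A K"] by simp

lemma ext_zero_set: "is_subspace V {0} \<Longrightarrow> ext {0} = {0}"
proof -
  assume s: "is_subspace V {0}"
  have "t = 0" if t: "t \<in> ext {0}" for t
  proof -
    obtain ps where ps: "set ps \<subseteq> {0} \<times> K" "t = (\<Sum>(v, x) \<leftarrow> ps. tens V A v x)"
      using ext_rep[OF s t] by blast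
    have "tens V A 0 x = 0" for x using tens_add1[of V A 0 0 x] by simp
    then have "(\<Sum>(v, x) \<leftarrow> ps. tens V A v x) = 0" using ps(1) by (induction ps) auto
    then show ?thesis using ps by simp
  qed
  then show ?thesis using ext_zero by blast
qed

lemma ext_sum:
  assumes N: "is_subspace V N" and M: "is_subspace V M"
    and NM: "is_subspace V {x + y | x y. x \<in> N \<and> y \<in> M}" and t: "t \<in> ext {x + y | x y. x \<in> N \<and> y \<in> M}"
  shows "\<exists>t1 \<in> ext N. \<exists>t2 \<in> ext M. t = t1 + t2"
proof -
  obtain ps where ps: "set ps \<subseteq> {x + y | x y. x \<in> N \<and> y \<in> M} \<times> K" "t = (\<Sum>(v, x) \<leftarrow> ps. tens V A v x)"
    using ext_rep[OF NM t] by blast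
  show ?thesis unfolding ps(2) using ps(1)
  proof (induction ps)
    case Nil
    (* tensors are functions, and plain simp would rewrite their sums pointwise *)
    show ?case
      by (rule bexI[OF _ ext_zero], rule bexI[OF _ ext_zero]) (simp only: list.map sum_list.Nil add_0)
  next
    case (Cons a ps)
    have "set ps \<subseteq> {x + y | x y. x \<in> N \<and> y \<in> M} \<times> K" using Cons.prems by (simp only: set_simps insert_subset)
    from Cons.IH[OF this] obtain t1 t2
      where 1: "t1 \<in> ext N" "t2 \<in> ext M" "(\<Sum>(v, x) \<leftarrow> ps. tens V A v x) = t1 + t2" by blast
    from Cons.prems obtain x y k where a: "a = (x + y, k)" "x \<in> N" "y \<in> M" "k \<in> K" by auto
    have "(\<Sum>(v, x) \<leftarrow> a # ps. tens V A v x) = (tens V A x k + t1) + (tens V A y k + t2)"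
      unfolding a(1) list.map sum_list.Cons prod.case 1(3) tens_add1 by (simp only: ac_simps)
    then show ?case
      using ext_add[OF ext_tens[OF a(2,4)] 1(1)] ext_add[OF ext_tens[OF a(3,4)] 1(2)] by blast
  qed
qed

text \<open>A tensor has finitely many terms, and some member of the chain contains all their left
  factors.\<close>

lemma ext_Union_chain:
  assumes \<C>: "\<C> \<noteq> {}" "subset.chain S \<C>" and s: "is_subspace V (\<Union>\<C>)" and t: "t \<in> ext (\<Union>\<C>)"
  shows "\<exists>N \<in> \<C>. t \<in> ext N"
proof -
  obtain ps where ps: "set ps \<subseteq> \<Union>\<C> \<times> K" "t = (\<Sum>(v, x) \<leftarrow> ps. tens V A v x)"
    using ext_rep[OF s t] by blast
  show ?thesis unfolding ps(2) using ps(1)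
  proof (induction ps)
    case Nil
    obtain N where "N \<in> \<C>" using \<C>(1) by blast
    then show ?case by (rule bexI[rotated]) (simp only: list.map sum_list.Nil ext_zero)
  next
    case (Cons a ps)
    then obtain N where N: "N \<in> \<C>" "(\<Sum>(v, x) \<leftarrow> ps. tens V A v x) \<in> ext N" by auto
    from Cons.prems obtain x k M where a: "a = (x, k)" "x \<in> M" "M \<in> \<C>" "k \<in> K" by auto
    have "M \<subseteq> N \<or> N \<subseteq> M" using \<C>(2) N a by (auto simp: subset.chain_def)
    then obtain L where L: "L \<in> \<C>" "M \<subseteq> L" "N \<subseteq> L" using N a by blast
    have "(\<Sum>(v, x) \<leftarrow> a # ps. tens V A v x) \<in> ext L"
      unfolding a(1) list.map sum_list.Cons prod.case
      using ext_add[OF ext_tens[of x M k, OF a(2,4), THEN subsetD[OF ext_mono[OF L(2)]]] subsetD[OF ext_mono[OF L(3)] N(2)]] .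
    then show ?case using L by blast
  qed
qed

lemma act_map_sub: "is_subspace V N \<Longrightarrow> t \<in> ext N \<Longrightarrow> tlift (sub V N) (sub A K) (rac V) t = act_map t"
  unfolding act_map_def ext_def by (rule tlift_sub_eq1[OF V_vs K_vs V_vs _ bilin_rac])

text \<open>Replaces the maps attached to the separate \<open>N\<close> by restrictions of the
  single map \<open>act_map\<close>.\<close>

lemma K_free_iff:
  assumes U: "is_subspace V U"
  shows "K_free H A K (V\<lparr>vcar := U\<rparr>) \<longleftrightarrow>
    (\<exists>N. N \<subseteq> U \<and> subcomodule H V (hco V) N \<and> bij_betw act_map (ext N) U)"
proof -
  have s: "sub (V\<lparr>vcar := U\<rparr>) N = sub V N" for N by (simp add: sub_def)
  have UV: "U \<subseteq> vcar V" using is_subspaceD(1)[OF V_vs U] .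
  have 1: "subcomodule H (V\<lparr>vcar := U\<rparr>) (hco V) N \<longleftrightarrow> N \<subseteq> U \<and> subcomodule H V (hco V) N" for N
    using UV by (auto simp: subcomodule_def is_subspace_def s)
  have 2: "bij_betw (tlift (sub V N) (sub A K) (rac V)) (ext N) U \<longleftrightarrow> bij_betw act_map (ext N) U"
    if "subcomodule H V (hco V) N" for N
    using that by (intro bij_betw_cong act_map_sub) (auto simp: subcomodule_def)
  show ?thesis
    unfolding K_free_def s using 2 by (auto simp: 1 ext_def)
qed

lemma inj_on_act_map:
  assumes N: "is_subspace V N"
  shows "inj_on act_map (ext N) \<longleftrightarrow> (\<forall>t \<in> ext N. act_map t = 0 \<longrightarrow> t = 0)"
proof
  have 0: "act_map 0 = 0" by (rule lin_zero[OF is_vspace_tensor lin_act_map])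
  assume i: "inj_on act_map (ext N)"
  show "\<forall>t \<in> ext N. act_map t = 0 \<longrightarrow> t = 0"
    using inj_onD[OF i _ _ ext_zero] 0 by simp
next
  assume z: "\<forall>t \<in> ext N. act_map t = 0 \<longrightarrow> t = 0"
  show "inj_on act_map (ext N)"
  proof (rule inj_onI)
    fix t t' assume t: "t \<in> ext N" "t' \<in> ext N" and e: "act_map t = act_map t'"
    have "act_map (t - t') = 0"
      using lin_diff[OF is_vspace_tensor lin_act_map ext_in[OF N t(1)] ext_in[OF N t(2)]] e by simp
    moreover have "t - t' \<in> ext N" using vs_diff[OF is_vspace_tensor] t unfolding ext_def by blast
    ultimately show "t = t'" using z by force
  qed
qed

end

context hopf_mod
begin

lemma ext_image_contains: "is_subspace V N \<Longrightarrow> N \<subseteq> act_map ` ext N"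
proof
  fix n assume N: "is_subspace V N" and n: "n \<in> N"
  then have "n \<in> vcar V" using is_subspaceD(1)[OF V_vs] by blast
  then have "act_map (tens V A n 1) = n" by (simp add: act_map_tens K_one rac_one)
  then show "n \<in> act_map ` ext N" using ext_tens[OF n K_one] by force
qed

definition partial_free :: "'v set \<Rightarrow> bool" where
  "partial_free N \<longleftrightarrow> subcomodule H V (hco V) N \<and> inj_on act_map (ext N) \<and>
     hopf_submodule H A K V (act_map ` ext N)"

lemma partial_free_zero: "partial_free {0}"
proof -
  have s: "is_subspace V {0}" using subcomodule_zero[OF H_coalgebra H_com] by (simp add: subcomodule_def)
  have "act_map ` ext {0} = {0}"
    using lin_zero[OF is_vspace_tensor lin_act_map] by (simp add: ext_zero_set[OF s])
  moreover have "rac V 0 x = 0" if "x \<in> K" for x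
    using lin_zero[OF V_vs lin_rac1[OF lin_id that]] .
  ultimately show ?thesis
    using subcomodule_zero[OF H_coalgebra H_com] subcomodule_zero[OF A_coalgebra A_com]
    by (simp add: partial_free_def ext_zero_set[OF s] hopf_submodule_def)
qed

text \<open>Injectivity is tested on one tensor at a time, which already lives over a single member
  of the chain; the images again form a chain.\<close>

lemma partial_free_Union:
  assumes \<C>: "\<C> \<noteq> {}" "subset.chain {N. partial_free N} \<C>"
  shows "partial_free (\<Union>\<C>)"
proof -
  have pf: "partial_free N" if "N \<in> \<C>" for N using \<C>(2) that by (auto simp: subset.chain_def)
  have sc: "subcomodule H V (hco V) (\<Union>\<C>)"
    by (rule subcomodule_Union_chain[OF H_coalgebra H_com \<C>]) (use pf in \<open>auto simp: partial_free_def\<close>)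
  then have s: "is_subspace V (\<Union>\<C>)" by (simp add: subcomodule_def)
  have sN: "is_subspace V N" if "N \<in> \<C>" for N using pf[OF that] by (simp add: partial_free_def subcomodule_def)
  note un = ext_Union_chain[OF \<C> s]
  have "inj_on act_map (ext (\<Union>\<C>))"
    unfolding inj_on_act_map[OF s]
  proof (intro ballI impI)
    fix t assume t: "t \<in> ext (\<Union>\<C>)" "act_map t = 0"
    from un[OF t(1)] obtain N where N: "N \<in> \<C>" "t \<in> ext N" by blast
    then show "t = 0" using pf[OF N(1)] t(2) inj_on_act_map[OF sN[OF N(1)]] by (simp add: partial_free_def)
  qed
  moreover have im: "act_map ` ext (\<Union>\<C>) = \<Union>((\<lambda>N. act_map ` ext N) ` \<C>)"
  proof
    show "act_map ` ext (\<Union>\<C>) \<subseteq> \<Union>((\<lambda>N. act_map ` ext N) ` \<C>)" using un by blast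
    show "\<Union>((\<lambda>N. act_map ` ext N) ` \<C>) \<subseteq> act_map ` ext (\<Union>\<C>)"
      using ext_mono[of _ "\<Union>\<C>"] by (intro UN_least image_mono) (simp add: Union_upper)
  qed
  moreover have "hopf_submodule H A K V (\<Union>((\<lambda>N. act_map ` ext N) ` \<C>))"
  proof -
    let ?D = "(\<lambda>N. act_map ` ext N) ` \<C>"
    have D: "?D \<noteq> {}" using \<C>(1) by blast
    have hs: "hopf_submodule H A K V U" if "U \<in> ?D" for U using that pf by (auto simp: partial_free_def)
    have ch: "subset.chain UNIV ?D"
      unfolding subset_chain_def
    proof (intro conjI ballI)
      fix X Y assume "X \<in> ?D" "Y \<in> ?D"
      then obtain M N where "X = act_map ` ext M" "Y = act_map ` ext N" and MN: "M \<in> \<C>" "N \<in> \<C>" by blast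
      moreover have "M \<subseteq> N \<or> N \<subseteq> M" using \<C>(2) MN by (auto simp: subset.chain_def)
      ultimately show "X \<subseteq> Y \<or> Y \<subseteq> X" using ext_mono[of M N] ext_mono[of N M] by blast
    qed simp
    have "subcomodule H V (hco V) (\<Union>?D)"
      by (rule subcomodule_Union_chain[OF H_coalgebra H_com D ch]) (use hs in \<open>simp add: hopf_submodule_def\<close>)
    moreover have "subcomodule A V (aco V) (\<Union>?D)"
      by (rule subcomodule_Union_chain[OF A_coalgebra A_com D ch]) (use hs in \<open>simp add: hopf_submodule_def\<close>)
    moreover have "rac V u x \<in> \<Union>?D" if "u \<in> \<Union>?D" "x \<in> K" for u x
      using hs that unfolding hopf_submodule_def by blast
    ultimately show ?thesis unfolding hopf_submodule_def by blast
  qed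
  ultimately show ?thesis using sc by (simp add: partial_free_def)
qed

end

section \<open>Enlarging a free submodule through the quotient\<close>

context hopf_quotient
begin

lemma act_map_Q:
  assumes N: "is_subspace Q N" and t: "t \<in> ext N"
  shows "Q.act_map t = p (act_map t)" "Q.ext N = ext N"
proof -
  have s: "sub Q N = sub V N" for N by (simp add: sub_def)
  have N': "is_subspace V N" using N W_V by (auto simp: is_subspace_def)
  show e: "Q.ext N = ext N" by (simp add: Q.ext_def ext_def s)
  have b: "bilin V (sub A K) V (\<lambda>v x. p (rac V v x))"
    by (intro bilinI lin_comp[OF lin_pV] lin_rac1 lin_rac2 lin_id; simp)
  have "Q.act_map t = tlift (sub V N) (sub A K) (\<lambda>v x. p (rac V v x)) t"
    using Q.act_map_sub[OF N, of t] t by (simp add: e s)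
  also have "\<dots> = tlift V (sub A K) (\<lambda>v x. p (rac V v x)) t"
    by (rule tlift_sub_eq1[OF V_vs K_vs V_vs N' b]) (use t in \<open>simp add: ext_def\<close>)
  also have "\<dots> = p (act_map t)"
    unfolding act_map_def by (rule lin_tlift_comp[OF V_vs K_vs V_vs V_vs bilin_rac lin_pV ext_in[OF N' t], symmetric])
  finally show "Q.act_map t = p (act_map t)" .
qed

text \<open>This sum is the preimage of \<open>X\<close> under \<open>p\<close>, because
  \<open>y - p y\<close> lies in \<open>U\<close>. The action and the operators of \<open>A\<close>
  agree with those of \<open>Q\<close> after applying \<open>p\<close>, so they preserve it.\<close>

lemma hopf_submodule_preimage:
  assumes X: "hopf_submodule H A K Q X"
  shows "hopf_submodule H A K V {u + w | u w. u \<in> U \<and> w \<in> X}"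
proof -
  have s: "sub Q N = sub V N" for N by (simp add: sub_def)
  have XW: "X \<subseteq> W" and XQ: "is_subspace Q X" using X by (auto simp: hopf_submodule_def subcomodule_def is_subspace_def)
  have XV: "x \<in> vcar V" if "x \<in> X" for x using that XW W_V by blast
  have HX: "subcomodule H V (hco V) X"
    using X XV by (auto simp: hopf_submodule_def subcomodule_def is_subspace_def s)
  let ?U = "{u + w | u w. u \<in> U \<and> w \<in> X}"
  have H: "subcomodule H V (hco V) ?U" by (rule subcomodule_sum[OF H_coalgebra H_com U_H HX])
  have dec: "y \<in> ?U" if y: "y \<in> vcar V" "p y \<in> X" for y
    using p_diff[OF y(1)] y(2) by (intro CollectI exI[of _ "y - p y"] exI[of _ "p y"]) simp
  have add: "x + y \<in> ?U" if "x \<in> U" "y \<in> ?U" for x y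
  proof -
    obtain u w where "y = u + w" "u \<in> U" "w \<in> X" using \<open>y \<in> ?U\<close> by blast
    then show ?thesis using is_subspaceD(3)[OF V_vs U_subspace \<open>x \<in> U\<close>, of u]
      by (intro CollectI exI[of _ "x + u"] exI[of _ w]) (simp add: add.assoc)
  qed
  note \<Delta> = lin_comult_A
  have A: "subcomodule A V (aco V) ?U"
    unfolding stable_A
  proof (intro conjI allI impI ballI)
    show "is_subspace V ?U" using H by (simp add: subcomodule_def)
    fix f v assume f: "lin A base f" and "v \<in> ?U"
    then obtain u w where v: "v = u + w" "u \<in> U" "w \<in> X" by blast
    note l = lin_cop_A[OF f]
    have "cop A V (aco V) f v = cop A V (aco V) f u + cop A V (aco V) f w"
      using lin_add[OF l U_V[OF v(2)] XV[OF v(3)]] v(1) by simp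
    moreover have "cop A V (aco V) f u \<in> U"
      using U_A f v(2) unfolding stable_A by blast
    moreover have "subcomodule A Q (aco Q) X" using X by (simp add: hopf_submodule_def)
    then have "cop A Q (aco Q) f w \<in> X"
      using f v(3) unfolding subcomodule_iff[OF A_vs Q_vs \<Delta> lin_aco_Q] by blast
    then have "p (cop A V (aco V) f w) \<in> X" unfolding cop_A_Q[OF f XV[OF v(3)]] .
    then have "cop A V (aco V) f w \<in> ?U" by (rule dec[OF lin_in[OF l XV[OF v(3)]]])
    ultimately show "cop A V (aco V) f v \<in> ?U" using add by simp
  qed
  have "rac V v x \<in> ?U" if v: "v \<in> ?U" and x: "x \<in> K" for v x
  proof -
    from v obtain u w where v: "v = u + w" "u \<in> U" "w \<in> X" by blast
    have "rac V v x = rac V u x + rac V w x"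
      using lin_add[OF lin_rac1[OF lin_id x] U_V[OF v(2)] XV[OF v(3)]] v(1) by simp
    moreover have "p (rac V w x) \<in> X" using X v(3) x by (simp add: hopf_submodule_def)
    then have "rac V w x \<in> ?U" using dec rac_in[OF XV[OF v(3)] x] by blast
    ultimately show ?thesis using add U_rac[OF v(2) x] by simp
  qed
  then show ?thesis using H A unfolding hopf_submodule_def by blast
qed

text \<open>A five lemma by hand: \<open>act_map\<close> is bijective from \<open>ext N\<close> onto
  \<open>U\<close>, and followed by \<open>p\<close> it is bijective from \<open>ext N'\<close> onto
  \<open>X\<close>. Applying \<open>p\<close> to a relation isolates its component in
  \<open>ext N'\<close>.\<close>

lemma partial_free_extend:
  assumes N: "partial_free N" and UN: "U = act_map ` ext N"
    and X: "hopf_submodule H A K Q X" and N': "N' \<subseteq> X" "subcomodule H Q (hco Q) N'"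
    and bij: "bij_betw Q.act_map (Q.ext N') X"
  shows "partial_free {x + y | x y. x \<in> N \<and> y \<in> N'}" (is "partial_free ?M")
proof -
  have s: "sub Q N = sub V N" for N by (simp add: sub_def)
  have N'Q: "is_subspace Q N'" using N'(2) by (simp add: subcomodule_def)
  then have N'V: "is_subspace V N'" using W_V by (auto simp: is_subspace_def)
  have sN: "is_subspace V N" and HN: "subcomodule H V (hco V) N" using N by (simp_all add: partial_free_def subcomodule_def)
  have "subcomodule H V (hco V) N'" using N'(2) N'V by (simp add: subcomodule_def s)
  then have M: "subcomodule H V (hco V) ?M" by (rule subcomodule_sum[OF H_coalgebra H_com HN])
  then have sM: "is_subspace V ?M" by (simp add: subcomodule_def)
  note split = ext_sum[OF sN N'V sM]
  note mQ = act_map_Q[OF N'Q]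
  have eQ: "Q.ext N' = ext N'" by (simp add: Q.ext_def ext_def s)
  have in_N: "t \<in> vcar (V \<otimes> sub A K)" "act_map t \<in> vcar V" if "t \<in> ext N" for t
    using ext_in[OF sN that] lin_in[OF lin_act_map] by blast+
  have in_N': "t \<in> vcar (V \<otimes> sub A K)" "act_map t \<in> vcar V" if "t \<in> ext N'" for t
    using ext_in[OF N'V that] lin_in[OF lin_act_map] by blast+
  have pX: "p (act_map t) \<in> X" if "t \<in> ext N'" for t
    using bij that mQ(1)[OF that] unfolding eQ bij_betw_def by force
  have add: "act_map (t1 + t2) = act_map t1 + act_map t2" if "t1 \<in> ext N" "t2 \<in> ext N'" for t1 t2
    using lin_add[OF lin_act_map in_N(1)[OF that(1)] in_N'(1)[OF that(2)]] .
  have "inj_on act_map (ext ?M)"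
    unfolding inj_on_act_map[OF sM]
  proof (intro ballI impI)
    fix t assume t: "t \<in> ext ?M" "act_map t = 0"
    from split[OF t(1)] obtain t1 t2 where t12: "t1 \<in> ext N" "t2 \<in> ext N'" "t = t1 + t2" by blast
    have 0: "act_map t1 + act_map t2 = 0" using add[OF t12(1,2)] t(2) t12(3) by simp
    have "p (act_map t1) + p (act_map t2) = p 0"
      using lin_add[OF lin_pV in_N(2)[OF t12(1)] in_N'(2)[OF t12(2)]] 0 by simp
    moreover have "p (act_map t1) = 0" by (rule p_zero) (use t12(1) UN in blast)
    moreover have "p 0 = 0" by (rule lin_zero[OF V_vs lin_pV])
    ultimately have "Q.act_map t2 = 0" using mQ(1)[OF t12(2)] by simp
    then have t2: "t2 = 0"
      using bij t12(2) Q.inj_on_act_map[OF N'Q] unfolding bij_betw_def eQ by blast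
    then have "act_map t1 = 0" using 0 lin_zero[OF is_vspace_tensor lin_act_map] by simp
    then have "t1 = 0" using N t12(1) inj_on_act_map[OF sN] by (simp add: partial_free_def)
    then show "t = 0" using t2 t12(3) by simp
  qed
  moreover have "act_map ` ext ?M = {u + w | u w. u \<in> U \<and> w \<in> X}"
  proof (intro equalityI subsetI)
    fix y assume "y \<in> act_map ` ext ?M"
    then obtain t1 t2 where t12: "t1 \<in> ext N" "t2 \<in> ext N'" "y = act_map (t1 + t2)" using split by blast
    \<comment> \<open>\<open>act_map t2\<close> need not lie in \<open>X\<close>; its difference
      from \<open>p (act_map t2)\<close> lies in \<open>U\<close> and is absorbed there.\<close>
    have "y = (act_map t1 + (act_map t2 - p (act_map t2))) + p (act_map t2)"
      using add[OF t12(1,2)] t12(3) by simp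
    moreover have "act_map t1 + (act_map t2 - p (act_map t2)) \<in> U"
      using is_subspaceD(3)[OF V_vs U_subspace] UN t12(1) p_diff[OF in_N'(2)[OF t12(2)]] by blast
    ultimately show "y \<in> {u + w | u w. u \<in> U \<and> w \<in> X}" using pX[OF t12(2)] by blast
  next
    fix y assume "y \<in> {u + w | u w. u \<in> U \<and> w \<in> X}"
    then obtain u w where y: "y = u + w" "u \<in> U" "w \<in> X" by blast
    have "w \<in> Q.act_map ` ext N'" using bij y(3) by (simp add: bij_betw_def eQ)
    then obtain t2 where t2: "t2 \<in> ext N'" "w = Q.act_map t2" by blast
    note t2 = t2(1) t2(2)[unfolded mQ(1)[OF t2(1)]]
    have "u - (act_map t2 - p (act_map t2)) \<in> U"
      using is_subspaceD(5)[OF V_vs U_subspace y(2)] p_diff[OF in_N'(2)[OF t2(1)]] by blast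
    then obtain t1 where t1: "t1 \<in> ext N" "u - (act_map t2 - p (act_map t2)) = act_map t1" using UN by blast
    have "y = act_map (t1 + t2)" using add[OF t1(1) t2(1)] y(1) t2(2) t1(2) by (simp add: algebra_simps)
    moreover have "N \<subseteq> ?M" "N' \<subseteq> ?M"
      using is_subspaceD(2)[OF V_vs sN] is_subspaceD(2)[OF V_vs N'V] by force+
    from ext_add[OF subsetD[OF ext_mono[OF this(1)] t1(1)] subsetD[OF ext_mono[OF this(2)] t2(1)]]
    have "t1 + t2 \<in> ext ?M" .
    ultimately show "y \<in> act_map ` ext ?M" by (rule image_eqI)
  qed
  ultimately show ?thesis using M hopf_submodule_preimage[OF X] by (simp add: partial_free_def)
qed

end

context hopf_mod
begin

theorem free_of_free_submodules:
  assumes ss: "cosemisimple TYPE('v) H"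
    and free: "\<And>V :: ('k, 'h, 'a, 'v) hopfmod. hopf_module H A K V \<Longrightarrow> vcar V \<noteq> {0} \<Longrightarrow>
      \<exists>U. hopf_submodule H A K V U \<and> U \<noteq> {0} \<and> K_free H A K (V\<lparr>vcar := U\<rparr>)"
  shows "K_free H A K V"
proof -
  have "\<exists>N\<in>{N. partial_free N}. \<forall>X\<in>{N. partial_free N}. N \<subseteq> X \<longrightarrow> X = N"
    by (rule subset_Zorn_nonempty) (use partial_free_zero partial_free_Union in auto)
  then obtain N where N: "partial_free N" and max: "\<And>X. partial_free X \<Longrightarrow> N \<subseteq> X \<Longrightarrow> X = N" by auto
  define U where "U = act_map ` ext N"
  have HN: "subcomodule H V (hco V) N" and hU: "hopf_submodule H A K V U"
    using N by (simp_all add: partial_free_def U_def)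
  then have U: "subcomodule H V (hco V) U" and sU: "is_subspace V U" and sN: "is_subspace V N"
    by (simp_all add: hopf_submodule_def subcomodule_def)
  have "U = vcar V"
  proof (rule ccontr)
    assume ne: "U \<noteq> vcar V"
    obtain W where W: "subcomodule H V (hco V) W" "U \<inter> W = {0}" 
      and dec: "\<And>v. v \<in> vcar V \<Longrightarrow> \<exists>u\<in>U. \<exists>w\<in>W. v = u + w"
      using cosemisimple_complement[OF H_coalgebra ss H_com U] by blast
    have sW: "is_subspace V W" using W by (simp add: subcomodule_def)
    obtain p where p: "lin V (sub V W) p" "\<forall>w\<in>W. p w = w" "\<forall>u\<in>U. p u = 0" "\<forall>v\<in>vcar V. v - p v \<in> U"
      using complement_projection[OF V_vs sU sW W(2) dec] by blast
    interpret hopf_quotient H A K V U W p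
      by unfold_locales (use p hU W in auto)
    have "W \<noteq> {0}"
    proof
      assume "W = {0}"
      then have "vcar V \<subseteq> U" using dec by auto
      then show False using ne is_subspaceD(1)[OF V_vs sU] by blast
    qed
    \<comment> \<open>The quotient is carried by the same type as \<open>V\<close>, so the
      hypothesis applies to it.\<close>
    then obtain X where X: "hopf_submodule H A K Q X" "X \<noteq> {0}" and fX: "K_free H A K (Q\<lparr>vcar := X\<rparr>)"
      using free[OF hopf_module_Q] by auto
    have sX: "is_subspace Q X" using X by (simp add: hopf_submodule_def subcomodule_def)
    obtain N' where N': "N' \<subseteq> X" "subcomodule H Q (hco Q) N'" "bij_betw Q.act_map (Q.ext N') X"
      using fX unfolding Q.K_free_iff[OF sX] by blast
    have sN': "is_subspace Q N'" using N'(2) by (simp add: subcomodule_def)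
    let ?M = "{x + y | x y. x \<in> N \<and> y \<in> N'}"
    have "partial_free ?M" by (rule partial_free_extend[OF N U_def X(1) N'])
    moreover have "N \<subseteq> ?M" "N' \<subseteq> ?M"
      using is_subspaceD(2)[OF V_vs sN] is_subspaceD(2)[OF Q_vs sN'] by force+
    ultimately have "N' \<subseteq> N" using max by blast
    \<comment> \<open>As \<open>1 \<in> K\<close>, the space \<open>N\<close> lies in
      \<open>U\<close>. Thus \<open>N'\<close> lies in both \<open>U\<close> and \<open>W\<close>,
      hence is zero, and so is \<open>X\<close>.\<close>
    then have "N' \<subseteq> U" using ext_image_contains[OF sN] by (auto simp: U_def)
    moreover have "N' \<subseteq> W" using is_subspaceD(1)[OF Q_vs sN'] by simp
    ultimately have N'0: "N' = {0}" using W(2) is_subspaceD(2)[OF Q_vs sN'] by blast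
    then have "Q.ext N' = {0}" using Q.ext_zero_set sN' by blast
    then have "X = {0}" using N'(3) lin_zero[OF is_vspace_tensor Q.lin_act_map] by (auto simp: bij_betw_def)
    then show False using X(2) by simp
  qed
  then have "bij_betw act_map (ext N) (vcar V)" using N by (simp add: partial_free_def bij_betw_def U_def)
  moreover have "N \<subseteq> vcar V" using is_subspaceD(1)[OF V_vs sN] .
  ultimately have "K_free H A K (V\<lparr>vcar := vcar V\<rparr>)"
    unfolding K_free_iff[OF is_subspace_carrier[OF V_vs]] using HN by blast
  then show ?thesis by simp
qed

end

section \<open>Antipode and grouplike elements\<close>

lemma tlift_tens_id:
  assumes V: "is_vspace V" and W: "is_vspace W" and t: "t \<in> vcar (V \<otimes> W)"
  shows "tlift V W (tens V W) t = t"
  by (rule lin_tensor_eqI[OF V lin_tlift lin_id _ t])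
    (auto intro: assms is_vspace_tensor bilin_tens tlift_tens)

lemma tensor_span_singleton:
  assumes C: "is_vspace C" and V: "is_vspace V" and v: "v \<in> vcar V"
    and t: "t \<in> vcar (C \<otimes> sub V (module.span (vscale V) {v}))"
  shows "\<exists>c \<in> vcar C. t = tens C V c v"
proof -
  interpret V: vector_space "vscale V" using V by (simp add: is_vspace_def)
  obtain ps where ps: "set ps \<subseteq> vcar C \<times> V.span {v}" "t = (\<Sum>(c, w)\<leftarrow>ps. tens C V c w)"
    using tensor_rep[OF C t] by auto
  have z: "tens C V 0 v = 0" using tens_add1[of C V 0 0 v] by simp
  show ?thesis unfolding ps(2) using ps(1)
  proof (induction ps)
    case Nil
    show ?case by (rule bexI[OF _ vs_zero[OF C]]) (simp only: list.map sum_list.Nil z)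
  next
    case (Cons a ps)
    have "set ps \<subseteq> vcar C \<times> V.span {v}" using Cons.prems by (simp only: set_simps insert_subset)
    from Cons.IH[OF this] obtain c where c: "c \<in> vcar C" "(\<Sum>(c, w)\<leftarrow>ps. tens C V c w) = tens C V c v" by blast
    from Cons.prems have "fst a \<in> vcar C" "snd a \<in> V.span {v}" by auto
    then obtain d k where a: "a = (d, vscale V k v)" "d \<in> vcar C"
      unfolding V.span_singleton by (metis prod.collapse rangeE)
    have "(\<Sum>(c, w)\<leftarrow>a # ps. tens C V c w) = tens C V (vscale C k d + c) v"
      unfolding a(1) list.map sum_list.Cons prod.case c(2) tens_scale2 tens_add1 tens_scale1 ..
    then show ?case using vs_add[OF C vs_scale[OF C a(2)] c(1)] by blast
  qed
qed

section \<open>Antipodes of ordinary Hopf algebras\<close>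

locale hopf_alg =
  fixes H :: "('k::field, 'h::ring_1) hopf"
  assumes hopf: "hopf_algebra H"
begin

abbreviation "\<Delta> \<equiv> comult H"
abbreviation "\<epsilon> \<equiv> counit H"
abbreviation "S \<equiv> antipode H"
abbreviation "sum2 \<equiv> tlift H H"

lemma algebra: "is_algebra H" and coalg: "coalgebra H"
  using hopf by (simp_all add: hopf_algebra_def)

lemma vs: "is_vspace H" and car: "x \<in> vcar H" and carU: "vcar H = UNIV"
  using algebra by (simp_all add: is_algebra_def)

lemma lin_S: "lin H H S" and lin_\<epsilon>: "lin H base \<epsilon>" and lin_\<Delta>: "lin H (H \<otimes> H) \<Delta>"
  using hopf coalg by (simp_all add: hopf_algebra_def antipode_axiom_def coalgebra_def)

lemma S_left: "sum2 (\<lambda>a b. S a * b) (\<Delta> x) = vscale H (\<epsilon> x) 1"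
  and S_right: "sum2 (\<lambda>a b. a * S b) (\<Delta> x) = vscale H (\<epsilon> x) 1"
  using hopf by (simp_all add: hopf_algebra_def antipode_axiom_def)

lemma \<epsilon>_left: "sum2 (\<lambda>a b. vscale H (\<epsilon> a) b) (\<Delta> x) = x"
  and \<epsilon>_right: "sum2 (\<lambda>a b. vscale H (\<epsilon> b) a) (\<Delta> x) = x"
  using coalg car by (simp_all add: coalgebra_def)

lemma \<Delta>_in: "\<Delta> x \<in> vcar (H \<otimes> H)" using lin_in[OF lin_\<Delta> car] .

lemmas rules = bilinI lin_tlift_param lin_tlift_arg lin_mult1[OF algebra] lin_mult2[OF algebra] lin_id
  lin_tens1 lin_tens2 vs car is_vspace_tensor tens_in lin_comp[OF lin_S] lin_comp[OF lin_\<epsilon>] lin_comp[OF lin_\<Delta>]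
  \<Delta>_in lin_scale1 lin_scale2 lin_base1 lin_base2

lemma scale_mult: "vscale H c x * y = vscale H c (x * y)" "x * vscale H c y = vscale H c (x * y)"
  using lin_scale[OF bilinD2[OF bilin_mult[OF algebra] car] car] lin_scale[OF bilinD1[OF bilin_mult[OF algebra] car] car] by auto

lemma sum2_lin: "bilin H H H B \<Longrightarrow> lin H H F \<Longrightarrow> F (sum2 B (\<Delta> x)) = sum2 (\<lambda>a b. F (B a b)) (\<Delta> x)"
  by (rule lin_tlift_comp[OF vs vs vs vs _ _ \<Delta>_in])

lemma sum2_\<Delta>_mult:
  assumes B: "bilin H H U B" and U: "is_vspace U"
  shows "sum2 B (\<Delta> (x * y)) = sum2 (\<lambda>a b. sum2 (\<lambda>a' b'. B (a * a') (b * b')) (\<Delta> y)) (\<Delta> x)"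
proof -
  have F: "lin (H \<otimes> H) U (sum2 B)" by (rule lin_tlift[OF vs vs U B])
  have b1: "bilin H H (H \<otimes> H) (\<lambda>a' b'. tens H H (a * a') (b * b'))" for a b by (intro rules)
  have b2: "bilin H H (H \<otimes> H) (\<lambda>a b. sum2 (\<lambda>a' b'. tens H H (a * a') (b * b')) (\<Delta> y))" by (intro rules)
  have "\<Delta> (x * y) = sum2 (\<lambda>a b. sum2 (\<lambda>a' b'. tens H H (a * a') (b * b')) (\<Delta> y)) (\<Delta> x)"
    using hopf by (simp add: hopf_algebra_def tmult_def)
  then have "sum2 B (\<Delta> (x * y)) = sum2 (\<lambda>a b. sum2 B (sum2 (\<lambda>a' b'. tens H H (a * a') (b * b')) (\<Delta> y))) (\<Delta> x)"
    using lin_tlift_comp[OF vs vs is_vspace_tensor U b2 F \<Delta>_in] by simp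
  also have "\<dots> = sum2 (\<lambda>a b. sum2 (\<lambda>a' b'. sum2 B (tens H H (a * a') (b * b'))) (\<Delta> y)) (\<Delta> x)"
    by (rule tlift_cong[OF refl refl _ refl]) (rule lin_tlift_comp[OF vs vs is_vspace_tensor U b1 F \<Delta>_in])
  also have "\<dots> = sum2 (\<lambda>a b. sum2 (\<lambda>a' b'. B (a * a') (b * b')) (\<Delta> y)) (\<Delta> x)"
    by (simp add: tlift_tens[OF vs vs U B car car])
  finally show ?thesis .
qed

lemma coassoc:
  assumes "\<And>c. bilin H H H (B c)" "\<And>c v. lin H H (\<lambda>x. B x c v)"
  shows "sum2 (\<lambda>c w. sum2 (B c) (\<Delta> w)) (\<Delta> x) = sum2 (\<lambda>c w. sum2 (\<lambda>c1 c2. B c1 c2 w) (\<Delta> c)) (\<Delta> x)"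
  by (rule comodule_coassoc[OF vs vs vs lin_\<Delta> lin_\<Delta> assms comodule_comult[OF coalg] car])

lemma S_one: "S 1 = 1"
proof -
  have "\<Delta> 1 = tens H H 1 1" "\<epsilon> 1 = 1" using hopf by (simp_all add: hopf_algebra_def)
  moreover have "bilin H H H (\<lambda>a b. S a * b)" by (intro rules)
  ultimately show ?thesis
    using S_left[of 1] tlift_tens[OF vs vs vs _ car car, of "\<lambda>a b. S a * b" 1 1] by (simp add: vs_simps[OF vs])
qed

text \<open>
  Anti-multiplicativity is reduced to this identity, which needs coassociativity in one variable only,
  so that the tensor product coalgebra \<open>H \<otimes> H\<close> never appears.
\<close>
lemma S_mult_aux: "sum2 (\<lambda>x1 x2. S (x1 * y) * x2) (\<Delta> x) = vscale H (\<epsilon> x) (S y)"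
proof -
  \<comment> \<open>The element \<open>S(x_(1) y_(1)) x_(2) y_(2) S(y_(3))\<close> is computed in
    two ways: contracting \<open>y_(2) S(y_(3))\<close> gives the left side, contracting the
    antipode identity for \<open>x y_(1)\<close> the right side.\<close>
  let ?B = "\<lambda>c c' v. sum2 (\<lambda>x1 x2. S (x1 * c) * x2 * c' * S v) (\<Delta> x)"
  have b0: "bilin H H H (\<lambda>x1 x2. S (x1 * c) * x2 * c' * S v)" for c c' v by (intro rules)
  have b1: "bilin H H H (?B c)" for c by (intro rules)
  have b2: "lin H H (\<lambda>c. ?B c c' v)" for c' v by (intro rules)
  have e: "\<epsilon> (x * y) = \<epsilon> x * \<epsilon> y" for x y using hopf by (simp add: hopf_algebra_def)
  have "sum2 (\<lambda>y1 w. sum2 (?B y1) (\<Delta> w)) (\<Delta> y) = sum2 (\<lambda>x1 x2. S (x1 * y) * x2) (\<Delta> x)"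
  proof -
    have "sum2 (?B y1) (\<Delta> w) = sum2 (\<lambda>x1 x2. S (x1 * vscale H (\<epsilon> w) y1) * x2) (\<Delta> x)" for y1 w
    proof -
      have "sum2 (?B y1) (\<Delta> w) = sum2 (\<lambda>x1 x2. sum2 (\<lambda>c' v. S (x1 * y1) * x2 * c' * S v) (\<Delta> w)) (\<Delta> x)"
        by (rule tlift_swap[OF vs vs vs vs vs]) (intro rules)+
      also have "\<dots> = sum2 (\<lambda>x1 x2. S (x1 * y1) * x2 * vscale H (\<epsilon> w) 1) (\<Delta> x)"
      proof (rule tlift_cong[OF refl refl _ refl])
        fix x1 x2
        have "bilin H H H (\<lambda>c' v. c' * S v)" "lin H H (\<lambda>z. S (x1 * y1) * x2 * z)" by (intro rules)+
        from sum2_lin[OF this, of w]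
        show "sum2 (\<lambda>c' v. S (x1 * y1) * x2 * c' * S v) (\<Delta> w) = S (x1 * y1) * x2 * vscale H (\<epsilon> w) 1"
          unfolding S_right by (simp add: mult.assoc)
      qed
      finally show ?thesis by (simp add: scale_mult lin_scale[OF lin_S car])
    qed
    then have "sum2 (\<lambda>y1 w. sum2 (?B y1) (\<Delta> w)) (\<Delta> y) =
      sum2 (\<lambda>y1 w. sum2 (\<lambda>x1 x2. S (x1 * vscale H (\<epsilon> w) y1) * x2) (\<Delta> x)) (\<Delta> y)" by simp
    also have "\<dots> = sum2 (\<lambda>x1 x2. S (x1 * y) * x2) (\<Delta> x)"
    proof -
      have "bilin H H H (\<lambda>y1 w. vscale H (\<epsilon> w) y1)" "lin H H (\<lambda>z. sum2 (\<lambda>x1 x2. S (x1 * z) * x2) (\<Delta> x))"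
        by (intro rules)+
      from sum2_lin[OF this, of y] show ?thesis by (simp add: \<epsilon>_right)
    qed
    finally show ?thesis .
  qed
  moreover have "sum2 (\<lambda>c w. sum2 (\<lambda>c1 c2. ?B c1 c2 w) (\<Delta> c)) (\<Delta> y) = vscale H (\<epsilon> x) (S y)"
  proof -
    have "sum2 (\<lambda>c1 c2. ?B c1 c2 w) (\<Delta> c) = vscale H (\<epsilon> x) (S (vscale H (\<epsilon> c) w))" for c w
    proof -
      have "sum2 (\<lambda>c1 c2. ?B c1 c2 w) (\<Delta> c) = sum2 (\<lambda>x1 x2. sum2 (\<lambda>c1 c2. S (x1 * c1) * (x2 * c2) * S w) (\<Delta> c)) (\<Delta> x)"
        unfolding mult.assoc by (rule tlift_swap[OF vs vs vs vs vs]) (intro rules)+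
      also have "\<dots> = sum2 (\<lambda>a b. S a * b * S w) (\<Delta> (x * c))"
        by (rule sum2_\<Delta>_mult[where U = H, symmetric]) (intro rules)+
      also have "\<dots> = sum2 (\<lambda>a b. S a * b) (\<Delta> (x * c)) * S w"
        by (rule sum2_lin[symmetric, of "\<lambda>a b. S a * b" "\<lambda>z. z * S w"]) (intro rules)+
      finally show ?thesis unfolding S_left by (simp add: e scale_mult lin_scale[OF lin_S car] vs_simps[OF vs])
    qed
    then have "sum2 (\<lambda>c w. sum2 (\<lambda>c1 c2. ?B c1 c2 w) (\<Delta> c)) (\<Delta> y) = 
      sum2 (\<lambda>c w. vscale H (\<epsilon> x) (S (vscale H (\<epsilon> c) w))) (\<Delta> y)" by simp
    also have "\<dots> = vscale H (\<epsilon> x) (S (sum2 (\<lambda>c w. vscale H (\<epsilon> c) w) (\<Delta> y)))"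
      by (rule sum2_lin[symmetric, of "\<lambda>c w. vscale H (\<epsilon> c) w" "\<lambda>z. vscale H (\<epsilon> x) (S z)"]) (intro rules)+
    finally show ?thesis by (simp add: \<epsilon>_left)
  qed
  ultimately show ?thesis using coassoc[of ?B y, OF b1 b2] by simp
qed

text \<open>Two evaluations of \<open>S(x_(1) y) x_(2) S(x_(3))\<close>: the antipode axiom on the
  last two factors leaves \<open>S(x y)\<close>, while \<open>S_mult_aux\<close> on the first two
  leaves \<open>S(y) S(x)\<close>.\<close>

lemma S_mult: "S (x * y) = S y * S x"
proof -
  let ?B = "\<lambda>c c' v. S (c * y) * c' * S v"
  have b1: "bilin H H H (?B c)" for c by (intro rules)
  have b2: "lin H H (\<lambda>c. ?B c c' v)" for c' v by (intro rules)
  have "sum2 (?B c) (\<Delta> w) = S (vscale H (\<epsilon> w) c * y)" for c w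
  proof -
    have "bilin H H H (\<lambda>c' v. c' * S v)" "lin H H (\<lambda>z. S (c * y) * z)" by (intro rules)+
    from sum2_lin[OF this, of w] show ?thesis
      unfolding S_right by (simp add: mult.assoc scale_mult lin_scale[OF lin_S car])
  qed
  then have "sum2 (\<lambda>c w. sum2 (?B c) (\<Delta> w)) (\<Delta> x) = sum2 (\<lambda>c w. S (vscale H (\<epsilon> w) c * y)) (\<Delta> x)" by simp
  also have "\<dots> = S (sum2 (\<lambda>c w. vscale H (\<epsilon> w) c) (\<Delta> x) * y)"
    by (rule sum2_lin[symmetric, of "\<lambda>c w. vscale H (\<epsilon> w) c" "\<lambda>z. S (z * y)"]) (intro rules)+
  finally have 1: "sum2 (\<lambda>c w. sum2 (?B c) (\<Delta> w)) (\<Delta> x) = S (x * y)" by (simp add: \<epsilon>_right)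
  have "sum2 (\<lambda>c1 c2. ?B c1 c2 w) (\<Delta> c) = S y * S (vscale H (\<epsilon> c) w)" for c w
  proof -
    have "bilin H H H (\<lambda>c1 c2. S (c1 * y) * c2)" "lin H H (\<lambda>z. z * S w)" by (intro rules)+
    from sum2_lin[OF this, of c] show ?thesis
      unfolding S_mult_aux by (simp add: scale_mult lin_scale[OF lin_S car])
  qed
  then have "sum2 (\<lambda>c w. sum2 (\<lambda>c1 c2. ?B c1 c2 w) (\<Delta> c)) (\<Delta> x) = sum2 (\<lambda>c w. S y * S (vscale H (\<epsilon> c) w)) (\<Delta> x)" by simp
  also have "\<dots> = S y * S (sum2 (\<lambda>c w. vscale H (\<epsilon> c) w) (\<Delta> x))"
    by (rule sum2_lin[symmetric, of "\<lambda>c w. vscale H (\<epsilon> c) w" "\<lambda>z. S y * S z"]) (intro rules)+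
  finally show ?thesis using 1 coassoc[of ?B x, OF b1 b2] by (simp add: \<epsilon>_left)
qed

text \<open>Applying the anti-multiplicative \<open>S\<close> turns the summand
  \<open>inv S b * a\<close> into \<open>S a * b\<close>, where the antipode axiom applies;
  \<open>S\<close> is injective. The identity is what cancels the braiding in
  \<open>untwist_twist\<close>.\<close>

lemma inverse_antipode:
  assumes bij: "bij S"
  shows "lin H H (inv S)" "sum2 (\<lambda>a b. inv S b * a) (\<Delta> x) = vscale H (\<epsilon> x) 1"
proof -
  have inv: "S (inv S x) = x" "inv S (S x) = x" for x
    using bij by (simp_all add: bij_is_inj bij_is_surj surj_f_inv_f)
  show l: "lin H H (inv S)"
  proof (rule linI[OF car])
    show "inv S (x + y) = inv S x + inv S y" for x y
      using lin_add[OF lin_S car car, of "inv S x" "inv S y"] inv by metis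
    show "inv S (vscale H c x) = vscale H c (inv S x)" for c x
      using lin_scale[OF lin_S car, of c "inv S x"] inv by metis
  qed
  have "S (sum2 (\<lambda>a b. inv S b * a) (\<Delta> x)) = sum2 (\<lambda>a b. S (inv S b * a)) (\<Delta> x)"
    by (rule sum2_lin[OF _ lin_S]) (intro rules lin_comp[OF l])
  also have "\<dots> = S (vscale H (\<epsilon> x) 1)"
    unfolding S_mult inv S_left lin_scale[OF lin_S car] S_one ..
  finally show "sum2 (\<lambda>a b. inv S b * a) (\<Delta> x) = vscale H (\<epsilon> x) 1" using inv by metis
qed

end

section \<open>Group-like elements of a braided Hopf algebra\<close>

context coideal_setting
begin

lemma yd_of_simps [simp]: "tlift X (yd_of A) B = tlift X A B" "tlift (yd_of A) Y B' = tlift A Y B'"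
  "tens X (yd_of A) = tens X A" "tens (yd_of A) Y = tens A Y"
  by (simp_all add: fun_eq_iff tlift_def tens_def yd_of_def sub_def)

lemma vcar_yd_of [simp]: "vcar (yd_of A) = UNIV" using A_car by (simp add: yd_of_def)

lemma A_scale_mult: "vscale A c x * y = vscale A c (x * y)" "x * vscale A c y = vscale A c (x * y)"
  using lin_scale[OF bilinD2[OF bilin_mult[OF A_algebra] A_car(1)] A_car(1)]
    lin_scale[OF bilinD1[OF bilin_mult[OF A_algebra] A_car(1)] A_car(1)] by auto

lemma counit_act: "counit A (act A h y) = counit H h * counit A y"
  using hopf_A by (simp add: braided_hopf_algebra_def yd_hom_def yd_unit_def) (simp add: yd_of_def)

lemma counit_mult: "counit A (x * y) = counit A x * counit A y"
  using hopf_A by (simp add: braided_hopf_algebra_def)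

lemma comult_act: "comult A (act A h y) =
    tlift H H (\<lambda>h1 h2. tlift A A (\<lambda>y1 y2. tens A A (act A h1 y1) (act A h2 y2)) (comult A y)) (comult H h)"
  using hopf_A by (simp add: braided_hopf_algebra_def yd_hom_def yd_tensor_def diag_act_def tmap_def)
    (simp add: yd_of_def)

lemma grouplikeD: "g \<in> grouplikes A \<Longrightarrow> comult A g = tens A A g g" "g \<in> grouplikes A \<Longrightarrow> counit A g = 1"
  by (simp_all add: grouplikes_def)

text \<open>Stability of the line gives coaction \<open>h \<otimes> g\<close> for some
  \<open>h\<close>. The counit is colinear and equals \<open>1\<close> on \<open>g\<close>, which
  forces \<open>h = 1\<close>.\<close>

lemma coact_grouplike:
  assumes g: "g \<in> grouplikes A" and s: "subcomodule H A (coact A) (module.span (vscale A) {g})"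
  shows "coact A g = tens H A 1 g"
proof -
  interpret V: vector_space "vscale A" using A_vs by (simp add: is_vspace_def)
  have "coact A g \<in> vcar (H \<otimes> sub A (V.span {g}))"
    using s V.span_base[of g "{g}"] by (simp add: subcomodule_def)
  from tensor_span_singleton[OF H_vs A_vs A_car(1) this] obtain h where h: "coact A g = tens H A h g" by blast
  have "tens H base 1 (counit A g) = tlift H A (\<lambda>h a. tens H base h (counit A a)) (coact A g)"
    using hopf_A by (simp add: braided_hopf_algebra_def yd_hom_def yd_unit_def colinear_def tmap_def)
      (simp add: yd_of_def tens_def base_def sub_def)
  also have "\<dots> = tens H base h (counit A g)"
    unfolding h by (rule tlift_tens[OF H_vs A_vs is_vspace_tensor[of H base]])
      (intro base_rules H_car lin_comp[OF lin_counit_A]; simp)+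
  finally have "tens H base 1 1 = tens H base h 1" using grouplikeD[OF g] by simp
  then have "rslice H base (\<lambda>x. x) (tens H base 1 1) = rslice H base (\<lambda>x. x) (tens H base h 1)" by simp
  then have "h = 1"
    using rslice_tens[OF H_vs is_vspace_base lin_id H_car(1)] by (simp add: vs_simps[OF H_vs])
  then show ?thesis using h by simp
qed

text \<open>In the braided product of \<open>g \<otimes> g\<close> with \<open>\<Delta> y\<close>,
  the second \<open>g\<close> acts through its coaction on the first factor of
  \<open>\<Delta> y\<close>; trivial coaction makes this the identity.\<close>

lemma comult_grouplike_mult:
  assumes g: "g \<in> grouplikes A" and c: "coact A g = tens H A 1 g"
  shows "comult A (g * y) = tlift A A (\<lambda>y1 y2. tens A A (g * y1) (g * y2)) (comult A y)"
proof -
  have b1: "bilin H A (A \<otimes> A) (\<lambda>x b0. tens A A (a * act A x a') (b0 * b'))" for a a' b' by (intro base_rules)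
  have b2: "bilin A A (A \<otimes> A) (\<lambda>a b. tlift A A (\<lambda>a' b'.
       tlift H A (\<lambda>x b0. tens A A (a * act A x a') (b0 * b')) (coact A b)) (comult A y))" by (intro base_rules)
  have "comult A (g * y) = tlift A A (\<lambda>a b. tlift A A (\<lambda>a' b'.
       tlift H A (\<lambda>x b0. tens A A (a * act A x a') (b0 * b')) (coact A b)) (comult A y)) (tens A A g g)"
    using hopf_A grouplikeD[OF g] by (simp add: braided_hopf_algebra_def braided_tmult_def)
  also have "\<dots> = tlift A A (\<lambda>a' b'. tlift H A (\<lambda>x b0. tens A A (g * act A x a') (b0 * b')) (tens H A 1 g)) (comult A y)"
    unfolding tlift_tens[OF A_vs A_vs is_vspace_tensor b2 A_car(1) A_car(1)] c ..
  also have "\<dots> = tlift A A (\<lambda>a' b'. tens A A (g * a') (g * b')) (comult A y)"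
    by (simp add: tlift_tens[OF H_vs A_vs is_vspace_tensor b1 H_car(1) A_car(1)] act_one)
  finally show ?thesis .
qed

lemma grouplike_mult:
  assumes g: "g \<in> grouplikes A" and c: "coact A g = tens H A 1 g" and g': "g' \<in> grouplikes A"
  shows "g * g' \<in> grouplikes A"
proof -
  have "bilin A A (A \<otimes> A) (\<lambda>y1 y2. tens A A (g * y1) (g * y2))" by (intro base_rules)
  then have "comult A (g * g') = tens A A (g * g') (g * g')"
    using comult_grouplike_mult[OF g c, of g'] grouplikeD[OF g']
      tlift_tens[OF A_vs A_vs is_vspace_tensor _ A_car(1) A_car(1)] by simp
  then show ?thesis using grouplikeD(2)[OF g] grouplikeD(2)[OF g'] A_car
    by (simp add: grouplikes_def counit_mult)
qed

lemma grouplike_antipode: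
  assumes g: "g \<in> grouplikes A"
  shows "antipode A g * g = 1" "g * antipode A g = 1"
proof -
  have ax: "antipode_axiom A" using hopf_A by (simp add: braided_hopf_algebra_def)
  then have l: "lin A A (antipode A)" by (simp add: antipode_axiom_def)
  have "bilin A A A (\<lambda>y z. antipode A y * z)" "bilin A A A (\<lambda>y z. y * antipode A z)"
    by (intro base_rules lin_comp[OF l])+
  then show "antipode A g * g = 1" "g * antipode A g = 1"
    using ax grouplikeD[OF g] tlift_tens[OF A_vs A_vs A_vs _ A_car(1) A_car(1)]
    unfolding antipode_axiom_def by (metis vs_simps(4)[OF A_vs])+
qed

text \<open>For \<open>u = antipode A g\<close>, multiplying both factors of
  \<open>\<Delta>(g u) = 1 \<otimes> 1\<close> by \<open>u\<close> cancels the two \<open>g\<close>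
  on one side and gives \<open>u \<otimes> u\<close> on the other.\<close>

lemma grouplike_inverse:
  assumes g: "g \<in> grouplikes A" and c: "coact A g = tens H A 1 g"
  shows "antipode A g \<in> grouplikes A"
proof -
  let ?u = "antipode A g"
  note inv = grouplike_antipode[OF g]
  have b: "bilin A A (A \<otimes> A) (\<lambda>y1 y2. tens A A (a * y1) (a * y2))" for a by (intro base_rules)
  note \<Delta>_in = lin_in[OF lin_comult_A A_car(1)]
  let ?F = "tlift A A (\<lambda>y1 y2. tens A A (?u * y1) (?u * y2))"
  have F: "lin (A \<otimes> A) (A \<otimes> A) ?F" by (rule lin_tlift[OF A_vs A_vs is_vspace_tensor b])
  have one: "comult A 1 = tens A A 1 1" "counit A 1 = 1" using hopf_A by (simp_all add: braided_hopf_algebra_def)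
  have "tens A A ?u ?u = ?F (comult A (g * ?u))"
    using tlift_tens[OF A_vs A_vs is_vspace_tensor b A_car(1) A_car(1), of ?u 1 1] by (simp add: inv one)
  also have "\<dots> = tlift A A (\<lambda>y1 y2. ?F (tens A A (g * y1) (g * y2))) (comult A ?u)"
    unfolding comult_grouplike_mult[OF g c]
    by (rule lin_tlift_comp[OF A_vs A_vs is_vspace_tensor is_vspace_tensor b F \<Delta>_in])
  also have "\<dots> = tlift A A (tens A A) (comult A ?u)"
    by (simp add: tlift_tens[OF A_vs A_vs is_vspace_tensor b A_car(1) A_car(1)] mult.assoc[symmetric] inv)
  also have "\<dots> = comult A ?u" by (rule tlift_tens_id[OF A_vs A_vs \<Delta>_in])
  finally have "comult A ?u = tens A A ?u ?u" ..
  moreover have "counit A ?u = 1" using counit_mult[of g ?u] inv one grouplikeD[OF g] by simp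
  ultimately show ?thesis using A_car by (simp add: grouplikes_def)
qed

lemma ring_inverse_grouplike:
  assumes g: "g \<in> grouplikes A"
  shows "g * ring_inverse g = 1"
proof -
  have "ring_inverse g = antipode A g"
    unfolding ring_inverse_def
  proof (rule the_equality)
    fix y assume y: "g * y = 1 \<and> y * g = 1"
    have "y = antipode A g * g * y" using grouplike_antipode[OF g] by simp
    then show "y = antipode A g" using y by (simp add: mult.assoc)
  qed (use grouplike_antipode[OF g] in simp)
  then show ?thesis using grouplike_antipode[OF g] by simp
qed

end

section \<open>Coinvariants of a grouplike element\<close>

lemma lin_tscale1: "lin X base f \<Longrightarrow> w \<in> vcar (V \<otimes> W) \<Longrightarrow> lin X (V \<otimes> W) (\<lambda>x. tscale (f x) w)"
  by (rule lin_scale1[where U = "V \<otimes> W", unfolded vscale_tensor, OF _ is_vspace_tensor])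

lemma lin_tscale2: "lin X (V \<otimes> W) f \<Longrightarrow> lin X (V \<otimes> W) (\<lambda>x. tscale c (f x))"
  by (rule lin_scale2[where U = "V \<otimes> W", unfolded vscale_tensor, OF _ is_vspace_tensor])

lemma tscale_in: "w \<in> vcar (V \<otimes> W) \<Longrightarrow> tscale c w \<in> vcar (V \<otimes> W)"
  using vs_scale[OF is_vspace_tensor, of w V W c] by simp

lemma tens_in_sub: "v \<in> N \<Longrightarrow> w \<in> M \<Longrightarrow> tens V W v w \<in> vcar (sub V N \<otimes> sub W M)"
  using tens_in[of v "sub V N" w "sub W M"] by simp

context module_data
begin

lemma ext_induct [consumes 2, case_names zero step]:
  assumes N: "is_subspace V N" and t: "t \<in> ext N" and 0: "P 0"
    and step: "\<And>v x t. v \<in> N \<Longrightarrow> x \<in> K \<Longrightarrow> t \<in> ext N \<Longrightarrow> P t \<Longrightarrow> P (tens V A v x + t)"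
  shows "P t"
proof -
  obtain ps where ps: "set ps \<subseteq> N \<times> K" "t = (\<Sum>(v, x) \<leftarrow> ps. tens V A v x)"
    using ext_rep[OF N t] by blast
  have "(\<Sum>(v, x) \<leftarrow> ps. tens V A v x) \<in> ext N \<and> P (\<Sum>(v, x) \<leftarrow> ps. tens V A v x)" using ps(1)
  proof (induction ps)
    case Nil
    show ?case by (simp only: list.map sum_list.Nil ext_zero 0)
  next
    case (Cons a ps)
    obtain v x where a: "a = (v, x)" by force
    have ps: "set ps \<subseteq> N \<times> K" and vx: "v \<in> N" "x \<in> K" using Cons.prems by (auto simp: a)
    show ?case
      unfolding a list.map sum_list.Cons prod.case
      using step[OF vx] ext_add[OF ext_tens[OF vx]] Cons.IH[OF ps] by blast
  qed
  then show ?thesis using ps(2) by simp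
qed

end

section \<open>A coaction of the braided Hopf algebra attached to a group-like element\<close>

locale hopf_mod_grouplike = hopf_mod H A K V
  for H :: "('k::field, 'h::ring_1) hopf" and A :: "('k, 'h, 'a::ring_1) bhopf" and K
    and V :: "('k, 'h, 'a, 'v::ab_group_add) hopfmod" +
  fixes g
  assumes g: "g \<in> grouplikes A" and coact_g: "coact A g = tens H A 1 g"
begin

lemmas rules = base_rules is_vspace_base V_rules lin_tscale1 lin_tscale2 tscale_in

lemmas \<Delta>_in = lin_in[OF lin_comult_A A_car(1)]
lemmas \<Delta>H_in = lin_in[OF lin_comult_H H_car(1)]

text \<open>The coaction \<open>v \<otimes> x \<mapsto> g (v_(-1) \<cdot> x_(1)) \<otimes> (v_(0) \<otimes> x_(2))\<close>, which for
  \<open>g\<close>-coinvariant \<open>v\<close> is carried to the coaction of \<open>V\<close> by the action.\<close>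
definition rho :: "('k, 'v, 'a) tensor \<Rightarrow> ('k, 'a, ('k, 'v, 'a) tensor) tensor" where
  "rho = tlift V A (\<lambda>v x. tlift A A (\<lambda>x1 x2.
     tlift H V (\<lambda>h v0. tens A (V \<otimes> A) (g * act A h x1) (tens V A v0 x2)) (hco V v)) (comult A x))"

definition rho_cop :: "('a \<Rightarrow> 'k) \<Rightarrow> 'v \<Rightarrow> 'a \<Rightarrow> ('k, 'v, 'a) tensor" where
  "rho_cop f v x = tlift A A (\<lambda>x1 x2.
     tlift H V (\<lambda>h v0. tscale (f (g * act A h x1)) (tens V A v0 x2)) (hco V v)) (comult A x)"

lemma bilin_rho1: "bilin H V (A \<otimes> (V \<otimes> A)) (\<lambda>h v0. tens A (V \<otimes> A) (g * act A h x1) (tens V A v0 x2))"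
  by (intro rules)

lemma bilin_rho2: "v \<in> vcar V \<Longrightarrow> bilin A A (A \<otimes> (V \<otimes> A)) (\<lambda>x1 x2.
     tlift H V (\<lambda>h v0. tens A (V \<otimes> A) (g * act A h x1) (tens V A v0 x2)) (hco V v))"
  by (intro rules)

lemma bilin_rho3: "bilin V A (A \<otimes> (V \<otimes> A)) (\<lambda>v x. tlift A A (\<lambda>x1 x2.
     tlift H V (\<lambda>h v0. tens A (V \<otimes> A) (g * act A h x1) (tens V A v0 x2)) (hco V v)) (comult A x))"
  by (intro rules)

lemma lin_rho: "lin (V \<otimes> A) (A \<otimes> (V \<otimes> A)) rho"
  unfolding rho_def by (rule lin_tlift[OF V_vs A_vs is_vspace_tensor bilin_rho3])

abbreviation "C \<equiv> cop A (V \<otimes> A) rho"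

lemma lin_C: "lin A base f \<Longrightarrow> lin (V \<otimes> A) (V \<otimes> A) (C f)"
  by (rule lin_cop[OF A_vs is_vspace_tensor lin_comult_A lin_rho])

lemma C_tens:
  assumes f: "lin A base f" and v: "v \<in> vcar V"
  shows "C f (tens V A v x) = rho_cop f v x"
proof -
  let ?F = "lslice A (V \<otimes> A) f"
  have F: "lin (A \<otimes> (V \<otimes> A)) (V \<otimes> A) ?F" by (rule lin_lslice[OF A_vs is_vspace_tensor f])
  have "C f (tens V A v x) = tlift A A (\<lambda>x1 x2.
     ?F (tlift H V (\<lambda>h v0. tens A (V \<otimes> A) (g * act A h x1) (tens V A v0 x2)) (hco V v))) (comult A x)"
    unfolding cop_def rho_def tlift_tens[OF V_vs A_vs is_vspace_tensor bilin_rho3 v A_car(1)]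
    by (rule lin_tlift_comp[OF A_vs A_vs is_vspace_tensor is_vspace_tensor bilin_rho2[OF v] F \<Delta>_in])
  also have "\<dots> = tlift A A (\<lambda>x1 x2.
     tlift H V (\<lambda>h v0. ?F (tens A (V \<otimes> A) (g * act A h x1) (tens V A v0 x2))) (hco V v)) (comult A x)"
    by (rule tlift_cong[OF refl refl _ refl])
      (rule lin_tlift_comp[OF H_vs V_vs is_vspace_tensor is_vspace_tensor bilin_rho1 F lin_in[OF lin_hco v]])
  also have "\<dots> = rho_cop f v x"
    unfolding rho_cop_def by (simp add: lslice_tens[OF A_vs is_vspace_tensor f A_car(1)] tens_in A_car(1))
  finally show ?thesis .
qed

text \<open>The counit is multiplicative, \<open>H\<close>-linear and \<open>1\<close> on
  \<open>g\<close>, so the form splits into the counits of \<open>H\<close> and \<open>A\<close>;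
  the counit laws for \<open>v\<close> and for \<open>x\<close> finish.\<close>

lemma rho_cop_counit:
  assumes v: "v \<in> vcar V"
  shows "rho_cop (counit A) v x = tens V A v x"
proof -
  have "rho_cop (counit A) v x = tlift A A (\<lambda>x1 x2. tens V A v (vscale A (counit A x1) x2)) (comult A x)"
    unfolding rho_cop_def
  proof (rule tlift_cong[OF refl refl _ refl])
    fix x1 x2
    let ?F = "\<lambda>w. tens V A w (vscale A (counit A x1) x2)"
    have F: "lin V (V \<otimes> A) ?F" by (intro rules)
    have "tlift H V (\<lambda>h v0. tscale (counit A (g * act A h x1)) (tens V A v0 x2)) (hco V v) =
      tlift H V (\<lambda>h v0. ?F (vscale V (counit H h) v0)) (hco V v)"
      unfolding tens_scale1 tens_scale2 counit_mult counit_act grouplikeD(2)[OF g]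
      by (simp add: vs_simps(3)[OF is_vspace_tensor, simplified] mult.commute)
    also have "\<dots> = ?F (tlift H V (\<lambda>h v0. vscale V (counit H h) v0) (hco V v))"
      by (rule lin_tlift_comp[OF H_vs V_vs V_vs is_vspace_tensor _ F lin_in[OF lin_hco v], symmetric])
        (rule bilin_lslice[OF H_vs V_vs lin_counit_H])
    also have "tlift H V (\<lambda>h v0. vscale V (counit H h) v0) (hco V v) = v"
      using H_com v by (simp add: comodule_def)
    finally show "tlift H V (\<lambda>h v0. tscale (counit A (g * act A h x1)) (tens V A v0 x2)) (hco V v) = ?F v" .
  qed
  also have "\<dots> = tens V A v (tlift A A (\<lambda>x1 x2. vscale A (counit A x1) x2) (comult A x))"
    by (rule lin_tlift_comp[OF A_vs A_vs A_vs is_vspace_tensor[of V A] _ _ \<Delta>_in, symmetric])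
      (rule bilin_lslice[OF A_vs A_vs lin_counit_A], intro rules v)
  also have "tlift A A (\<lambda>x1 x2. vscale A (counit A x1) x2) (comult A x) = x"
    using A_coalgebra A_car by (simp add: coalgebra_def)
  finally show ?thesis .
qed

context
  fixes f f' v assumes f: "lin A base f" and f': "lin A base f'" and v: "v \<in> vcar V"
begin

lemmas frules = rules lin_comp[OF f] lin_comp[OF f'] v

text \<open>The common summand of both sides of the comodule identity: \<open>h\<close>,
  \<open>h'\<close>, \<open>v0\<close> come from \<open>v\<close>, and \<open>a\<close>,
  \<open>b\<close>, \<open>z\<close> from \<open>x\<close>. \<open>triple\<close> sums over the
  parts of \<open>v\<close>, leaving those of \<open>x\<close>.\<close>

definition "term3 h a h' b v0 z = tscale (f' (g * act A h a) * f (g * act A h' b)) (tens V A v0 z)"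

definition "triple a b z = tlift H V (\<lambda>k v0. tlift H H (\<lambda>h h'. term3 h a h' b v0 z) (comult H k)) (hco V v)"

text \<open>Iterating the operator coacts twice on \<open>v\<close>; coassociativity over
  \<open>H\<close> turns the second coaction into a coproduct in \<open>H\<close>, as
  \<open>triple\<close> expects.\<close>

lemma C_rho_cop: "C f (rho_cop f' v x) = tlift A A (\<lambda>x1 x2. tlift A A (triple x1) (comult A x2)) (comult A x)"
proof -
  let ?t = "\<lambda>x1 x2 h v0. tscale (f' (g * act A h x1)) (tens V A v0 x2)"
  have b1: "bilin H V (V \<otimes> A) (?t x1 x2)" for x1 x2
    by (intro frules)
  have b2: "bilin A A (V \<otimes> A) (\<lambda>x1 x2. tlift H V (?t x1 x2) (hco V v))"
    by (intro frules)
  have "C f (rho_cop f' v x) = tlift A A (\<lambda>x1 x2.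
     C f (tlift H V (?t x1 x2) (hco V v))) (comult A x)"
    unfolding rho_cop_def[of f']
    by (rule lin_tlift_comp[OF A_vs A_vs is_vspace_tensor is_vspace_tensor b2 lin_C[OF f] \<Delta>_in])
  also have "\<dots> = tlift A A (\<lambda>x1 x2. tlift A A (triple x1) (comult A x2)) (comult A x)"
  proof (rule tlift_cong[OF refl refl _ refl])
    fix x1 x2
    have "C f (tlift H V (?t x1 x2) (hco V v)) =
      tlift H V (\<lambda>h v0. C f (tscale (f' (g * act A h x1)) (tens V A v0 x2))) (hco V v)"
      by (rule lin_tlift_comp[OF H_vs V_vs is_vspace_tensor is_vspace_tensor b1 lin_C[OF f] lin_in[OF lin_hco v]])
    also have "\<dots> = tlift H V (\<lambda>h v0. tlift A A (\<lambda>b z. tlift H V (\<lambda>h' v00. term3 h x1 h' b v00 z) (hco V v0)) (comult A x2)) (hco V v)"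
    proof (rule tlift_cong[OF refl refl _ refl])
      fix h v0 assume v0: "v0 \<in> vcar V"
      let ?c = "f' (g * act A h x1)"
      have sc: "lin (V \<otimes> A) (V \<otimes> A) (tscale ?c)" by (intro lin_tscale2 lin_id)
      have "C f (tscale ?c (tens V A v0 x2)) = tscale ?c (rho_cop f v0 x2)"
        using lin_scale[OF lin_C[OF f] tens_in[OF v0 A_car(1)]] C_tens[OF f v0] by simp
      also have "\<dots> = tlift A A (\<lambda>b z. tscale ?c (tlift H V (\<lambda>h' v00. tscale (f (g * act A h' b)) (tens V A v00 z)) (hco V v0))) (comult A x2)"
        unfolding rho_cop_def
        by (rule lin_tlift_comp[OF A_vs A_vs is_vspace_tensor is_vspace_tensor _ sc \<Delta>_in]) (intro frules v0)
      also have "\<dots> = tlift A A (\<lambda>b z. tlift H V (\<lambda>h' v00. tscale ?c (tscale (f (g * act A h' b)) (tens V A v00 z))) (hco V v0)) (comult A x2)"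
        by (rule tlift_cong[OF refl refl _ refl])
          (rule lin_tlift_comp[OF H_vs V_vs is_vspace_tensor is_vspace_tensor _ sc lin_in[OF lin_hco v0]], intro frules)
      also have "\<dots> = tlift A A (\<lambda>b z. tlift H V (\<lambda>h' v00. term3 h x1 h' b v00 z) (hco V v0)) (comult A x2)"
        by (simp only: term3_def vs_simps(3)[OF is_vspace_tensor, unfolded vscale_tensor])
      finally show "C f (tscale ?c (tens V A v0 x2)) = \<dots>" .
    qed
    also have "\<dots> = tlift A A (\<lambda>b z. tlift H V (\<lambda>h v0. tlift H V (\<lambda>h' v00. term3 h x1 h' b v00 z) (hco V v0)) (hco V v)) (comult A x2)"
      unfolding term3_def
      by (rule tlift_swap[OF H_vs V_vs A_vs A_vs is_vspace_tensor[of V A] _ _ lin_in[OF lin_hco v] \<Delta>_in]) (intro frules | assumption)+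
    also have "\<dots> = tlift A A (triple x1) (comult A x2)"
    proof (rule tlift_cong[OF refl refl _ refl])
      fix b z
      show "tlift H V (\<lambda>h v0. tlift H V (\<lambda>h' v00. term3 h x1 h' b v00 z) (hco V v0)) (hco V v) = triple x1 b z"
        unfolding triple_def term3_def
        by (rule comodule_coassoc[OF H_vs V_vs is_vspace_tensor[of V A] lin_comult_H lin_hco _ _ H_com v])
          (intro frules | assumption)+
    qed
    finally show "C f (tlift H V (?t x1 x2) (hco V v)) =
      tlift A A (triple x1) (comult A x2)" .
  qed
  finally show ?thesis .
qed

text \<open>The coproduct of \<open>g (k \<cdot> y)\<close> splits because left multiplication by
  \<open>g\<close> and the action of \<open>H\<close> are both compatible with coproducts.\<close>

lemma conv_act:
  "conv A f' f (g * act A k y) = tlift H H (\<lambda>h h'. tlift A A (\<lambda>a b. f' (g * act A h a) * f (g * act A h' b)) (comult A y)) (comult H k)"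
proof -
  let ?F = "tlift A A (\<lambda>p q. f' p * f q)" and ?G = "tlift A A (\<lambda>p q. f' (g * p) * f (g * q))"
  have bF: "bilin A A base (\<lambda>p q. f' p * f q)" by (intro frules f f')
  have bG: "bilin A A base (\<lambda>p q. f' (g * p) * f (g * q))" by (intro frules)
  have F: "lin (A \<otimes> A) base ?F" and G: "lin (A \<otimes> A) base ?G" by (intro lin_tlift A_vs is_vspace_base bF bG)+
  have b1: "bilin A A (A \<otimes> A) (\<lambda>y1 y2. tens A A (g * y1) (g * y2))" by (intro frules)
  have b2: "bilin A A (A \<otimes> A) (\<lambda>y1 y2. tens A A (act A h y1) (act A h' y2))" for h h' by (intro frules)
  have b3: "bilin H H (A \<otimes> A) (\<lambda>h1 h2. tlift A A (\<lambda>y1 y2. tens A A (act A h1 y1) (act A h2 y2)) (comult A y))"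
    by (intro frules)
  have "conv A f' f (g * act A k y) = tlift A A (\<lambda>y1 y2. ?F (tens A A (g * y1) (g * y2))) (comult A (act A k y))"
    unfolding conv_def comult_grouplike_mult[OF g coact_g]
    by (rule lin_tlift_comp[OF A_vs A_vs is_vspace_tensor is_vspace_base b1 F \<Delta>_in])
  also have "\<dots> = ?G (comult A (act A k y))"
    by (simp add: tlift_tens[OF A_vs A_vs is_vspace_base bF A_car(1) A_car(1)])
  also have "\<dots> = tlift H H (\<lambda>h1 h2. ?G (tlift A A (\<lambda>y1 y2. tens A A (act A h1 y1) (act A h2 y2)) (comult A y))) (comult H k)"
    unfolding comult_act
    by (rule lin_tlift_comp[OF H_vs H_vs is_vspace_tensor is_vspace_base b3 G \<Delta>H_in])
  also have "\<dots> = tlift H H (\<lambda>h1 h2. tlift A A (\<lambda>y1 y2. ?G (tens A A (act A h1 y1) (act A h2 y2))) (comult A y)) (comult H k)"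
    by (rule tlift_cong[OF refl refl _ refl])
      (rule lin_tlift_comp[OF A_vs A_vs is_vspace_tensor is_vspace_base b2 G \<Delta>_in])
  also have "\<dots> = tlift H H (\<lambda>h h'. tlift A A (\<lambda>a b. f' (g * act A h a) * f (g * act A h' b)) (comult A y)) (comult H k)"
    by (simp add: tlift_tens[OF A_vs A_vs is_vspace_base bG A_car(1) A_car(1)])
  finally show ?thesis .
qed

lemma rho_cop_conv:
  "rho_cop (conv A f' f) v x = tlift A A (\<lambda>y z. tlift A A (\<lambda>a b. triple a b z) (comult A y)) (comult A x)"
  unfolding rho_cop_def
proof (rule tlift_cong[OF refl refl _ refl])
  fix y z
  have "tlift H V (\<lambda>k v0. tscale (conv A f' f (g * act A k y)) (tens V A v0 z)) (hco V v) =
    tlift H V (\<lambda>k v0. tlift A A (\<lambda>a b. tlift H H (\<lambda>h h'. term3 h a h' b v0 z) (comult H k)) (comult A y)) (hco V v)"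
  proof (rule tlift_cong[OF refl refl _ refl])
    fix k v0 assume v0: "v0 \<in> vcar V"
    let ?F = "\<lambda>c. tscale c (tens V A v0 z)"
    have F: "lin base (V \<otimes> A) ?F" by (intro frules v0)
    have "?F (conv A f' f (g * act A k y)) = tlift H H (\<lambda>h h'. ?F (tlift A A (\<lambda>a b. f' (g * act A h a) * f (g * act A h' b)) (comult A y))) (comult H k)"
      unfolding conv_act
      by (rule lin_tlift_comp[OF H_vs H_vs is_vspace_base is_vspace_tensor _ F \<Delta>H_in]) (intro frules)
    also have "\<dots> = tlift H H (\<lambda>h h'. tlift A A (\<lambda>a b. term3 h a h' b v0 z) (comult A y)) (comult H k)"
      unfolding term3_def
      by (rule tlift_cong[OF refl refl _ refl])
        (rule lin_tlift_comp[OF A_vs A_vs is_vspace_base is_vspace_tensor _ F \<Delta>_in], intro frules)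
    also have "\<dots> = tlift A A (\<lambda>a b. tlift H H (\<lambda>h h'. term3 h a h' b v0 z) (comult H k)) (comult A y)"
      unfolding term3_def
      by (rule tlift_swap[OF H_vs H_vs A_vs A_vs is_vspace_tensor[of V A] _ _ \<Delta>H_in \<Delta>_in]) (intro frules v0 | assumption)+
    finally show "?F (conv A f' f (g * act A k y)) = \<dots>" .
  qed
  also have "\<dots> = tlift A A (\<lambda>a b. triple a b z) (comult A y)"
    unfolding term3_def triple_def
    by (rule tlift_swap[OF H_vs V_vs A_vs A_vs is_vspace_tensor[of V A] _ _ lin_in[OF lin_hco v] \<Delta>_in]) (intro frules | assumption)+
  finally show "tlift H V (\<lambda>k v0. tscale (conv A f' f (g * act A k y)) (tens V A v0 z)) (hco V v) = \<dots>" .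
qed

text \<open>With the parts of \<open>v\<close> already matched in \<open>triple\<close>, what
  remains is coassociativity of \<open>A\<close> in \<open>x\<close>.\<close>

lemma C_C_tens: "C f (C f' (tens V A v x)) = C (conv A f' f) (tens V A v x)"
proof -
  have "lin A base (conv A f' f)"
    by (rule lin_conv[OF A_vs A_vs lin_comult_A lin_comult_A f' f])
  moreover have "tlift A A (\<lambda>x1 x2. tlift A A (triple x1) (comult A x2)) (comult A x) =
    tlift A A (\<lambda>y z. tlift A A (\<lambda>a b. triple a b z) (comult A y)) (comult A x)"
    unfolding triple_def term3_def
    by (rule comodule_coassoc[OF A_vs A_vs is_vspace_tensor[of V A] lin_comult_A
      lin_comult_A _ _ comodule_comult[OF A_coalgebra] A_car(1)]) (intro frules | assumption)+
  ultimately show ?thesis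
    by (simp add: C_tens[OF _ v] f' C_rho_cop rho_cop_conv)
qed

end

text \<open>Established on all of \<open>V \<otimes> A\<close>, where the right factor carries no
  membership condition; \<open>C_ext\<close> later shows that \<open>ext coinv\<close> is
  stable.\<close>

theorem comodule_rho: "comodule A (V \<otimes> A) rho"
  unfolding comodule_iff[OF A_vs is_vspace_tensor lin_comult_A lin_rho]
proof (intro ballI conjI allI impI)
  fix t assume t: "t \<in> vcar (V \<otimes> A)"
  note \<epsilon> = lin_counit_A
  show "C (counit A) t = t"
    by (rule lin_tensor_eqI[OF V_vs lin_C[OF \<epsilon>] lin_id _ t]) (simp add: C_tens[OF \<epsilon>] rho_cop_counit)
  fix f f' assume f: "lin A base f" and f': "lin A base f'"
  have c: "lin A base (conv A f' f)"
    by (rule lin_conv[OF A_vs A_vs lin_comult_A lin_comult_A f' f])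
  show "C f (C f' t) = C (conv A f' f) t"
    by (rule lin_tensor_eqI[OF V_vs lin_comp[OF lin_C[OF f] lin_C[OF f']] lin_C[OF c] _ t])
      (rule C_C_tens[OF f f'])
qed

end

section \<open>Coinvariants and the Hopf submodule they generate\<close>

context hopf_mod_grouplike
begin

definition coinv :: "'v set" where
  "coinv = {v \<in> vcar V. aco V v = tens A V g v}"

lemma coinv_V: "n \<in> coinv \<Longrightarrow> n \<in> vcar V" and aco_coinv: "n \<in> coinv \<Longrightarrow> aco V n = tens A V g n"
  by (simp_all add: coinv_def)

lemma coinv_subspace: "is_subspace V coinv"
proof (rule is_subspaceI[OF V_vs])
  show "coinv \<subseteq> vcar V" by (auto simp: coinv_def)
  have "tens A V g 0 = 0" using tens_add2[of A V g 0 0] by simp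
  then show "0 \<in> coinv" using lin_zero[OF V_vs lin_aco] vs_zero[OF V_vs] by (simp only: coinv_def mem_Collect_eq)
  show "x + y \<in> coinv" if "x \<in> coinv" "y \<in> coinv" for x y
    using that vs_add[OF V_vs] by (simp only: coinv_def mem_Collect_eq lin_add[OF lin_aco] tens_add2)
  show "vscale V c x \<in> coinv" if "x \<in> coinv" for c x
    using that vs_scale[OF V_vs] by (simp add: coinv_def lin_scale[OF lin_aco] tens_scale2)
qed

text \<open>The coaction of \<open>A\<close> is \<open>H\<close>-colinear. Since \<open>H\<close>
  coacts trivially on \<open>g\<close>, its diagonal operators on \<open>g \<otimes> n\<close> act
  on \<open>n\<close> alone.\<close>

lemma coinv_subcomodule: "subcomodule H V (hco V) coinv"
  unfolding stable_H
proof (intro conjI coinv_subspace allI impI ballI)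
  fix \<phi> n assume \<phi>: "lin H base \<phi>" and n: "n \<in> coinv"
  note nV = coinv_V[OF n]
  let ?T = "cop H V (hco V) \<phi>"
  have b: "bilin H A (A \<otimes> V) (\<lambda>x a. tlift H V (\<lambda>y w0. tscale (\<phi> (x * y)) (tens A V a w0)) (hco V n))"
    by (intro rules lin_comp[OF \<phi>] nV)
  have F: "lin V (A \<otimes> V) (tens A V g)" by (intro rules)
  have "aco V (?T n) = cop H (A \<otimes> V) (diag_coact H A (coact A) V (hco V)) \<phi> (tens A V g n)"
    using aco_cop_hco[OF \<phi> nV] by (simp add: aco_coinv[OF n])
  also have "\<dots> = tlift H A (\<lambda>x a. tlift H V (\<lambda>y w0. tscale (\<phi> (x * y)) (tens A V a w0)) (hco V n)) (coact A g)"
    using diag_cop_tens[OF H_algebra A_vs V_vs lin_coact lin_hco lin_id is_vspace_tensor \<phi> A_car(1) nV, of g]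
    by simp
  also have "\<dots> = tlift H V (\<lambda>y w0. tscale (\<phi> (1 * y)) (tens A V g w0)) (hco V n)"
    unfolding coact_g by (rule tlift_tens[OF H_vs A_vs is_vspace_tensor b H_car(1) A_car(1)])
  also have "\<dots> = tlift H V (\<lambda>y w0. tens A V g (vscale V (\<phi> y) w0)) (hco V n)"
    by (simp add: tens_scale2)
  also have "\<dots> = tens A V g (?T n)"
    unfolding cop_def lslice_def
    by (rule lin_tlift_comp[OF H_vs V_vs V_vs is_vspace_tensor bilin_lslice[OF H_vs V_vs \<phi>] F lin_in[OF lin_hco nV], symmetric])
  finally show "?T n \<in> coinv"
    using lin_in[OF lin_cop_H[OF \<phi>] nV] by (simp add: coinv_def)
qed

lemma hco_coinv: "n \<in> coinv \<Longrightarrow> hco V n \<in> vcar (H \<otimes> sub V coinv)"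
  using coinv_subcomodule by (simp add: subcomodule_def)

lemma coinv_vs: "is_vspace (sub V coinv)" by (rule is_vspace_sub[OF V_vs coinv_subspace])

lemma lin_coinv_incl: "lin (sub V coinv) V (\<lambda>v. v)"
  using coinv_V by (simp add: lin_def)

lemma lin_act_map_ext: "lin (sub V coinv \<otimes> sub A K) V act_map"
  using lin_act_map ext_in[OF coinv_subspace] unfolding lin_def ext_def by simp

lemmas coinv_rules = lin_tens_sub1 lin_tens_sub2 tens_in_sub rules hco_coinv coinv_vs lin_coinv_incl

lemma rac_zero: "x \<in> K \<Longrightarrow> rac V 0 x = 0"
  using lin_zero[OF V_vs lin_rac1[OF lin_id]] .

lemma C_coinv:
  assumes f: "lin A base f" and n: "n \<in> coinv" and x: "x \<in> K"
  shows "C f (tens V A n x) \<in> ext coinv"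
    and "act_map (C f (tens V A n x)) = cop A V (aco V) f (rac V n x)"
proof -
  note nV = coinv_V[OF n] and fr = lin_comp[OF f]
  note hn = hco_coinv[OF n] and Dx = K_comult[OF x]
  let ?t = "\<lambda>x1 x2 h v0. tscale (f (g * act A h x1)) (tens V A v0 x2)"
  let ?r = "\<lambda>x1 x2 h v0. vscale V (f (g * act A h x1)) (rac V v0 x2)"
  let ?b = "\<lambda>x1 x2 h v0. tens A V (g * act A h x1) (rac V v0 x2)"
  let ?E = "tlift A (sub A K) (\<lambda>x1 x2. tlift H (sub V coinv) (?t x1 x2) (hco V n)) (comult A x)"
  let ?W = "sub V coinv \<otimes> sub A K"
  have b1: "bilin H V (V \<otimes> A) (?t x1 x2)" for x1 x2
    by (intro rules fr)
  have b2: "bilin A A (V \<otimes> A) (\<lambda>x1 x2. tlift H V (?t x1 x2) (hco V n))"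
    by (intro rules fr nV)
  have b3: "bilin H (sub V coinv) ?W (?t x1 x2)" if x2: "x2 \<in> K" for x1 x2
    by (intro coinv_rules fr x2; simp)
  have b4: "bilin A (sub A K) ?W (\<lambda>x1 x2. tlift H (sub V coinv) (?t x1 x2) (hco V n))"
    by (intro coinv_rules fr n; simp)
  \<comment> \<open>\<open>\<Delta> x\<close> lies in \<open>A \<otimes> K\<close> and the coaction
    of \<open>n\<close> stays over \<open>coinv\<close>, so both sums may be read over the smaller
    carriers.\<close>
  have eq: "C f (tens V A n x) = ?E"
  proof -
    have "rho_cop f n x = tlift A (sub A K) (\<lambda>x1 x2. tlift H V (?t x1 x2) (hco V n)) (comult A x)"
      unfolding rho_cop_def
      by (rule tlift_sub_eq2[OF A_vs A_vs is_vspace_tensor K_subspace b2 Dx, symmetric])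
    also have "\<dots> = ?E"
      by (rule tlift_cong[OF refl refl _ refl])
        (rule tlift_sub_eq2[OF H_vs V_vs is_vspace_tensor coinv_subspace b1 hn, symmetric])
    finally show ?thesis by (simp add: C_tens[OF f nV])
  qed
  show "C f (tens V A n x) \<in> ext coinv"
    unfolding eq ext_def by (rule tlift_in[OF b4 Dx A_vs K_vs is_vspace_tensor])
  let ?F = "lslice A V f"
  have F: "lin (A \<otimes> V) V ?F" by (rule lin_lslice[OF A_vs V_vs f])
  have b5: "bilin A (sub A K) (A \<otimes> V) (\<lambda>x1 x2. tlift H V (?b x1 x2) (hco V n))"
    by (intro rules nV; simp)
  have b6: "bilin H V V (?r x1 x2)" if x2: "x2 \<in> K" for x1 x2
    by (intro rules fr x2)
  have "act_map ?E = tlift A (sub A K) (\<lambda>x1 x2. act_map (tlift H (sub V coinv) (?t x1 x2) (hco V n))) (comult A x)"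
    by (rule lin_tlift_comp[OF A_vs K_vs is_vspace_tensor V_vs b4 lin_act_map_ext Dx])
  also have "\<dots> = tlift A (sub A K) (\<lambda>x1 x2. ?F (tlift H V (?b x1 x2) (hco V n))) (comult A x)"
  proof (rule tlift_cong[OF refl refl _ refl])
    fix x1 x2 assume "x2 \<in> vcar (sub A K)"
    then have x2: "x2 \<in> K" by simp
    have "act_map (tlift H (sub V coinv) (?t x1 x2) (hco V n)) =
        tlift H (sub V coinv) (\<lambda>h v0. act_map (tscale (f (g * act A h x1)) (tens V A v0 x2))) (hco V n)"
      by (rule lin_tlift_comp[OF H_vs coinv_vs is_vspace_tensor V_vs b3[OF x2] lin_act_map_ext hn])
    also have "\<dots> = tlift H (sub V coinv) (?r x1 x2) (hco V n)"
    proof (rule tlift_cong[OF refl refl _ refl])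
      fix h v0 assume "v0 \<in> vcar (sub V coinv)"
      then have v0: "v0 \<in> coinv" by simp
      show "act_map (tscale (f (g * act A h x1)) (tens V A v0 x2)) = vscale V (f (g * act A h x1)) (rac V v0 x2)"
        using lin_scale[OF lin_act_map_ext tens_in_sub[OF v0 x2]] act_map_tens[OF coinv_V[OF v0] x2] by simp
    qed
    also have "\<dots> = tlift H V (?r x1 x2) (hco V n)"
      by (rule tlift_sub_eq2[OF H_vs V_vs V_vs coinv_subspace b6[OF x2] hn])
    also have "\<dots> = tlift H V (\<lambda>h v0. ?F (tens A V (g * act A h x1) (rac V v0 x2))) (hco V n)"
      by (simp add: lslice_tens[OF A_vs V_vs f A_car(1)] rac_in x2)
    also have "\<dots> = ?F (tlift H V (?b x1 x2) (hco V n))"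
      by (rule lin_tlift_comp[OF H_vs V_vs is_vspace_tensor V_vs bilin_hb4[OF A_car(1) x2] F lin_in[OF lin_hco nV], symmetric])
    finally show "act_map (tlift H (sub V coinv) (?t x1 x2) (hco V n)) = \<dots>" .
  qed
  also have "\<dots> = ?F (half_braided_act H A K V (tens A V g n) x)"
    unfolding half_braided_act_tens[OF nV x]
    by (rule lin_tlift_comp[OF A_vs K_vs is_vspace_tensor V_vs b5 F Dx, symmetric])
  also have "\<dots> = cop A V (aco V) f (rac V n x)"
    unfolding cop_def aco_rac[OF nV x] aco_coinv[OF n] ..
  finally show "act_map (C f (tens V A n x)) = cop A V (aco V) f (rac V n x)" unfolding eq .
qed

lemma ext_VA: "t \<in> ext coinv \<Longrightarrow> t \<in> vcar (V \<otimes> A)"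
  using ext_in[OF coinv_subspace] tensor_mono2[of K A] A_car(2) by blast

lemma ext_VK: "t \<in> ext coinv \<Longrightarrow> t \<in> vcar (V \<otimes> sub A K)"
  by (rule ext_in[OF coinv_subspace])

lemma C_ext:
  assumes f: "lin A base f" and t: "t \<in> ext coinv"
  shows "C f t \<in> ext coinv \<and> act_map (C f t) = cop A V (aco V) f (act_map t)"
  using coinv_subspace t
proof (induction rule: ext_induct)
  case zero
  show ?case
    using lin_zero[OF is_vspace_tensor lin_C[OF f]] lin_zero[OF is_vspace_tensor lin_act_map] ext_zero
      lin_zero[OF V_vs lin_cop_A[OF f]] by metis
next
  case (step v x t)
  note e = ext_tens[OF step(1,2)]
  note l = lin_cop_A[OF f]
  note am = lin_add[OF lin_act_map]
  have 1: "C f (tens V A v x + t) = C f (tens V A v x) + C f t"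
    by (rule lin_add[OF lin_C[OF f] ext_VA[OF e] ext_VA[OF step(3)]])
  have 2: "act_map (tens V A v x + t) = act_map (tens V A v x) + act_map t"
    by (rule am[OF ext_VK[OF e] ext_VK[OF step(3)]])
  have 3: "act_map (C f (tens V A v x) + C f t) = act_map (C f (tens V A v x)) + act_map (C f t)"
    using step(4) C_coinv(1)[OF f step(1,2)] by (intro am ext_VK) blast+
  have 4: "act_map (tens V A v x) = rac V v x" by (rule act_map_tens[OF coinv_V[OF step(1)] step(2)])
  have 5: "cop A V (aco V) f (rac V v x + act_map t) = cop A V (aco V) f (rac V v x) + cop A V (aco V) f (act_map t)"
    by (rule lin_add[OF l rac_in[OF coinv_V[OF step(1)] step(2)] lin_in[OF lin_act_map ext_VK[OF step(3)]]])
  show ?case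
    unfolding 1 2 3 4 5 using step(4) C_coinv[OF f step(1,2)] by (simp only: ext_add)
qed

lemma image_subspace: "is_subspace V (act_map ` ext coinv)"
proof (rule is_subspaceI[OF V_vs])
  show "act_map ` ext coinv \<subseteq> vcar V" using lin_in[OF lin_act_map ext_VK] by blast
  show "0 \<in> act_map ` ext coinv"
    using imageI[OF ext_zero, of act_map] lin_zero[OF is_vspace_tensor lin_act_map] by metis
  show "y + z \<in> act_map ` ext coinv" if yz: "y \<in> act_map ` ext coinv" "z \<in> act_map ` ext coinv" for y z
  proof -
    obtain s t where st: "s \<in> ext coinv" "t \<in> ext coinv" "y = act_map s" "z = act_map t" using yz by blast
    have "y + z = act_map (s + t)"
      unfolding st(3,4) by (rule lin_add[OF lin_act_map ext_VK[OF st(1)] ext_VK[OF st(2)], symmetric])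
    then show ?thesis using ext_add[OF st(1,2)] by (rule image_eqI)
  qed
  show "vscale V c y \<in> act_map ` ext coinv" if y: "y \<in> act_map ` ext coinv" for c y
  proof -
    obtain s where s: "s \<in> ext coinv" "y = act_map s" using y by blast
    have "vscale V c (act_map s) = act_map (tscale c s)"
      using lin_scale[OF lin_act_map ext_VK[OF s(1)], of c] by simp
    then show ?thesis unfolding s(2) using ext_scale[OF s(1)] by (rule image_eqI)
  qed
qed

text \<open>The image is spanned by the products of coinvariants with \<open>K\<close>; this serves
  the operators of \<open>H\<close> as well as the action of \<open>K\<close>.\<close>

lemma image_induct:
  assumes F: "lin V V F" and step: "\<And>n x. n \<in> coinv \<Longrightarrow> x \<in> K \<Longrightarrow> F (rac V n x) \<in> act_map ` ext coinv"
    and t: "t \<in> ext coinv"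
  shows "F (act_map t) \<in> act_map ` ext coinv"
  using coinv_subspace t
proof (induction rule: ext_induct)
  case zero
  show ?case
    using lin_zero[OF is_vspace_tensor lin_act_map] lin_zero[OF V_vs F] is_subspaceD(2)[OF V_vs image_subspace] by metis
next
  case step': (step v x t)
  have "F (act_map (tens V A v x + t)) = F (rac V v x) + F (act_map t)"
    using lin_add[OF lin_act_map ext_VK[OF ext_tens[OF step'(1,2)]] ext_VK[OF step'(3)]]
      act_map_tens[OF coinv_V[OF step'(1)] step'(2)]
      lin_add[OF F rac_in[OF coinv_V[OF step'(1)] step'(2)] lin_in[OF lin_act_map ext_VK[OF step'(3)]]] by metis
  then show ?case using is_subspaceD(3)[OF V_vs image_subspace step[OF step'(1,2)] step'(4)] by metis
qed

lemma hopf_submodule_image: "hopf_submodule H A K V (act_map ` ext coinv)"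
  unfolding hopf_submodule_def
proof (intro conjI ballI)
  show "subcomodule A V (aco V) (act_map ` ext coinv)"
    unfolding stable_A
  proof (intro conjI image_subspace allI impI ballI)
    fix f v assume f: "lin A base f" and "v \<in> act_map ` ext coinv"
    then obtain t where t: "t \<in> ext coinv" "v = act_map t" by blast
    show "cop A V (aco V) f v \<in> act_map ` ext coinv" unfolding t(2) using C_ext[OF f t(1)] by (metis imageI)
  qed
  show "subcomodule H V (hco V) (act_map ` ext coinv)"
    unfolding stable_H
  proof (intro conjI image_subspace allI impI ballI)
    fix \<phi> v assume \<phi>: "lin H base \<phi>" and "v \<in> act_map ` ext coinv"
    then obtain t where t: "t \<in> ext coinv" "v = act_map t" by blast
    show "cop H V (hco V) \<phi> v \<in> act_map ` ext coinv" unfolding t(2)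
    proof (rule image_induct[OF lin_cop_H[OF \<phi>] _ t(1)])
      fix n x assume n: "n \<in> coinv" and x: "x \<in> K"
      let ?W = "sub V coinv \<otimes> sub A K"
      \<comment> \<open>The diagonal coaction on \<open>coinv \<otimes> K\<close> contracted with
        \<open>\<phi>\<close>; as the action is colinear, it supplies a preimage of the operator
        applied to \<open>n x\<close>.\<close>
      let ?B = "\<lambda>h v0. tlift H (sub A K) (\<lambda>y x0. tscale (\<phi> (h * y)) (tens V A v0 x0)) (coact A x)"
      let ?G = "\<lambda>h v0. tlift H (sub A K) (\<lambda>y x0. vscale V (\<phi> (h * y)) (rac V v0 x0)) (coact A x)"
      note cx = K_coact[OF x] and fr = lin_comp[OF \<phi>] and hn = hco_coinv[OF n]
      have b1: "bilin H (sub A K) ?W (\<lambda>y x0. tscale (\<phi> (h * y)) (tens V A v0 x0))" if v0: "v0 \<in> coinv" for h v0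
        by (intro coinv_rules fr v0; simp)
      have b2: "bilin H (sub V coinv) ?W ?B" by (intro coinv_rules fr cx; simp)
      have b3: "bilin H V V ?G" by (intro rules fr cx; simp)
      have "act_map (tlift H (sub V coinv) ?B (hco V n)) = tlift H (sub V coinv) (\<lambda>h v0. act_map (?B h v0)) (hco V n)"
        by (rule lin_tlift_comp[OF H_vs coinv_vs is_vspace_tensor V_vs b2 lin_act_map_ext hn])
      also have "\<dots> = tlift H (sub V coinv) ?G (hco V n)"
      proof (rule tlift_cong[OF refl refl _ refl])
        fix h v0 assume "v0 \<in> vcar (sub V coinv)"
        then have v0: "v0 \<in> coinv" by simp
        have "act_map (?B h v0) = tlift H (sub A K) (\<lambda>y x0. act_map (tscale (\<phi> (h * y)) (tens V A v0 x0))) (coact A x)"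
          by (rule lin_tlift_comp[OF H_vs K_vs is_vspace_tensor V_vs b1[OF v0] lin_act_map_ext cx])
        also have "\<dots> = ?G h v0"
        proof (rule tlift_cong[OF refl refl _ refl])
          fix y x0 assume "x0 \<in> vcar (sub A K)"
          then have x0: "x0 \<in> K" by simp
          show "act_map (tscale (\<phi> (h * y)) (tens V A v0 x0)) = vscale V (\<phi> (h * y)) (rac V v0 x0)"
            using lin_scale[OF lin_act_map_ext tens_in_sub[OF v0 x0]] act_map_tens[OF coinv_V[OF v0] x0] by simp
        qed
        finally show "act_map (?B h v0) = ?G h v0" .
      qed
      also have "\<dots> = tlift H V ?G (hco V n)"
        by (rule tlift_sub_eq2[OF H_vs V_vs V_vs coinv_subspace b3 hn])
      also have "\<dots> = cop H V (hco V) \<phi> (rac V n x)" by (rule rac_colinear[OF \<phi> coinv_V[OF n] x, symmetric])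
      finally have "cop H V (hco V) \<phi> (rac V n x) = act_map (tlift H (sub V coinv) ?B (hco V n))" ..
      moreover have "tlift H (sub V coinv) ?B (hco V n) \<in> ext coinv"
        unfolding ext_def by (rule tlift_in[OF b2 hn H_vs coinv_vs is_vspace_tensor])
      ultimately show "cop H V (hco V) \<phi> (rac V n x) \<in> act_map ` ext coinv" by (rule image_eqI)
    qed
  qed
  fix v y assume "v \<in> act_map ` ext coinv" and y: "y \<in> K"
  then obtain t where t: "t \<in> ext coinv" "v = act_map t" by blast
  show "rac V v y \<in> act_map ` ext coinv" unfolding t(2)
  proof (rule image_induct[OF lin_rac1[OF lin_id y] _ t(1)])
    fix n x assume n: "n \<in> coinv" and x: "x \<in> K"
    have "rac V (rac V n x) y = act_map (tens V A n (x * y))"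
      using rac_mult[OF coinv_V[OF n] x y] act_map_tens[OF coinv_V[OF n] K_mult[OF x y]] by simp
    then show "rac V (rac V n x) y \<in> act_map ` ext coinv"
      using ext_tens[OF n K_mult[OF x y]] by (rule image_eqI)
  qed
qed

text \<open>\<open>twist\<close> is the braiding followed by left multiplication by \<open>g\<close>; it is inverted by
  \<open>untwist\<close>, which is where bijectivity of the antipode of \<open>H\<close> enters.\<close>
definition twist :: "('k, 'v, 'a) tensor \<Rightarrow> ('k, 'a, 'v) tensor" where
  "twist = tlift V A (\<lambda>v x. tlift H V (\<lambda>h v0. tens A V (g * act A h x) v0) (hco V v))"

definition untwist :: "('k, 'a, 'v) tensor \<Rightarrow> ('k, 'v, 'a) tensor" where
  "untwist = tlift A V (\<lambda>a v. tlift H V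
     (\<lambda>h v0. tens V A v0 (act A (inv (antipode H) h) (antipode A g * a))) (hco V v))"

lemma bilin_twist: "bilin V A (A \<otimes> V) (\<lambda>v x. tlift H V (\<lambda>h v0. tens A V (g * act A h x) v0) (hco V v))"
  by (intro rules)

lemma lin_twist: "lin (V \<otimes> A) (A \<otimes> V) twist"
  unfolding twist_def by (rule lin_tlift[OF V_vs A_vs is_vspace_tensor bilin_twist])

lemma twist_tens: "v \<in> vcar V \<Longrightarrow> twist (tens V A v x) = tlift H V (\<lambda>h v0. tens A V (g * act A h x) v0) (hco V v)"
  unfolding twist_def by (rule tlift_tens[OF V_vs A_vs is_vspace_tensor bilin_twist _ A_car(1)])

text \<open>The counit on the last factor of \<open>rho\<close> collapses
  \<open>x_(1) \<otimes> x_(2)\<close> to \<open>x\<close>, and what is left of the coaction is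
  \<open>twist\<close>.\<close>

lemma lslice_twist:
  assumes f: "lin A base f" and t: "t \<in> vcar (V \<otimes> A)"
  shows "lslice A V f (twist t) = rslice V A (counit A) (C f t)"
proof -
  note \<epsilon> = lin_counit_A
  note \<eta> = lin_rslice[OF V_vs A_vs \<epsilon>] and F = lin_lslice[OF A_vs V_vs f] and fr = lin_comp[OF f]
  show ?thesis
  proof (rule lin_tensor_eqI[OF V_vs lin_comp[OF F lin_twist] lin_comp[OF \<eta> lin_C[OF f]] _ t])
    fix v x assume v: "v \<in> vcar V"
    let ?t = "\<lambda>x1 x2 h v0. tscale (f (g * act A h x1)) (tens V A v0 x2)"
    let ?Y = "\<lambda>z. tlift H V (\<lambda>h v0. vscale V (f (g * act A h z)) v0) (hco V v)"
    have Y: "lin A V ?Y" by (intro rules fr v)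
    have b1: "bilin H V (A \<otimes> V) (\<lambda>h v0. tens A V (g * act A h x) v0)" by (intro rules)
    have b2: "bilin A A (V \<otimes> A) (\<lambda>x1 x2. tlift H V (?t x1 x2) (hco V v))"
      by (intro rules fr v)
    have b3: "bilin H V (V \<otimes> A) (?t x1 x2)" for x1 x2
      by (intro rules fr)
    have "lslice A V f (twist (tens V A v x)) = tlift H V (\<lambda>h v0. lslice A V f (tens A V (g * act A h x) v0)) (hco V v)"
      unfolding twist_tens[OF v]
      by (rule lin_tlift_comp[OF H_vs V_vs is_vspace_tensor V_vs b1 F lin_in[OF lin_hco v]])
    also have "\<dots> = ?Y x" by (simp add: lslice_tens[OF A_vs V_vs f A_car(1)])
    finally have 1: "lslice A V f (twist (tens V A v x)) = ?Y x" .
    have "rslice V A (counit A) (C f (tens V A v x)) = tlift A A (\<lambda>x1 x2. rslice V A (counit A)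
        (tlift H V (?t x1 x2) (hco V v))) (comult A x)"
      unfolding C_tens[OF f v] rho_cop_def
      by (rule lin_tlift_comp[OF A_vs A_vs is_vspace_tensor V_vs b2 \<eta> \<Delta>_in])
    also have "\<dots> = tlift A A (\<lambda>x1 x2. ?Y (vscale A (counit A x2) x1)) (comult A x)"
    proof (rule tlift_cong[OF refl refl _ refl])
      fix x1 x2
      have "rslice V A (counit A) (tlift H V (?t x1 x2) (hco V v)) =
          tlift H V (\<lambda>h v0. rslice V A (counit A) (tscale (f (g * act A h x1)) (tens V A v0 x2))) (hco V v)"
        by (rule lin_tlift_comp[OF H_vs V_vs is_vspace_tensor V_vs b3 \<eta> lin_in[OF lin_hco v]])
      also have "\<dots> = ?Y (vscale A (counit A x2) x1)"
      proof (rule tlift_cong[OF refl refl _ refl])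
        fix h v0 assume v0: "v0 \<in> vcar V"
        have "rslice V A (counit A) (tscale (f (g * act A h x1)) (tens V A v0 x2)) =
            vscale V (f (g * act A h x1)) (vscale V (counit A x2) v0)"
          using lin_scale[OF \<eta> tens_in[OF v0 A_car(1), of x2]] rslice_tens[OF V_vs A_vs \<epsilon> v0 A_car(1)] by simp
        also have "\<dots> = vscale V (f (g * act A h (vscale A (counit A x2) x1))) v0"
          using lin_scale[OF bilinD1[OF act_bilin H_car(1)] A_car(1)] lin_scale[OF f A_car(1)]
          by (simp add: A_scale_mult vs_simps[OF V_vs] mult.commute)
        finally show "rslice V A (counit A) (tscale (f (g * act A h x1)) (tens V A v0 x2)) = \<dots>" .
      qed
      finally show "rslice V A (counit A) (tlift H V (?t x1 x2) (hco V v)) =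
          ?Y (vscale A (counit A x2) x1)" .
    qed
    also have "\<dots> = ?Y (tlift A A (\<lambda>x1 x2. vscale A (counit A x2) x1) (comult A x))"
      by (rule lin_tlift_comp[OF A_vs A_vs A_vs V_vs bilin_rslice[OF A_vs A_vs \<epsilon>] Y \<Delta>_in, symmetric])
    also have "tlift A A (\<lambda>x1 x2. vscale A (counit A x2) x1) (comult A x) = x"
      using A_coalgebra A_car by (simp add: coalgebra_def)
    finally show "lslice A V f (twist (tens V A v x)) = rslice V A (counit A) (C f (tens V A v x))" using 1 by simp
  qed
qed

section \<open>Inverting the twist, and injectivity of the action map\<close>

context
  assumes bij: "bij (antipode H)"
begin

interpretation HA: hopf_alg H by unfold_locales (rule hopf_H)

lemmas R = HA.inverse_antipode[OF bij]

lemma bilin_untwist: "bilin A V (V \<otimes> A) (\<lambda>a v. tlift H V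
     (\<lambda>h v0. tens V A v0 (act A (inv (antipode H) h) (antipode A g * a))) (hco V v))"
  by (intro rules lin_comp[OF R(1)])

lemma lin_untwist: "lin (A \<otimes> V) (V \<otimes> A) untwist"
  unfolding untwist_def by (rule lin_tlift[OF A_vs V_vs is_vspace_tensor bilin_untwist])

lemma untwist_tens: "v \<in> vcar V \<Longrightarrow> untwist (tens A V a v) = tlift H V
     (\<lambda>h v0. tens V A v0 (act A (inv (antipode H) h) (antipode A g * a))) (hco V v)"
  unfolding untwist_def by (rule tlift_tens[OF A_vs V_vs is_vspace_tensor bilin_untwist A_car(1)])

text \<open>\<open>antipode A g\<close> cancels \<open>g\<close>, and coassociativity brings the two
  actions of \<open>H\<close> together as \<open>inv (antipode H) h' * h\<close> over
  \<open>\<Delta> k = h \<otimes> h'\<close>, which contracts to the counit of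
  \<open>k\<close>.\<close>

lemma untwist_twist:
  assumes t: "t \<in> vcar (V \<otimes> A)"
  shows "untwist (twist t) = t"
proof (rule lin_tensor_eqI[OF V_vs lin_comp[OF lin_untwist lin_twist] lin_id _ t])
  fix v x assume v: "v \<in> vcar V"
  let ?R = "inv (antipode H)"
  have b1: "bilin H V (A \<otimes> V) (\<lambda>h v0. tens A V (g * act A h x) v0)" by (intro rules)
  have "untwist (twist (tens V A v x)) = tlift H V (\<lambda>h v0. untwist (tens A V (g * act A h x) v0)) (hco V v)"
    unfolding twist_tens[OF v]
    by (rule lin_tlift_comp[OF H_vs V_vs is_vspace_tensor is_vspace_tensor b1 lin_untwist lin_in[OF lin_hco v]])
  also have "\<dots> = tlift H V (\<lambda>h v0. tlift H V (\<lambda>h' v00. tens V A v00 (act A (?R h' * h) x)) (hco V v0)) (hco V v)"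
    by (simp add: untwist_tens mult.assoc[symmetric] grouplike_antipode[OF g] act_mult)
  also have "\<dots> = tlift H V (\<lambda>k v0. tlift H H (\<lambda>h h'. tens V A v0 (act A (?R h' * h) x)) (comult H k)) (hco V v)"
    by (rule comodule_coassoc[OF H_vs V_vs is_vspace_tensor[of V A] lin_comult_H lin_hco _ _ H_com v])
      (intro rules lin_comp[OF R(1)] | assumption)+
  also have "\<dots> = tlift H V (\<lambda>k v0. tens V A (vscale V (counit H k) v0) x) (hco V v)"
  proof (rule tlift_cong[OF refl refl _ refl])
    fix k v0 assume v0: "v0 \<in> vcar V"
    let ?F = "\<lambda>z. tens V A v0 (act A z x)"
    have F: "lin H (V \<otimes> A) ?F" by (intro rules v0)
    have b: "bilin H H H (\<lambda>h h'. ?R h' * h)" by (intro rules lin_comp[OF R(1)])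
    have "tlift H H (\<lambda>h h'. ?F (?R h' * h)) (comult H k) = ?F (tlift H H (\<lambda>h h'. ?R h' * h) (comult H k))"
      by (rule lin_tlift_comp[OF H_vs H_vs H_vs is_vspace_tensor b F \<Delta>H_in, symmetric])
    also have "\<dots> = tens V A (vscale V (counit H k) v0) x"
      unfolding R(2) lin_scale[OF F H_car(1)] by (simp add: act_one tens_scale1)
    finally show "tlift H H (\<lambda>h h'. ?F (?R h' * h)) (comult H k) = tens V A (vscale V (counit H k) v0) x" .
  qed
  also have "\<dots> = tens V A (tlift H V (\<lambda>k v0. vscale V (counit H k) v0) (hco V v)) x"
    by (rule lin_tlift_comp[OF H_vs V_vs V_vs is_vspace_tensor[of V A] _ _ lin_in[OF lin_hco v], symmetric])
      (rule bilin_lslice[OF H_vs V_vs lin_counit_H], intro rules)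
  also have "tlift H V (\<lambda>k v0. vscale V (counit H k) v0) (hco V v) = v"
    using H_com v by (simp add: comodule_def)
  finally show "untwist (twist (tens V A v x)) = tens V A v x" .
qed

lemma act_map_injective:
  assumes pt: "pointed A"
    and inv: "\<And>u. u \<in> grouplikes A \<Longrightarrow> u \<in> K \<Longrightarrow> ring_inverse u \<in> K"
    and stable: "\<And>u h. u \<in> grouplikes A \<Longrightarrow> act A h u \<in> module.span (vscale A) {u}"
  shows "inj_on act_map (ext coinv)"
  unfolding inj_on_act_map[OF coinv_subspace]
proof (rule ccontr)
  assume ker: "\<not> (\<forall>t \<in> ext coinv. act_map t = 0 \<longrightarrow> t = 0)"
  define Z where "Z = {t \<in> ext coinv. act_map t = 0}"
  have Z_ext: "t \<in> ext coinv" if "t \<in> Z" for t using that by (simp add: Z_def)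
  have z0: "act_map 0 = 0" by (rule lin_zero[OF is_vspace_tensor lin_act_map])
  have sub: "subcomodule A (V \<otimes> A) rho Z"
    unfolding subcomodule_iff[OF A_vs is_vspace_tensor lin_comult_A lin_rho]
  proof (intro conjI allI impI ballI)
    show "is_subspace (V \<otimes> A) Z"
    proof (rule is_subspaceI[OF is_vspace_tensor])
      show "Z \<subseteq> vcar (V \<otimes> A)" using Z_ext ext_VA by blast
      show "0 \<in> Z" using z0 ext_zero by (simp only: Z_def mem_Collect_eq)
      show "s + t \<in> Z" if "s \<in> Z" "t \<in> Z" for s t
        using that ext_add lin_add[OF lin_act_map ext_VK ext_VK] by (simp only: Z_def mem_Collect_eq) simp
      show "vscale (V \<otimes> A) c t \<in> Z" if "t \<in> Z" for c t
        using that ext_scale lin_scale[OF lin_act_map ext_VK, of t c] by (simp add: Z_def vs_simps[OF V_vs])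
    qed
    fix f t assume f: "lin A base f" and t: "t \<in> Z"
    then show "C f t \<in> Z"
      using C_ext[OF f Z_ext[OF t]] lin_zero[OF V_vs lin_cop_A[OF f]]
      by (simp add: Z_def)
  qed
  have ne: "vcar (sub (V \<otimes> A) Z) \<noteq> {0}" using ker by (auto simp: Z_def)
  obtain g' t where g': "g' \<in> grouplikes A" and tZ: "t \<in> Z" and t0: "t \<noteq> 0" and rho_t: "rho t = tens A (V \<otimes> A) g' t"
    using pointed_comodule_eigenvector[OF A_coalgebra comodule_sub(1)[OF A_coalgebra comodule_rho sub] pt ne] by auto
  note te = Z_ext[OF tZ]
  note tVA = ext_VA[OF te]
  note \<epsilon> = lin_counit_A
  note \<eta> = lin_rslice[OF V_vs A_vs \<epsilon>]
  let ?w = "rslice V A (counit A) t"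
  have w: "?w \<in> vcar V" by (rule lin_in[OF \<eta> tVA])
  \<comment> \<open>On \<open>t\<close> the operators of \<open>rho\<close> are the scalars
    \<open>f g'\<close>; by \<open>lslice_twist\<close> the twist therefore has left factor
    \<open>g'\<close>.\<close>
  have "twist t = tens A V g' ?w"
  proof (rule tensor_eqI[OF A_vs V_vs lin_in[OF lin_twist tVA] tens_in[OF A_car(1) w]])
    fix f assume f: "lin A base f"
    have "C f t = tscale (f g') t"
      using lslice_tens[OF A_vs is_vspace_tensor f A_car(1) tVA] by (simp add: cop_def rho_t)
    then show "lslice A V f (twist t) = lslice A V f (tens A V g' ?w)"
      using lslice_twist[OF f tVA] lin_scale[OF \<eta> tVA] lslice_tens[OF A_vs V_vs f A_car(1) w] by simp
  qed
  then have t_eq: "t = untwist (tens A V g' ?w)" using untwist_twist[OF tVA] by simp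
  \<comment> \<open>The element on which \<open>untwist\<close> lets \<open>H\<close> act when it is
    applied to \<open>g' \<otimes> w\<close>.\<close>
  define y where "y = antipode A g * g'"
  have y: "y \<in> grouplikes A"
  proof -
    have u: "antipode A g \<in> grouplikes A" by (rule grouplike_inverse[OF g coact_g])
    have "yd_hom H (yd_of A) (yd_of A) (antipode A)" using hopf_A by (simp add: braided_hopf_algebra_def)
    \<comment> \<open>The product lemma for group-likes requires trivial coaction of its left
      factor; the antipode is colinear and inherits it from \<open>g\<close>.\<close>
    then have "coact A (antipode A g) = tlift H A (\<lambda>h a. tens H A h (antipode A a)) (coact A g)"
      by (simp add: yd_hom_def colinear_def tmap_def) (simp add: yd_of_def)
    also have "\<dots> = tens H A 1 (antipode A g)"
    proof -
      have l: "lin A A (antipode A)" using hopf_A by (simp add: braided_hopf_algebra_def antipode_axiom_def)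
      have "bilin H A (H \<otimes> A) (\<lambda>h a. tens H A h (antipode A a))" by (intro rules l lin_in[OF l])
      then show ?thesis unfolding coact_g by (rule tlift_tens[OF H_vs A_vs is_vspace_tensor _ H_car(1) A_car(1)])
    qed
    finally show ?thesis unfolding y_def using grouplike_mult[OF u _ g'] by blast
  qed
  let ?L = "module.span (vscale A) {y}"
  \<comment> \<open>Untwisting produces right factors in the \<open>H\<close>-orbit of
    \<open>y\<close>, which stays on the line through \<open>y\<close>; hence \<open>t\<close> is a
    pure tensor.\<close>
  have "t \<in> vcar (V \<otimes> sub A ?L)"
  proof -
    have b: "bilin H V (V \<otimes> A) (\<lambda>h v0. tens V A v0 (act A (inv (antipode H) h) y))"
      by (intro rules lin_comp[OF R(1)])
    have m: "tens V A v0 (act A (inv (antipode H) h) y) \<in> vcar (V \<otimes> sub A ?L)" if "v0 \<in> vcar V" for h v0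
      using tens_in[OF that, of "act A (inv (antipode H) h) y" "sub A ?L"] stable[OF y] by simp
    have "bilin H V (V \<otimes> sub A ?L) (\<lambda>h v0. tens V A v0 (act A (inv (antipode H) h) y))"
      using b m by (simp add: bilin_def lin_def)
    from tlift_in[OF this lin_in[OF lin_hco w] H_vs V_vs is_vspace_tensor]
    have "untwist (tens A V g' ?w) \<in> vcar (V \<otimes> sub A ?L)" unfolding untwist_tens[OF w] y_def .
    then show ?thesis by (subst t_eq)
  qed
  then obtain n where n: "n \<in> vcar V" "t = tens V A n y"
    using tensor_span_singleton[OF V_vs A_vs A_car(1)] by blast
  have "n \<noteq> 0"
  proof
    assume "n = 0"
    then have "t = 0" using n(2) tens_add1[of V A 0 0 y] by simp
    then show False using t0 by contradiction
  qed
  from functional_exists[OF V_vs n(1) this] obtain \<xi> where \<xi>: "lin V base \<xi>" "\<xi> n = 1" by blast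
  \<comment> \<open>Contracting the left factor of \<open>t\<close>, which lies over
    \<open>K\<close>, with a functional equal to \<open>1\<close> on \<open>n\<close> returns
    \<open>y\<close>.\<close>
  have yK: "y \<in> K"
    using lslice_sub[OF V_vs A_vs K_subspace ext_VK[OF te] \<xi>(1)] lslice_tens[OF V_vs A_vs \<xi>(1) n(1) A_car(1), of y]
    by (simp add: n(2) \<xi>(2) vs_simps[OF A_vs])
  have "rac V n y = 0" using tZ act_map_tens[OF n(1) yK] by (simp add: Z_def n(2))
  then have "rac V n (y * ring_inverse y) = 0"
    using rac_mult[OF n(1) yK inv[OF y yK]] rac_zero[OF inv[OF y yK]] by simp
  then show False using \<open>n \<noteq> 0\<close> rac_one[OF n(1)] ring_inverse_grouplike[OF y] by simp
qed

end

end

context coideal_setting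
begin

theorem free_submodule_exists:
  fixes V :: "('k, 'h, 'a, 'v::ab_group_add) hopfmod"
  assumes V: "hopf_module H A K V" and ne: "vcar V \<noteq> {0}"
    and bij: "bij (antipode H)" and pt: "pointed A"
    and inv: "\<And>u. u \<in> grouplikes A \<Longrightarrow> u \<in> K \<Longrightarrow> ring_inverse u \<in> K"
    and coinv: "\<And>u. u \<in> grouplikes A \<Longrightarrow> subcomodule H A (coact A) (module.span (vscale A) {u})"
    and stable: "\<And>u h. u \<in> grouplikes A \<Longrightarrow> act A h u \<in> module.span (vscale A) {u}"
  shows "\<exists>U. hopf_submodule H A K V U \<and> U \<noteq> {0} \<and> K_free H A K (V\<lparr>vcar := U\<rparr>)"
proof -
  interpret hopf_mod H A K V by unfold_locales (rule V)
  obtain g v where g: "g \<in> grouplikes A" and v: "v \<in> vcar V" "v \<noteq> 0" "aco V v = tens A V g v"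
    using pointed_comodule_eigenvector[OF A_coalgebra A_com pt ne] by blast
  interpret hopf_mod_grouplike H A K V g
    by unfold_locales (rule g, rule coact_grouplike[OF g coinv[OF g]])
  let ?U = "act_map ` ext coinv"
  have sub: "coinv \<subseteq> ?U" by (rule ext_image_contains[OF coinv_subspace])
  have "v \<in> coinv" using v by (simp add: coinv_def)
  then have "?U \<noteq> {0}" using sub v(2) by blast
  moreover have "bij_betw act_map (ext coinv) ?U"
    using act_map_injective[OF bij pt inv stable] by (simp add: bij_betw_def)
  then have "K_free H A K (V\<lparr>vcar := ?U\<rparr>)"
    unfolding K_free_iff[OF image_subspace] using sub coinv_subcomodule by blast
  ultimately show ?thesis using hopf_submodule_image by blast
qed

end

theorem proposition2p8:
  fixes H :: "('k::field, 'h::ring_1) hopf"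
    and A :: "('k, 'h, 'a::ring_1) bhopf"
    and K :: "'a set"
  assumes "hopf_algebra H" and "bij (antipode H)"
    and "braided_hopf_algebra H A"
    and "left_coideal_subalgebra H A K"
    and "cosemisimple TYPE('v::ab_group_add) H"
  shows
    "((\<forall>V :: ('k, 'h, 'a, 'v) hopfmod.
         hopf_module H A K V \<and> vcar V \<noteq> {0} \<longrightarrow>
         (\<exists>U. hopf_submodule H A K V U \<and> U \<noteq> {0} \<and> K_free H A K (V\<lparr>vcar := U\<rparr>)))
      \<longrightarrow> (\<forall>V :: ('k, 'h, 'a, 'v) hopfmod. hopf_module H A K V \<longrightarrow> K_free H A K V))
     \<and>
     (pointed A
      \<and> (\<forall>g \<in> grouplikes A \<inter> K. ring_inverse g \<in> K)
      \<and> (\<forall>g \<in> grouplikes A. subcomodule H A (coact A) (module.span (vscale A) {g}))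
      \<and> (\<forall>g \<in> grouplikes A. \<forall>h. \<forall>x \<in> module.span (vscale A) {g}.
            act A h x \<in> module.span (vscale A) {g})
      \<longrightarrow> (\<forall>V :: ('k, 'h, 'a, 'v) hopfmod. hopf_module H A K V \<longrightarrow> K_free H A K V))"
proof -
  interpret coideal_setting H A K by unfold_locales (rule assms)+
  \<comment> \<open>The hypothesis must cover all Hopf modules on this type, since the argument
    applies it to a quotient of \<open>V\<close>.\<close>
  have 1: "K_free H A K V"
    if free: "\<And>V :: ('k, 'h, 'a, 'v) hopfmod. hopf_module H A K V \<Longrightarrow> vcar V \<noteq> {0} \<Longrightarrow>
        \<exists>U. hopf_submodule H A K V U \<and> U \<noteq> {0} \<and> K_free H A K (V\<lparr>vcar := U\<rparr>)"
      and V: "hopf_module H A K V" for V :: "('k, 'h, 'a, 'v) hopfmod"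
  proof -
    interpret hopf_mod H A K V by unfold_locales (rule V)
    show ?thesis by (rule free_of_free_submodules[OF assms(5) free])
  qed
  \<comment> \<open>Under the conditions of (2) the hypothesis of (1) holds, so the freeness follows
    from \<open>1\<close>.\<close>
  have 2: "\<exists>U. hopf_submodule H A K V U \<and> U \<noteq> {0} \<and> K_free H A K (V\<lparr>vcar := U\<rparr>)"
    if pt: "pointed A" and inv: "\<forall>g \<in> grouplikes A \<inter> K. ring_inverse g \<in> K"
      and co: "\<forall>g \<in> grouplikes A. subcomodule H A (coact A) (module.span (vscale A) {g})"
      and st: "\<forall>g \<in> grouplikes A. \<forall>h. \<forall>x \<in> module.span (vscale A) {g}. act A h x \<in> module.span (vscale A) {g}"
      and V: "hopf_module H A K V" "vcar V \<noteq> {0}" for V :: "('k, 'h, 'a, 'v) hopfmod"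
  proof (rule free_submodule_exists[OF V assms(2) pt])
    interpret A: vector_space "vscale A" using A_vs by (simp add: is_vspace_def)
    show "act A h u \<in> A.span {u}" if "u \<in> grouplikes A" for u h
      using st that A.span_base[of u "{u}"] by blast
  qed (use inv co in auto)
  show ?thesis
  proof (rule conjI; intro impI allI)
    fix V :: "('k, 'h, 'a, 'v) hopfmod"
    assume free: "\<forall>V :: ('k, 'h, 'a, 'v) hopfmod. hopf_module H A K V \<and> vcar V \<noteq> {0} \<longrightarrow>
        (\<exists>U. hopf_submodule H A K V U \<and> U \<noteq> {0} \<and> K_free H A K (V\<lparr>vcar := U\<rparr>))"
      and V: "hopf_module H A K V"
    show "K_free H A K V" by (rule 1[OF free[rule_format, OF conjI] V])
  next
    fix V :: "('k, 'h, 'a, 'v) hopfmod"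
    assume h: "pointed A
      \<and> (\<forall>g \<in> grouplikes A \<inter> K. ring_inverse g \<in> K)
      \<and> (\<forall>g \<in> grouplikes A. subcomodule H A (coact A) (module.span (vscale A) {g}))
      \<and> (\<forall>g \<in> grouplikes A. \<forall>h. \<forall>x \<in> module.span (vscale A) {g}.
            act A h x \<in> module.span (vscale A) {g})"
      and V: "hopf_module H A K V"
    show "K_free H A K V"
      using h by (elim conjE) (rule 1[OF 2 V])
  qed
qed

end
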